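(* Let $n\geq 3$ and let $T$ be a strongly isotropic random field on $S^2$ with finite moments of order $n$. Then for every $l_1,\dots,l_n\geq 0$ there exist two arrays $P_{l_1\dots l_n}(\lambda_1,\dots,\lambda_{n-3})$ and $P^C_{l_1\dots l_n}(\lambda_1,\dots,\lambda_{n-3})$, indexed by integers with $|l_2-l_1|\leq\lambda_1\leq l_2+l_1$, $|l_3-\lambda_1|\leq\lambda_2\leq l_3+\lambda_1$, $\dots$, $|l_{n-2}-\lambda_{n-4}|\leq\lambda_{n-3}\leq l_{n-2}+\lambda_{n-4}$, such that for all $m_i\in\{-l_i,\dots,l_i\}$, $$E\left[a_{l_1m_1}\cdots a_{l_nm_n}\right]=(-1)^{m_n}\sum_{\lambda_1,\dots,\lambda_{n-3}}C^{\lambda_1\dots\lambda_{n-3};l_n,-m_n}_{l_1m_1\dots l_{n-1}m_{n-1}}P_{l_1\dots l_n}(\lambda_1,\dots,\lambda_{n-3}),$$ $$\mathrm{Cum}\left\{a_{l_1m_1},\dots,a_{l_nm_n}\right\}=(-1)^{m_n}\sum_{\lambda_1,\dots,\lambda_{n-3}}C^{\lambda_1\dots\lambda_{n-3};l_n,-m_n}_{l_1m_1\dots l_{n-1}m_{n-1}}P^C_{l_1\dots l_n}(\lambda_1,\dots,\lambda_{n-3}),$$ where the sums run over the ranges above and $$C^{\lambda_1\dots\lambda_{n-3};l_n,-m_n}_{l_1m_1\dots l_{n-1}m_{n-1}}=\sum_{\mu_1,\dots,\mu_{n-3}}C^{\lambda_1\mu_1}_{l_1m_1l_2m_2}C^{\lambda_2\mu_2}_{\lambda_1\mu_1l_3m_3}\cdots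 C^{l_n,-m_n}_{\lambda_{n-3}\mu_{n-3}l_{n-1}m_{n-1}}.$$ (For $n=3$ there are no $\lambda$'s and $C^{;l_3,-m_3}_{l_1m_1l_2m_2}=C^{l_3,-m_3}_{l_1m_1l_2m_2}$.)
   Context: $S^2$ is the unit sphere with surface measure $dx$ and $SO(3)$ the rotation group. A random field $T$ on $S^2$ is a collection of real-valued, centered, square-integrable random variables $\{T(x)\}$; it is strongly isotropic if $(T(x_1),\dots,T(x_k))\overset{d}{=}(T(gx_1),\dots,T(gx_k))$ for all $k$, $x_i\in S^2$, $g\in SO(3)$; finite moments of order $n$ means $E|T(x)|^n<\infty$. $Y_{lm}$ are the standard complex spherical harmonics and $a_{lm}=\int_{S^2}T(x)\overline{Y_{lm}(x)}dx$. $\mathrm{Cum}$ denotes the joint cumulant. $C^{lm}_{l_1m_1l_2m_2}$ are the standard real Clebsch–Gordan coefficients of $SO(3)$, i.e. the entries of the unitary matrix $C_{l_1l_2}$ (rows indexed by $(m_1,m_2)$, columns by $(l,m)$ with $|l_1-l_2|\leq l\leq l_1+l_2$, $|m|\leq l$) satisfying $D^{l_1}(g)\otimes D^{l_2}(g)=C_{l_1l_2}\left(\oplus_{l=|l_2-l_1|}^{l_1+l_2}D^l(g)\right)C^*_{l_1l_2}$, where $D^l$ are the Wigner $D$-matrices (irreducible unitary representations of $SO(3)$); they vanish unless $m=m_1+m_2$ and the triangle conditions hold. *)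

theory Defs
  imports "HOL-Probability.Probability" "HOL-Computational_Algebra.Polynomial"
begin

abbreviation S2 :: "(real^3) set" where "S2 \<equiv> sphere 0 1"

text \<open>Surface measure on S2: sigma(A) = 3 * Lebesgue measure of the cone
  {t x : x in A, 0 < t <= 1}, written as a push-forward of Lebesgue measure on the
  punctured unit ball under radial projection, scaled by 3.\<close>
definition S2_measure :: "(real^3) measure" where
  "S2_measure = scale_measure 3
     (distr (restrict_space lborel (ball 0 1 - {0})) (restrict_space borel S2)
            (\<lambda>x. x /\<^sub>R norm x))"

definition SO3 :: "(real^3^3) set" where
  "SO3 = {g. orthogonal_matrix g \<and> det g = 1}"

section \<open>Spherical harmonics (Condon-Shortley convention)\<close>

definition legendre_core :: "nat \<Rightarrow> nat \<Rightarrow> real poly" where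
  "legendre_core l m = smult (1 / (2 ^ l * fact l)) ((pderiv ^^ (l + m)) ([:-1, 0, 1:] ^ l))"

text \<open>For 0 <= m <= l:
  Y_lm(x) = N_lm (-1)^m (sin theta e^(i phi))^m Q_l^m(cos theta)
          = N_lm (-1)^m (x1 + i x2)^m Q_l^m(x3),
  and Y_{l,-m} = (-1)^m conj(Y_lm).\<close>
definition Yp :: "nat \<Rightarrow> nat \<Rightarrow> real^3 \<Rightarrow> complex" where
  "Yp l m x = complex_of_real (sqrt ((2 * real l + 1) / (4 * pi) * fact (l - m) / fact (l + m)))
      * (-1) ^ m * (complex_of_real (x $ 1) + \<i> * complex_of_real (x $ 2)) ^ m
      * complex_of_real (poly (legendre_core l m) (x $ 3))"

definition Y :: "nat \<Rightarrow> int \<Rightarrow> real^3 \<Rightarrow> complex" where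
  "Y l m x = (if \<bar>m\<bar> > int l then 0
              else if m \<ge> 0 then Yp l (nat m) x
              else (-1) ^ nat (-m) * cnj (Yp l (nat (-m)) x))"

definition random_field_S2 :: "'w measure \<Rightarrow> ('w \<Rightarrow> real^3 \<Rightarrow> real) \<Rightarrow> bool" where
  "random_field_S2 M T \<longleftrightarrow>
     (\<lambda>(\<omega>, x). T \<omega> x) \<in> borel_measurable (M \<Otimes>\<^sub>M S2_measure) \<and>
     (\<forall>x\<in>S2. integrable M (\<lambda>\<omega>. T \<omega> x) \<and> (\<integral>\<omega>. T \<omega> x \<partial>M) = 0 \<and>
              integrable M (\<lambda>\<omega>. (T \<omega> x)\<^sup>2))"

definition strongly_isotropic :: "'w measure \<Rightarrow> ('w \<Rightarrow> real^3 \<Rightarrow> real) \<Rightarrow> bool" where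
  "strongly_isotropic M T \<longleftrightarrow>
     (\<forall>(k::nat) (xs :: nat \<Rightarrow> real^3) g. (\<forall>i<k. xs i \<in> S2) \<longrightarrow> g \<in> SO3 \<longrightarrow>
        distr M (PiM {..<k} (\<lambda>_. borel)) (\<lambda>\<omega>. \<lambda>i\<in>{..<k}. T \<omega> (xs i)) =
        distr M (PiM {..<k} (\<lambda>_. borel)) (\<lambda>\<omega>. \<lambda>i\<in>{..<k}. T \<omega> (g *v xs i)))"

definition alm :: "('w \<Rightarrow> real^3 \<Rightarrow> real) \<Rightarrow> nat \<Rightarrow> int \<Rightarrow> 'w \<Rightarrow> complex" where
  "alm T l m \<omega> = (\<integral>x. complex_of_real (T \<omega> x) * cnj (Y l m x) \<partial>S2_measure)"

definition cumulant :: "'w measure \<Rightarrow> (nat \<Rightarrow> 'w \<Rightarrow> complex) \<Rightarrow> nat set \<Rightarrow> complex" where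
  "cumulant M X I = (\<Sum>\<pi>\<in>{\<pi>. partition_on I \<pi>}.
      (-1) ^ (card \<pi> - 1) * of_nat (fact (card \<pi> - 1)) *
      (\<Prod>B\<in>\<pi>. \<integral>\<omega>. (\<Prod>i\<in>B. X i \<omega>) \<partial>M))"

section \<open>Clebsch-Gordan coefficients (Racah's formula, Condon-Shortley phase)\<close>

definition ifact :: "int \<Rightarrow> real" where "ifact k = fact (nat k)"

definition CG :: "int \<Rightarrow> int \<Rightarrow> int \<Rightarrow> int \<Rightarrow> int \<Rightarrow> int \<Rightarrow> real" where
  "CG j1 m1 j2 m2 J M =
    (if 0 \<le> j1 \<and> 0 \<le> j2 \<and> \<bar>j1 - j2\<bar> \<le> J \<and> J \<le> j1 + j2 \<and>
        \<bar>m1\<bar> \<le> j1 \<and> \<bar>m2\<bar> \<le> j2 \<and> \<bar>M\<bar> \<le> J \<and> M = m1 + m2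
     then sqrt ((2 * of_int J + 1) * ifact (J + j1 - j2) * ifact (J - j1 + j2) * ifact (j1 + j2 - J)
                / ifact (j1 + j2 + J + 1))
        * sqrt (ifact (J + M) * ifact (J - M) * ifact (j1 - m1) * ifact (j1 + m1)
                * ifact (j2 - m2) * ifact (j2 + m2))
        * (\<Sum>k\<in>{k. 0 \<le> k \<and> k \<le> j1 + j2 - J \<and> k \<le> j1 - m1 \<and> k \<le> j2 + m2 \<and>
                     0 \<le> J - j2 + m1 + k \<and> 0 \<le> J - j1 - m2 + k}.
             (-1) ^ nat k / (ifact k * ifact (j1 + j2 - J - k) * ifact (j1 - m1 - k)
                * ifact (j2 + m2 - k) * ifact (J - j2 + m1 + k) * ifact (J - j1 - m2 + k)))
     else 0)"

definition lam_set :: "nat \<Rightarrow> (nat \<Rightarrow> nat) \<Rightarrow> (nat \<Rightarrow> int) set" where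
  "lam_set n l = {lam. (\<forall>i\<in>{1..n-3}.
        \<bar>int (l (i+1)) - (if i = 1 then int (l 1) else lam (i-1))\<bar> \<le> lam i \<and>
        lam i \<le> int (l (i+1)) + (if i = 1 then int (l 1) else lam (i-1))) \<and>
      (\<forall>i. i \<notin> {1..n-3} \<longrightarrow> lam i = 0)}"

definition mu_set :: "nat \<Rightarrow> (nat \<Rightarrow> int) \<Rightarrow> (nat \<Rightarrow> int) set" where
  "mu_set n lam = {mu. (\<forall>i\<in>{1..n-3}. \<bar>mu i\<bar> \<le> lam i) \<and> (\<forall>i. i \<notin> {1..n-3} \<longrightarrow> mu i = 0)}"

definition chainL :: "(nat \<Rightarrow> nat) \<Rightarrow> (nat \<Rightarrow> int) \<Rightarrow> nat \<Rightarrow> int" where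
  "chainL l lam i = (if i = 0 then int (l 1) else lam i)"

definition chainM :: "(nat \<Rightarrow> int) \<Rightarrow> (nat \<Rightarrow> int) \<Rightarrow> nat \<Rightarrow> int" where
  "chainM m mu i = (if i = 0 then m 1 else mu i)"

definition coupledCG :: "nat \<Rightarrow> (nat \<Rightarrow> nat) \<Rightarrow> (nat \<Rightarrow> int) \<Rightarrow> (nat \<Rightarrow> int) \<Rightarrow> real" where
  "coupledCG n l m lam = (\<Sum>mu\<in>mu_set n lam.
      (\<Prod>i\<in>{1..n-3}. CG (chainL l lam (i-1)) (chainM m mu (i-1)) (int (l (i+1))) (m (i+1))
                          (lam i) (mu i))
      * CG (chainL l lam (n-3)) (chainM m mu (n-3)) (int (l (n-1))) (m (n-1))
           (int (l n)) (- m n))"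

end

theory Submission
  imports Defs
begin

text \<open>The moments and cumulants of the coefficients are rotation-invariant multilinear functionals of the
  spherical harmonics. Differentiating the invariance along the rotations about the three axes shows that,
  as tensors in \<open>m\<^sub>1, \<dots>, m\<^sub>n\<close>, they have total weight 0 and are annihilated by the sum of the ladder
  operators acting on the single indices. The Clebsch-Gordan coefficients intertwine the ladder operators
  and form a complete orthogonal system, so the first two indices can be coupled to a single
  one, giving an invariant tensor of lower order for every intermediate spin. After \<open>n - 2\<close> couplings
  an invariant tensor with two indices remains, and such a tensor is a multiple of
  \<open>(-1)\<^bsup>m\<^esup>\<close> if the spins agree and the weights are opposite, and vanishes otherwise.\<close>

section \<open>Clebsch-Gordan coefficients\<close>

text \<open>The coefficients \<open>CG\<close> are given by Racah's closed formula and the harmonics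
  by derivatives of polynomials, so no representation of SO(3) is at hand. Intertwining,
  orthogonality and completeness of \<open>CG\<close> come from recursions of a finite sum, the
  action on harmonics from a differential equation. Working infinitesimally replaces the Wigner
  matrices by two scalar identities, one for a ladder operator and one for the weight; they pin down
  a tensor with two indices up to a constant. The field carries no smoothness in \<open>x\<close>:
  isotropy and invariance of the surface measure move every rotation onto the harmonics, and only
  these are differentiated. Cumulants follow the same path because a ladder operator acts as a
  derivation: on a product over the blocks of a partition it acts inside one block at a time, and
  each block is a moment of order at most \<open>n\<close>. The sign in front of the sums is the
  alternating solution of the two-index recursion, and the entries of the arrays are the constants
  of these solutions, one for each chain of intermediate spins.\<close>

text \<open>The reciprocal factorial, extended by 0 to negative integers: Racah's sum may then be taken over
  all \<open>k\<close>, it vanishes by itself for inadmissible \<open>m\<close>, and its recursions hold without side conditions.\<close>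

definition inv_fact :: "int \<Rightarrow> real" where
  "inv_fact k = (if 0 \<le> k then 1 / fact (nat k) else 0)"

lemma inv_fact_rec: "of_int k * inv_fact k = inv_fact (k - 1)"
proof (cases "1 \<le> k")
  case True
  then have "nat k = Suc (nat (k - 1))" by linarith
  then show ?thesis using True by (simp add: inv_fact_def of_nat_nat field_simps del: of_nat_Suc)
next
  case False
  then show ?thesis by (cases "k = 0") (auto simp: inv_fact_def)
qed

lemma inv_fact_mult_eq_0: "x + y < 0 \<Longrightarrow> inv_fact x * inv_fact y = 0"
  by (auto simp: inv_fact_def)

text \<open>Up to normalisation a terminating hypergeometric series 3F2(-a, -b, -c; d+1, e+1; 1).
  With the five parameters free, a single recursion yields both ladder relations.\<close>

definition racah_sum :: "int \<Rightarrow> int \<Rightarrow> int \<Rightarrow> int \<Rightarrow> int \<Rightarrow> real" where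
  "racah_sum a b c d e = (\<Sum>k\<in>{0..a}. (-1) ^ nat k * (inv_fact k * inv_fact (a - k) * inv_fact (b - k) * inv_fact (c - k)
      * inv_fact (d + k) * inv_fact (e + k)))"

text \<open>Exchanging the roles of the two coupled spins; it turns the recursion for lowering into
  the one for raising.\<close>

lemma racah_sum_swap: "racah_sum a b c d e = racah_sum a c b e d"
  by (simp add: racah_sum_def mult_ac)

lemma sum_int_telescope:
  fixes h :: "int \<Rightarrow> real"
  assumes "0 \<le> a"
  shows "(\<Sum>k\<in>{0..a}. h (k - 1) - h k) = h (-1) - h a"
  using assms
proof (induction a rule: int_ge_induct)
  case (step i)
  then have "{0..i + 1} = insert (i + 1) {0..i}" by auto
  with step show ?case by simp
qed simp

text \<open>The termwise defect of the recursion telescopes in \<open>k\<close>.\<close>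

lemma racah_sum_rec:
  "of_int (b + e) * racah_sum a b c d e =
     of_int (a + d + 1) * racah_sum a (b - 1) c (d + 1) e + of_int (c + 1) * racah_sum a b (c + 1) d (e - 1)"
proof (cases "0 \<le> a")
  case True
  \<comment> \<open>The telescoping certificate: the summand with \<open>a - k\<close> and
    \<open>b - k\<close> lowered and \<open>d + k\<close> raised by one.\<close>
  define h where "h k = (-1) ^ nat k * (inv_fact k * inv_fact (a - k - 1) * inv_fact (b - k - 1) * inv_fact (c - k)
      * inv_fact (d + k + 1) * inv_fact (e + k))" for k
  have "of_int (a + d + 1) * ((-1) ^ nat k * (inv_fact k * inv_fact (a - k) * inv_fact (b - 1 - k) * inv_fact (c - k)
            * inv_fact (d + 1 + k) * inv_fact (e + k)))
      + of_int (c + 1) * ((-1) ^ nat k * (inv_fact k * inv_fact (a - k) * inv_fact (b - k) * inv_fact (c + 1 - k)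
            * inv_fact (d + k) * inv_fact (e - 1 + k)))
      - of_int (b + e) * ((-1) ^ nat k * (inv_fact k * inv_fact (a - k) * inv_fact (b - k) * inv_fact (c - k)
            * inv_fact (d + k) * inv_fact (e + k))) = h k - h (k - 1)" (is "?L1 + ?L2 - ?L3 = _")
    if "k \<in> {0..a}" for k
  proof -
    \<comment> \<open>Passing to \<open>k - 1\<close> flips the sign. At \<open>k = 0\<close> the
      truncation in \<open>nat\<close> breaks this, but there both sides contain the reciprocal
      factorial of -1.\<close>
    have h1: "h (k - 1) = - ((-1) ^ nat k * (inv_fact (k - 1) * inv_fact (a - k) * inv_fact (b - k) * inv_fact (c + 1 - k)
      * inv_fact (d + k) * inv_fact (e - 1 + k)))"
    proof (cases "k = 0")
      case False
      then have "nat k = Suc (nat (k - 1))" using that by auto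
      then show ?thesis by (simp add: h_def algebra_simps)
    qed (simp add: h_def inv_fact_def)
    have a: "inv_fact (a - k - 1) = of_int (a - k) * inv_fact (a - k)" using inv_fact_rec[of "a - k"] by simp
    have b: "inv_fact (b - k - 1) = of_int (b - k) * inv_fact (b - k)" using inv_fact_rec[of "b - k"] by simp
    have b': "inv_fact (b - 1 - k) = of_int (b - k) * inv_fact (b - k)" using b by (simp add: algebra_simps)
    have c: "inv_fact (c - k) = of_int (c + 1 - k) * inv_fact (c + 1 - k)"
      using inv_fact_rec[of "c + 1 - k"] by simp
    have d: "inv_fact (d + k) = of_int (d + 1 + k) * inv_fact (d + 1 + k)"
      using inv_fact_rec[of "d + 1 + k"] by simp
    have e: "inv_fact (e - 1 + k) = of_int (e + k) * inv_fact (e + k)"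
      using inv_fact_rec[of "e + k"] by (simp add: algebra_simps)
    have k: "inv_fact (k - 1) = of_int k * inv_fact k" using inv_fact_rec[of k] by simp
    have d': "d + k + 1 = d + 1 + k" by simp
    have "?L1 = (-1) ^ nat k * (inv_fact k * inv_fact (a - k - 1) * inv_fact (b - k - 1) * inv_fact (c - k) * inv_fact (d + 1 + k) * inv_fact (e + k))
       + of_int (b - k) * ((-1) ^ nat k * (inv_fact k * inv_fact (a - k) * inv_fact (b - k) * inv_fact (c - k) * inv_fact (d + k) * inv_fact (e + k)))"
      unfolding a b b' d by (simp add: algebra_simps)
    moreover have "?L2 = of_int (e + k) * ((-1) ^ nat k * (inv_fact k * inv_fact (a - k) * inv_fact (b - k) * inv_fact (c - k) * inv_fact (d + k) * inv_fact (e + k)))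
       + (-1) ^ nat k * (inv_fact (k - 1) * inv_fact (a - k) * inv_fact (b - k) * inv_fact (c + 1 - k) * inv_fact (d + k) * inv_fact (e - 1 + k))"
      unfolding e k c by (simp add: algebra_simps)
    ultimately show ?thesis unfolding h1 unfolding h_def d' by (simp add: algebra_simps)
  qed
  then have "of_int (a + d + 1) * racah_sum a (b - 1) c (d + 1) e + of_int (c + 1) * racah_sum a b (c + 1) d (e - 1)
     - of_int (b + e) * racah_sum a b c d e = (\<Sum>k\<in>{0..a}. h k - h (k - 1))"
    unfolding racah_sum_def sum_distrib_left sum.distrib[symmetric] sum_subtractf[symmetric]
    by (intro sum.cong) auto
  also have "\<dots> = - (\<Sum>k\<in>{0..a}. h (k - 1) - h k)"
    by (simp add: sum_negf[symmetric])
  \<comment> \<open>Both boundary terms vanish: \<open>h (-1)\<close> through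
    \<open>inv_fact k\<close>, \<open>h a\<close> through
    \<open>inv_fact (a - k - 1)\<close>.\<close>
  also have "\<dots> = 0"
    unfolding sum_int_telescope[OF True] by (simp add: h_def inv_fact_def)
  finally show ?thesis by simp
qed (simp add: racah_sum_def)

section \<open>Ladder relations of the Clebsch-Gordan coefficients\<close>

definition ladder :: "int \<Rightarrow> int \<Rightarrow> real" where
  "ladder j m = sqrt (of_int ((j - m) * (j + m + 1)))"

text \<open>The norm of the monomial x^(j+m) y^(j-m) in the Fock inner product on binary forms of
  degree 2j. The cutoff is explicit because \<open>ifact\<close> is 1 on negative integers.\<close>

definition weight_norm :: "int \<Rightarrow> int \<Rightarrow> real" where
  "weight_norm j m = (if \<bar>m\<bar> \<le> j then sqrt (ifact (j + m) * ifact (j - m)) else 0)"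

definition triangle :: "int \<Rightarrow> int \<Rightarrow> int \<Rightarrow> bool" where
  "triangle j1 j2 J \<longleftrightarrow> 0 \<le> j1 \<and> 0 \<le> j2 \<and> \<bar>j1 - j2\<bar> \<le> J \<and> J \<le> j1 + j2"

text \<open>Racah's sum without the square roots, which carry the normalisation of the weight vectors.\<close>

definition racah :: "int \<Rightarrow> int \<Rightarrow> int \<Rightarrow> int \<Rightarrow> int \<Rightarrow> real" where
  "racah j1 m1 j2 m2 J = racah_sum (j1 + j2 - J) (j1 - m1) (j2 + m2) (J - j2 + m1) (J - j1 - m2)"

text \<open>For every \<open>k\<close> some reciprocal factorial has a negative argument. Where no
  single argument is negative for all \<open>k\<close>, two of them have a negative sum in which
  \<open>k\<close> cancels.\<close>

lemma racah_eq_0: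
  assumes "\<not> (\<bar>m1\<bar> \<le> j1 \<and> \<bar>m2\<bar> \<le> j2 \<and> \<bar>m1 + m2\<bar> \<le> J)"
  shows "racah j1 m1 j2 m2 J = 0"
  unfolding racah_def racah_sum_def
proof (rule sum.neutral, rule ballI, goal_cases)
  case (1 k)
  from 1 have "k \<ge> 0" by auto
  from assms consider "m1 > j1" | "m1 < - j1" | "m2 > j2" | "m2 < - j2" | "m1 + m2 > J" | "m1 + m2 < - J"
    by linarith
  then show ?case
  proof cases
    case 1 then show ?thesis using \<open>k \<ge> 0\<close> by (simp add: inv_fact_def)
  next
    case 2
    then have "inv_fact (j1 + j2 - J - k) * inv_fact (J - j2 + m1 + k) = 0" by (intro inv_fact_mult_eq_0) auto
    then show ?thesis by auto
  next
    case 3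
    then have "inv_fact (j1 + j2 - J - k) * inv_fact (J - j1 - m2 + k) = 0" by (intro inv_fact_mult_eq_0) auto
    then show ?thesis by auto
  next
    case 4 then show ?thesis using \<open>k \<ge> 0\<close> by (simp add: inv_fact_def)
  next
    case 5
    then have "inv_fact (j1 - m1 - k) * inv_fact (J - j1 - m2 + k) = 0" by (intro inv_fact_mult_eq_0) auto
    then show ?thesis by auto
  next
    case 6
    then have "inv_fact (j2 + m2 - k) * inv_fact (J - j2 + m1 + k) = 0" by (intro inv_fact_mult_eq_0) auto
    then show ?thesis by auto
  qed
qed

text \<open>The recursion of \<open>racah_sum\<close> with the two spins exchanged; without the
  exchange it gives \<open>racah_down\<close>. Both are ladder relations in an unnormalised weight
  basis, where all matrix entries are integers.\<close>

lemma racah_up: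
  "of_int (J + (m1 + m2)) * racah j1 m1 j2 m2 J =
     of_int (j1 - m1 + 1) * racah j1 (m1 - 1) j2 m2 J + of_int (j2 - m2 + 1) * racah j1 m1 j2 (m2 - 1) J"
  using racah_sum_rec[of "j2 + m2" "J - j2 + m1" "j1 + j2 - J" "j1 - m1" "J - j1 - m2"]
  unfolding racah_def racah_sum_swap[of _ "j2 + m2"] racah_sum_swap[of _ "j2 + m2 - 1"]
  by (simp add: algebra_simps)

lemma racah_down:
  "of_int (J - m1 - m2) * racah j1 m1 j2 m2 J =
     of_int (j1 + m1 + 1) * racah j1 (m1 + 1) j2 m2 J + of_int (j2 + m2 + 1) * racah j1 m1 j2 (m2 + 1) J"
  using racah_sum_rec[of "j1 - m1" "J - j1 - m2" "j1 + j2 - J" "j2 + m2" "J - j2 + m1"]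
  unfolding racah_def by (simp add: algebra_simps)

definition CG_norm :: "int \<Rightarrow> int \<Rightarrow> int \<Rightarrow> real" where
  "CG_norm j1 j2 J = sqrt ((2 * of_int J + 1) * ifact (J + j1 - j2) * ifact (J - j1 + j2)
     * ifact (j1 + j2 - J) / ifact (j1 + j2 + J + 1))"

lemma ifact_pos: "ifact k > 0"
  by (simp add: ifact_def)

lemma CG_norm_pos: "triangle j1 j2 J \<Longrightarrow> CG_norm j1 j2 J > 0"
  unfolding CG_norm_def triangle_def
  by (intro real_sqrt_gt_zero divide_pos_pos mult_pos_pos ifact_pos) auto

lemma inv_fact_eq: "0 \<le> k \<Longrightarrow> inv_fact k = inverse (ifact k)"
  by (simp add: inv_fact_def ifact_def inverse_eq_divide)

text \<open>Racah's range of \<open>k\<close> is exactly the set where no reciprocal factorial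
  vanishes, so summing further adds only zeros. The prefactor splits into \<open>CG_norm\<close>,
  which depends on the spins alone and is common to all terms of a ladder relation, and the norms of
  the three weight vectors.\<close>

lemma CG_eq_racah:
  assumes "triangle j1 j2 J"
  shows "CG j1 m1 j2 m2 J (m1 + m2) =
    CG_norm j1 j2 J * (weight_norm J (m1 + m2) * weight_norm j1 m1 * weight_norm j2 m2) * racah j1 m1 j2 m2 J"
proof (cases "\<bar>m1\<bar> \<le> j1 \<and> \<bar>m2\<bar> \<le> j2 \<and> \<bar>m1 + m2\<bar> \<le> J")
  case True
  have "racah j1 m1 j2 m2 J =
    (\<Sum>k\<in>{k. 0 \<le> k \<and> k \<le> j1 + j2 - J \<and> k \<le> j1 - m1 \<and> k \<le> j2 + m2 \<and>
                     0 \<le> J - j2 + m1 + k \<and> 0 \<le> J - j1 - m2 + k}.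
             (-1) ^ nat k / (ifact k * ifact (j1 + j2 - J - k) * ifact (j1 - m1 - k)
                * ifact (j2 + m2 - k) * ifact (J - j2 + m1 + k) * ifact (J - j1 - m2 + k)))"
    unfolding racah_def racah_sum_def
    by (rule sum.mono_neutral_cong_right)
       (auto simp: inv_fact_eq divide_simps less_le_not_le, auto simp: inv_fact_def ifact_def split: if_splits)
  moreover have "weight_norm J (m1 + m2) * weight_norm j1 m1 * weight_norm j2 m2 =
    sqrt (ifact (J + (m1 + m2)) * ifact (J - (m1 + m2)) * ifact (j1 - m1) * ifact (j1 + m1)
                * ifact (j2 - m2) * ifact (j2 + m2))"
    using True by (simp add: weight_norm_def real_sqrt_mult mult_ac)
  ultimately show ?thesis
    using True assms unfolding CG_def triangle_def CG_norm_def by simp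
qed (auto simp: CG_def racah_eq_0)

lemma CG_eq_0: "M \<noteq> m1 + m2 \<or> \<bar>m1\<bar> > j1 \<or> \<bar>m2\<bar> > j2 \<or> \<bar>M\<bar> > J \<Longrightarrow> CG j1 m1 j2 m2 J M = 0"
  by (auto simp: CG_def)

lemma ifact_rec: "1 \<le> k \<Longrightarrow> ifact k = of_int k * ifact (k - 1)"
proof -
  assume "1 \<le> k"
  then have "nat k = Suc (nat (k - 1))" by linarith
  then show ?thesis using \<open>1 \<le> k\<close> by (simp add: ifact_def of_nat_nat del: of_nat_Suc)
qed

text \<open>The change of basis between normalised weight vectors, with entries
  \<open>ladder\<close>, and monomials, with the integer entries that occur in
  \<open>racah_up\<close> and \<open>racah_down\<close>.\<close>

lemma ladder_weight_norm_up:
  assumes "- j \<le> m" "m < j"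
  shows "ladder j m * weight_norm j (m + 1) = of_int (j + m + 1) * weight_norm j m"
proof -
  have "ifact (j + m + 1) = of_int (j + m + 1) * ifact (j + m)"
    using ifact_rec[of "j + m + 1"] assms by simp
  moreover have "ifact (j - m) = of_int (j - m) * ifact (j - m - 1)"
    using ifact_rec[of "j - m"] assms by simp
  moreover have "weight_norm j (m + 1) = sqrt (ifact (j + m + 1) * ifact (j - m - 1))"
    using assms by (simp add: weight_norm_def algebra_simps)
  ultimately have "ladder j m * weight_norm j (m + 1) = sqrt ((of_int (j + m + 1) * of_int (j + m + 1)) *
      (ifact (j + m) * ifact (j - m)))"
    unfolding ladder_def by (simp add: real_sqrt_mult[symmetric] mult_ac)
  also have "\<dots> = of_int (j + m + 1) * sqrt (ifact (j + m) * ifact (j - m))"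
    using assms unfolding real_sqrt_mult[of "_ * _"] by simp
  finally show ?thesis using assms by (simp add: weight_norm_def)
qed

lemma ladder_weight_norm_down:
  assumes "- j \<le> m" "m < j"
  shows "ladder j m * weight_norm j m = of_int (j - m) * weight_norm j (m + 1)"
proof -
  have "ladder j m * ladder j m = of_int (j - m) * of_int (j + m + 1)"
    using assms by (simp add: ladder_def)
  moreover have "ladder j m * (ladder j m * weight_norm j (m + 1)) = ladder j m * (of_int (j + m + 1) * weight_norm j m)"
    using ladder_weight_norm_up[OF assms] by simp
  ultimately have "of_int (j + m + 1) * (ladder j m * weight_norm j m) = of_int (j + m + 1) * (of_int (j - m) * weight_norm j (m + 1))"
    by (metis mult.assoc mult.left_commute)
  moreover have "real_of_int (j + m + 1) \<noteq> 0" using assms by linarith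
  ultimately show ?thesis by simp
qed

text \<open>The zeros at both ends of the weight range; they remove the boundary terms whenever a
  summation over weights is shifted by one.\<close>

lemma ladder_boundary [simp]: "ladder j j = 0" "ladder j (- j - 1) = 0" "ladder j (-1 - j) = 0"
  by (auto simp: ladder_def)

text \<open>This is \<open>racah_up\<close> multiplied by the weight norms. It is stated for all
  integer weights, so that sums can be shifted without case distinctions: outside the range each
  term has a vanishing coefficient or a vanishing \<open>ladder\<close>.\<close>

lemma CG_up:
  assumes "triangle j1 j2 J"
  shows "ladder J M * CG j1 m1 j2 m2 J (M + 1) =
    ladder j1 (m1 - 1) * CG j1 (m1 - 1) j2 m2 J M + ladder j2 (m2 - 1) * CG j1 m1 j2 (m2 - 1) J M"
proof (cases "M = m1 + m2 - 1 \<and> \<bar>m1\<bar> \<le> j1 \<and> \<bar>m2\<bar> \<le> j2 \<and> \<bar>M\<bar> \<le> J")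
  case True
  then have M: "M = m1 + m2 - 1" by simp
  define c where "c = CG_norm j1 j2 J"
  define R where "R = racah j1 m1 j2 m2 J"
  define R1 where "R1 = racah j1 (m1 - 1) j2 m2 J"
  define R2 where "R2 = racah j1 m1 j2 (m2 - 1) J"
  define S where "S = weight_norm J M"
  have eqs: "CG j1 m1 j2 m2 J (M + 1) = c * (weight_norm J (M + 1) * weight_norm j1 m1 * weight_norm j2 m2) * R"
     "CG j1 (m1 - 1) j2 m2 J M = c * (S * weight_norm j1 (m1 - 1) * weight_norm j2 m2) * R1"
     "CG j1 m1 j2 (m2 - 1) J M = c * (S * weight_norm j1 m1 * weight_norm j2 (m2 - 1)) * R2"
    using CG_eq_racah[OF assms, of m1 m2] CG_eq_racah[OF assms, of "m1 - 1" m2] CG_eq_racah[OF assms, of m1 "m2 - 1"]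
    by (simp_all add: M c_def R_def R1_def R2_def S_def algebra_simps)
  \<comment> \<open>At the edge of the weight range the conversion fails for the norms alone; there
    the factor \<open>racah\<close> is zero. The same holds for the two conversions that
    follow.\<close>
  have "ladder J M * weight_norm J (M + 1) * R = of_int (J + M + 1) * S * R"
  proof (cases "M = J")
    case True
    then have "R = 0" unfolding R_def using M by (intro racah_eq_0) auto
    then show ?thesis by simp
  next
    case False
    then have "- J \<le> M" "M < J" using True by auto
    then show ?thesis using ladder_weight_norm_up[of J M] by (simp add: S_def)
  qed
  moreover have "ladder j1 (m1 - 1) * weight_norm j1 (m1 - 1) * R1 = of_int (j1 - m1 + 1) * weight_norm j1 m1 * R1"
  proof (cases "m1 = - j1")
    case True
    then have "R1 = 0" unfolding R1_def by (intro racah_eq_0) auto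
    then show ?thesis by simp
  next
    case False
    then have "- j1 \<le> m1 - 1" "m1 - 1 < j1" using True by auto
    then show ?thesis using ladder_weight_norm_down[of j1 "m1 - 1"] by simp
  qed
  moreover have "ladder j2 (m2 - 1) * weight_norm j2 (m2 - 1) * R2 = of_int (j2 - m2 + 1) * weight_norm j2 m2 * R2"
  proof (cases "m2 = - j2")
    case True
    then have "R2 = 0" unfolding R2_def by (intro racah_eq_0) auto
    then show ?thesis by simp
  next
    case False
    then have "- j2 \<le> m2 - 1" "m2 - 1 < j2" using True by auto
    then show ?thesis using ladder_weight_norm_down[of j2 "m2 - 1"] by simp
  qed
  moreover have "of_int (J + M + 1) * R = of_int (j1 - m1 + 1) * R1 + of_int (j2 - m2 + 1) * R2"
    using racah_up[of J m1 m2 j1 j2] by (simp add: M R_def R1_def R2_def add.assoc)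
  ultimately have "ladder J M * (c * (weight_norm J (M + 1) * weight_norm j1 m1 * weight_norm j2 m2) * R) =
     ladder j1 (m1 - 1) * (c * (S * weight_norm j1 (m1 - 1) * weight_norm j2 m2) * R1) +
     ladder j2 (m2 - 1) * (c * (S * weight_norm j1 m1 * weight_norm j2 (m2 - 1)) * R2)"
    by algebra
  then show ?thesis unfolding eqs .
next
  case False
  then consider "M \<noteq> m1 + m2 - 1" | "\<bar>m1\<bar> > j1" | "\<bar>m2\<bar> > j2" | "\<bar>M\<bar> > J" by linarith
  then show ?thesis
  proof cases
    case 2
    then have "m1 - 1 = j1 \<or> \<bar>m1 - 1\<bar> > j1" using assms by (auto simp: triangle_def)
    then show ?thesis using 2 by (auto simp: CG_eq_0)
  next
    case 3
    then have "m2 - 1 = j2 \<or> \<bar>m2 - 1\<bar> > j2" using assms by (auto simp: triangle_def)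
    then show ?thesis using 3 by (auto simp: CG_eq_0)
  next
    case 4
    then have "M = - J - 1 \<or> \<bar>M + 1\<bar> > J" using assms by (auto simp: triangle_def)
    then show ?thesis using 4 by (auto simp: CG_eq_0)
  qed (auto simp: CG_eq_0)
qed

text \<open>The companion relation for lowering, obtained from \<open>racah_down\<close>; with
  \<open>CG_up\<close> it expresses the adjointness used in \<open>gram_rec\<close>.\<close>

lemma CG_down:
  assumes "triangle j1 j2 J"
  shows "ladder J M * CG j1 m1 j2 m2 J M =
    ladder j1 m1 * CG j1 (m1 + 1) j2 m2 J (M + 1) + ladder j2 m2 * CG j1 m1 j2 (m2 + 1) J (M + 1)"
proof (cases "M = m1 + m2 \<and> \<bar>m1\<bar> \<le> j1 \<and> \<bar>m2\<bar> \<le> j2 \<and> \<bar>M + 1\<bar> \<le> J")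
  case True
  then have M: "M = m1 + m2" by simp
  define c where "c = CG_norm j1 j2 J"
  define R where "R = racah j1 m1 j2 m2 J"
  define R1 where "R1 = racah j1 (m1 + 1) j2 m2 J"
  define R2 where "R2 = racah j1 m1 j2 (m2 + 1) J"
  define S where "S = weight_norm J (M + 1)"
  have eqs: "CG j1 m1 j2 m2 J M = c * (weight_norm J M * weight_norm j1 m1 * weight_norm j2 m2) * R"
     "CG j1 (m1 + 1) j2 m2 J (M + 1) = c * (S * weight_norm j1 (m1 + 1) * weight_norm j2 m2) * R1"
     "CG j1 m1 j2 (m2 + 1) J (M + 1) = c * (S * weight_norm j1 m1 * weight_norm j2 (m2 + 1)) * R2"
    using CG_eq_racah[OF assms, of m1 m2] CG_eq_racah[OF assms, of "m1 + 1" m2] CG_eq_racah[OF assms, of m1 "m2 + 1"]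
    by (simp_all add: M c_def R_def R1_def R2_def S_def algebra_simps)
  have "ladder J M * weight_norm J M * R = of_int (J - M) * S * R"
  proof (cases "M = - J - 1")
    case True
    then have "R = 0" unfolding R_def using M by (intro racah_eq_0) auto
    then show ?thesis by simp
  next
    case False
    then have "- J \<le> M" "M < J" using True by auto
    then show ?thesis using ladder_weight_norm_down[of J M] by (simp add: S_def)
  qed
  moreover have "ladder j1 m1 * weight_norm j1 (m1 + 1) * R1 = of_int (j1 + m1 + 1) * weight_norm j1 m1 * R1"
  proof (cases "m1 = j1")
    case True
    then have "R1 = 0" unfolding R1_def by (intro racah_eq_0) auto
    then show ?thesis by simp
  next
    case False
    then have "- j1 \<le> m1" "m1 < j1" using True by auto
    then show ?thesis using ladder_weight_norm_up[of j1 m1] by simp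
  qed
  moreover have "ladder j2 m2 * weight_norm j2 (m2 + 1) * R2 = of_int (j2 + m2 + 1) * weight_norm j2 m2 * R2"
  proof (cases "m2 = j2")
    case True
    then have "R2 = 0" unfolding R2_def by (intro racah_eq_0) auto
    then show ?thesis by simp
  next
    case False
    then have "- j2 \<le> m2" "m2 < j2" using True by auto
    then show ?thesis using ladder_weight_norm_up[of j2 m2] by simp
  qed
  moreover have "of_int (J - M) * R = of_int (j1 + m1 + 1) * R1 + of_int (j2 + m2 + 1) * R2"
    using racah_down[of J m1 m2 j1 j2] by (simp add: M R_def R1_def R2_def algebra_simps)
  ultimately have "ladder J M * (c * (weight_norm J M * weight_norm j1 m1 * weight_norm j2 m2) * R) =
     ladder j1 m1 * (c * (S * weight_norm j1 (m1 + 1) * weight_norm j2 m2) * R1) +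
     ladder j2 m2 * (c * (S * weight_norm j1 m1 * weight_norm j2 (m2 + 1)) * R2)"
    by algebra
  then show ?thesis unfolding eqs .
next
  case False
  then consider "M \<noteq> m1 + m2" | "\<bar>m1\<bar> > j1" | "\<bar>m2\<bar> > j2" | "\<bar>M + 1\<bar> > J" by linarith
  then show ?thesis
  proof cases
    case 2
    then have "m1 = - j1 - 1 \<or> \<bar>m1 + 1\<bar> > j1" using assms by (auto simp: triangle_def)
    then show ?thesis using 2 by (auto simp: CG_eq_0)
  next
    case 3
    then have "m2 = - j2 - 1 \<or> \<bar>m2 + 1\<bar> > j2" using assms by (auto simp: triangle_def)
    then show ?thesis using 3 by (auto simp: CG_eq_0)
  next
    case 4
    then have "M = J \<or> \<bar>M\<bar> > J" using assms by (auto simp: triangle_def)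
    then show ?thesis using 4 by (auto simp: CG_eq_0)
  qed (auto simp: CG_eq_0)
qed

text \<open>At \<open>m1 = j1\<close> the factor \<open>inv_fact (j1 - m1 - k)\<close> leaves only
  the term \<open>k = 0\<close>, so no cancellation can occur.\<close>

lemma CG_top_nonzero:
  assumes "triangle j1 j2 J"
  shows "CG j1 j1 j2 (J - j1) J J \<noteq> 0"
proof -
  have t: "0 \<le> j1" "0 \<le> j2" "\<bar>j1 - j2\<bar> \<le> J" "J \<le> j1 + j2" using assms by (auto simp: triangle_def)
  have "racah j1 j1 j2 (J - j1) J = (\<Sum>k\<in>{0}. (-1) ^ nat k * (inv_fact k * inv_fact (j1 + j2 - J - k) * inv_fact (0 - k)
     * inv_fact (j2 + (J - j1) - k) * inv_fact (J - j2 + j1 + k) * inv_fact (J - j1 - (J - j1) + k)))"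
    unfolding racah_def racah_sum_def using t by (intro sum.mono_neutral_cong_right) (auto simp: inv_fact_def)
  also have "\<dots> \<noteq> 0"
    using t abs_ge_self[of "j1 - j2"] abs_ge_minus_self[of "j1 - j2"] by (simp add: inv_fact_def)
  finally have "racah j1 j1 j2 (J - j1) J \<noteq> 0" .
  moreover have "weight_norm J J \<noteq> 0" "weight_norm j1 j1 \<noteq> 0" "weight_norm j2 (J - j1) \<noteq> 0"
    using t abs_ge_self[of "j1 - j2"] abs_ge_minus_self[of "j1 - j2"] by (simp_all add: weight_norm_def ifact_def abs_le_iff)
  ultimately show ?thesis
    using CG_eq_racah[OF assms, of j1 "J - j1"] CG_norm_pos[OF assms] by simp
qed

text \<open>Summation by parts over weights. The two hypotheses are met by a factor
  \<open>ladder j k\<close> in the summand, by \<open>ladder_boundary\<close>.\<close>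

lemma sum_shift_int:
  fixes F :: "int \<Rightarrow> 'b::comm_monoid_add"
  assumes "F j = 0" "F (- j - 1) = 0"
  shows "(\<Sum>k\<in>{-j..j}. F k) = (\<Sum>k\<in>{-j..j}. F (k - 1))"
proof -
  have "(\<Sum>k\<in>{-j..j}. F (k - 1)) = (\<Sum>k\<in>{-j-1..j-1}. F k)"
    by (rule sum.reindex_bij_witness[of _ "\<lambda>k. k + 1" "\<lambda>k. k - 1"]) auto
  also have "\<dots> = (\<Sum>k\<in>{-j-1..j}. F k)"
  proof (rule sum.mono_neutral_left)
    show "\<forall>i\<in>{-j-1..j} - {-j-1..j-1}. F i = 0"
    proof
      fix i assume "i \<in> {-j-1..j} - {-j-1..j-1}"
      then have "i = j" by auto
      then show "F i = 0" using assms(1) by simp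
    qed
  qed auto
  also have "\<dots> = (\<Sum>k\<in>{-j..j}. F k)"
  proof (rule sum.mono_neutral_right)
    show "\<forall>i\<in>{-j-1..j} - {-j..j}. F i = 0"
    proof
      fix i assume "i \<in> {-j-1..j} - {-j..j}"
      then have "i = - j - 1" by auto
      then show "F i = 0" using assms(2) by simp
    qed
  qed auto
  finally show ?thesis ..
qed

section \<open>Orthogonality and completeness of the coupled vectors\<close>

definition gram :: "int \<Rightarrow> int \<Rightarrow> int \<Rightarrow> int \<Rightarrow> int \<Rightarrow> real" where
  "gram j1 j2 J J' M = (\<Sum>a\<in>{-j1..j1}. \<Sum>b\<in>{-j2..j2}. CG j1 a j2 b J M * CG j1 a j2 b J' M)"

text \<open>The raising and lowering operators are adjoint. Together with the vanishing of \<open>ladder J M\<close> at \<open>M = J\<close>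
  this makes coupled vectors of different spin orthogonal and those of equal spin equally long.\<close>

lemma gram_rec:
  assumes "triangle j1 j2 J" "triangle j1 j2 J'"
  shows "ladder J M * gram j1 j2 J J' (M + 1) = ladder J' M * gram j1 j2 J J' M"
proof -
  have "ladder J M * gram j1 j2 J J' (M + 1) =
     (\<Sum>a\<in>{-j1..j1}. \<Sum>b\<in>{-j2..j2}. (ladder J M * CG j1 a j2 b J (M + 1)) * CG j1 a j2 b J' (M + 1))"
    by (simp add: gram_def sum_distrib_left mult_ac)
  also have "\<dots> = (\<Sum>a\<in>{-j1..j1}. \<Sum>b\<in>{-j2..j2}. ladder j1 (a - 1) * CG j1 (a - 1) j2 b J M * CG j1 a j2 b J' (M + 1))
     + (\<Sum>a\<in>{-j1..j1}. \<Sum>b\<in>{-j2..j2}. ladder j2 (b - 1) * CG j1 a j2 (b - 1) J M * CG j1 a j2 b J' (M + 1))"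
    unfolding CG_up[OF assms(1)] by (simp add: algebra_simps sum.distrib)
  also have "(\<Sum>a\<in>{-j1..j1}. \<Sum>b\<in>{-j2..j2}. ladder j1 (a - 1) * CG j1 (a - 1) j2 b J M * CG j1 a j2 b J' (M + 1))
     = (\<Sum>a\<in>{-j1..j1}. \<Sum>b\<in>{-j2..j2}. ladder j1 a * CG j1 a j2 b J M * CG j1 (a + 1) j2 b J' (M + 1))"
    by (subst (2) sum_shift_int) simp_all
  also have "(\<Sum>a\<in>{-j1..j1}. \<Sum>b\<in>{-j2..j2}. ladder j2 (b - 1) * CG j1 a j2 (b - 1) J M * CG j1 a j2 b J' (M + 1))
     = (\<Sum>a\<in>{-j1..j1}. \<Sum>b\<in>{-j2..j2}. ladder j2 b * CG j1 a j2 b J M * CG j1 a j2 (b + 1) J' (M + 1))"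
    by (rule sum.cong[OF refl], subst (2) sum_shift_int) simp_all
  also have "(\<Sum>a\<in>{-j1..j1}. \<Sum>b\<in>{-j2..j2}. ladder j1 a * CG j1 a j2 b J M * CG j1 (a + 1) j2 b J' (M + 1)) + \<dots>
     = (\<Sum>a\<in>{-j1..j1}. \<Sum>b\<in>{-j2..j2}. CG j1 a j2 b J M * (ladder J' M * CG j1 a j2 b J' M))"
    unfolding CG_down[OF assms(2)] by (simp add: algebra_simps sum.distrib)
  also have "\<dots> = ladder J' M * gram j1 j2 J J' M"
    by (simp add: gram_def sum_distrib_left mult_ac)
  finally show ?thesis .
qed

lemma ladder_pos: "- j \<le> m \<Longrightarrow> m < j \<Longrightarrow> ladder j m > 0"
  by (simp add: ladder_def)

lemma ladder_pos': "\<lbrakk>0 \<le> J; J < J'; - J \<le> M; M \<le> J\<rbrakk> \<Longrightarrow> ladder J' M > 0"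
  by (rule ladder_pos) auto

text \<open>Descent from the top weight of the smaller spin. The order \<open>J < J'\<close> keeps
  \<open>ladder J' M\<close> positive even at \<open>M = J\<close>, where \<open>ladder J M\<close>
  is zero; \<open>gram_sym\<close> serves the opposite order.\<close>

lemma gram_off:
  assumes "triangle j1 j2 J" "triangle j1 j2 J'" "J < J'"
  shows "gram j1 j2 J J' M = 0"
proof (cases "\<bar>M\<bar> \<le> J")
  case True
  have "gram j1 j2 J J' (J - int k) = 0" if "int k \<le> 2 * J" for k
    using that
  proof (induction k)
    case 0
    have "ladder J' J > 0" using assms by (intro ladder_pos') (auto simp: triangle_def)
    then show ?case using gram_rec[OF assms(1,2), of J] by simp
  next
    case (Suc k)
    have "ladder J' (J - int (Suc k)) > 0" using Suc.prems assms by (intro ladder_pos'[of J]) (auto simp: triangle_def)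
    moreover have "gram j1 j2 J J' (J - int (Suc k) + 1) = 0" using Suc by (simp add: algebra_simps)
    ultimately show ?case using gram_rec[OF assms(1,2), of "J - int (Suc k)"] by simp
  qed
  from this[of "nat (J - M)"] show ?thesis using abs_le_D1[OF True] abs_le_D2[OF True] by simp
qed (simp add: gram_def CG_eq_0)

lemma gram_sym: "gram j1 j2 J J' M = gram j1 j2 J' J M"
  by (simp add: gram_def mult_ac)

lemma gram_neq_0:
  assumes "triangle j1 j2 J" "triangle j1 j2 J'" "J \<noteq> J'"
  shows "gram j1 j2 J J' M = 0"
  using gram_off[OF assms(1,2), of M] gram_off[OF assms(2,1), of M] assms(3) gram_sym[of j1 j2 J J' M]
  by linarith

lemma gram_diag:
  assumes "triangle j1 j2 J" "\<bar>M\<bar> \<le> J"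
  shows "gram j1 j2 J J M = gram j1 j2 J J J"
proof -
  have "gram j1 j2 J J (J - int k) = gram j1 j2 J J J" if "int k \<le> 2 * J" for k
    using that
  proof (induction k)
    case (Suc k)
    have "ladder J (J - int (Suc k)) > 0" using Suc.prems by (intro ladder_pos) auto
    then show ?case using gram_rec[OF assms(1,1), of "J - int (Suc k)"] Suc by (simp add: algebra_simps)
  qed simp
  from this[of "nat (J - M)"] show ?thesis
    using abs_le_D1[OF assms(2)] abs_le_D2[OF assms(2)] by simp
qed

text \<open>A sum of squares, one of which is the coefficient of
  \<open>CG_top_nonzero\<close>.\<close>

lemma gram_pos:
  assumes "triangle j1 j2 J"
  shows "gram j1 j2 J J J > 0"
proof -
  have t: "0 \<le> j1" "0 \<le> j2" "\<bar>J - j1\<bar> \<le> j2" using assms by (auto simp: triangle_def)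
  have "0 < (CG j1 j1 j2 (J - j1) J J)\<^sup>2" using CG_top_nonzero[OF assms] by simp
  also have "\<dots> \<le> (\<Sum>b\<in>{-j2..j2}. (CG j1 j1 j2 b J J)\<^sup>2)"
    using t by (intro member_le_sum) auto
  also have "\<dots> \<le> (\<Sum>a\<in>{-j1..j1}. \<Sum>b\<in>{-j2..j2}. (CG j1 a j2 b J J)\<^sup>2)"
    using t by (intro member_le_sum[of j1 _ "\<lambda>a. \<Sum>b\<in>{-j2..j2}. (CG j1 a j2 b J J)\<^sup>2"]) (auto intro: sum_nonneg)
  finally show ?thesis by (simp add: gram_def power2_eq_square)
qed

text \<open>Bessel's inequality for the point masses, summed over all points, must be an equality because
  there are as many orthonormal vectors as points.\<close>
lemma orthonormal_complete:
  fixes u :: "'a \<Rightarrow> 'x \<Rightarrow> real"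
  assumes "finite A" "finite X" "card A = card X"
    and orth: "\<And>a b. a \<in> A \<Longrightarrow> b \<in> A \<Longrightarrow> (\<Sum>x\<in>X. u a x * u b x) = (if a = b then 1 else 0)"
    and "x \<in> X" "y \<in> X"
  shows "(\<Sum>a\<in>A. u a x * u a y) = (if x = y then 1 else 0)"
proof -
  \<comment> \<open>The squared distance of the point mass at \<open>x\<close> from its projection
    onto the span of the \<open>u a\<close>, expanded into Bessel's defect.\<close>
  have sq: "(\<Sum>z\<in>X. ((if x = z then 1 else 0) - (\<Sum>a\<in>A. u a x * u a z))\<^sup>2) = 1 - (\<Sum>a\<in>A. (u a x)\<^sup>2)"
    if "x \<in> X" for x
  proof -
    have "(\<Sum>z\<in>X. (\<Sum>a\<in>A. u a x * u a z)\<^sup>2)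
        = (\<Sum>z\<in>X. \<Sum>a\<in>A. \<Sum>b\<in>A. (u a x * u b x) * (u a z * u b z))"
      by (simp add: power2_eq_square sum_product mult_ac)
    also have "\<dots> = (\<Sum>a\<in>A. \<Sum>z\<in>X. \<Sum>b\<in>A. (u a x * u b x) * (u a z * u b z))"
      by (rule sum.swap)
    also have "\<dots> = (\<Sum>a\<in>A. \<Sum>b\<in>A. (u a x * u b x) * (\<Sum>z\<in>X. u a z * u b z))"
      by (intro sum.cong refl) (simp add: sum.swap[of _ X] sum_distrib_left)
    also have "\<dots> = (\<Sum>a\<in>A. \<Sum>b\<in>A. if a = b then (u a x)\<^sup>2 else 0)"
      by (intro sum.cong refl) (auto simp: orth power2_eq_square)
    also have "\<dots> = (\<Sum>a\<in>A. (u a x)\<^sup>2)"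
      using \<open>finite A\<close> by simp
    finally have 1: "(\<Sum>z\<in>X. (\<Sum>a\<in>A. u a x * u a z)\<^sup>2) = (\<Sum>a\<in>A. (u a x)\<^sup>2)" .
    have "(\<Sum>z\<in>X. ((if x = z then 1 else 0) - (\<Sum>a\<in>A. u a x * u a z))\<^sup>2) =
       (\<Sum>z\<in>X. (if x = z then 1 - 2 * (\<Sum>a\<in>A. u a x * u a z) else 0) + (\<Sum>a\<in>A. u a x * u a z)\<^sup>2)"
      by (intro sum.cong refl) (auto simp: power2_diff)
    also have "\<dots> = 1 - 2 * (\<Sum>a\<in>A. (u a x)\<^sup>2) + (\<Sum>a\<in>A. (u a x)\<^sup>2)"
      using that \<open>finite X\<close> by (simp add: sum.distrib 1) (simp add: power2_eq_square)
    finally show ?thesis by simp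
  qed
  have "(\<Sum>x\<in>X. 1 - (\<Sum>a\<in>A. (u a x)\<^sup>2)) = real (card X) - (\<Sum>a\<in>A. \<Sum>x\<in>X. u a x * u a x)"
    by (simp add: sum_subtractf sum.swap[of _ A] power2_eq_square)
  also have "\<dots> = 0" using assms(1,3) by (simp add: orth)
  finally have "(\<Sum>x\<in>X. \<Sum>z\<in>X. ((if x = z then 1 else 0) - (\<Sum>a\<in>A. u a x * u a z))\<^sup>2) = 0"
    by (simp add: sq)
  then have "(\<Sum>z\<in>X. ((if x = z then 1 else 0) - (\<Sum>a\<in>A. u a x * u a z))\<^sup>2) = 0"
    using assms(2,5) by (subst (asm) sum_nonneg_eq_0_iff) (auto intro: sum_nonneg)
  then have "((if x = y then 1 else 0) - (\<Sum>a\<in>A. u a x * u a y))\<^sup>2 = 0"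
    using assms(2,6) by (subst (asm) sum_nonneg_eq_0_iff) auto
  then show ?thesis by (simp split: if_splits)
qed

definition coupled_indices :: "int \<Rightarrow> int \<Rightarrow> (int \<times> int) set" where
  "coupled_indices j1 j2 = (SIGMA J:{\<bar>j1 - j2\<bar>..j1 + j2}. {-J..J})"

text \<open>The dimension count of the Clebsch-Gordan decomposition: 2J + 1 is the difference of the
  squares of J + 1 and J, so the sum over \<open>J\<close> telescopes.\<close>

lemma card_coupled_indices:
  assumes "0 \<le> j1" "0 \<le> j2"
  shows "card (coupled_indices j1 j2) = card ({-j1..j1} \<times> {-j2..j2})"
proof -
  have s: "(\<Sum>J\<in>{d..d + int k}. 2 * J + 1) = (d + int k + 1)\<^sup>2 - d\<^sup>2" for d k
  proof (induction k)
    case (Suc k)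
    have "{d..d + int (Suc k)} = insert (d + int (Suc k)) {d..d + int k}" by auto
    with Suc show ?case by (simp add: power2_eq_square algebra_simps)
  qed (simp add: power2_eq_square algebra_simps)
  have "int (card (coupled_indices j1 j2)) = (\<Sum>J\<in>{\<bar>j1 - j2\<bar>..j1 + j2}. 2 * J + 1)"
    unfolding coupled_indices_def by (subst card_SigmaI) (auto intro!: sum.cong)
  also have "\<dots> = (j1 + j2 + 1)\<^sup>2 - \<bar>j1 - j2\<bar>\<^sup>2"
  proof -
    have "\<bar>j1 - j2\<bar> + int (nat (j1 + j2 - \<bar>j1 - j2\<bar>)) = j1 + j2" using assms by linarith
    then show ?thesis using s[of "\<bar>j1 - j2\<bar>" "nat (j1 + j2 - \<bar>j1 - j2\<bar>)"] by simp
  qed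
  also have "\<dots> = (2 * j1 + 1) * (2 * j2 + 1)" by (simp add: power2_eq_square algebra_simps)
  also have "\<dots> = int (card ({-j1..j1} \<times> {-j2..j2}))" using assms by (simp add: card_cartesian_product)
  finally show ?thesis by (simp only: of_nat_eq_iff)
qed

text \<open>Divided by the square roots of \<open>gram\<close>, the coupled vectors are orthonormal,
  and by the dimension count they are as many as the pairs of weights.\<close>

lemma CG_complete:
  assumes "\<bar>a\<bar> \<le> j1" "\<bar>b\<bar> \<le> j2" "\<bar>a'\<bar> \<le> j1" "\<bar>b'\<bar> \<le> j2"
  shows "(\<Sum>J\<in>{\<bar>j1 - j2\<bar>..j1 + j2}. \<Sum>M\<in>{-J..J}. CG j1 a j2 b J M * CG j1 a' j2 b' J M / gram j1 j2 J J J)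
    = (if a = a' \<and> b = b' then 1 else 0)"
proof -
  have j: "0 \<le> j1" "0 \<le> j2" using assms by auto
  have triangle: "triangle j1 j2 J" if "J \<in> {\<bar>j1 - j2\<bar>..j1 + j2}" for J using that j by (auto simp: triangle_def)
  define u where "u p q = (case p of (J, M) \<Rightarrow> case q of (a, b) \<Rightarrow> CG j1 a j2 b J M / sqrt (gram j1 j2 J J J))" for p q
  have orth: "(\<Sum>x\<in>{-j1..j1} \<times> {-j2..j2}. u p x * u q x) = (if p = q then 1 else 0)"
    if "p \<in> coupled_indices j1 j2" "q \<in> coupled_indices j1 j2" for p q
  proof -
    obtain J M J' M' where p: "p = (J, M)" and q: "q = (J', M')" by (cases p, cases q) auto
    have t: "triangle j1 j2 J" "triangle j1 j2 J'" "\<bar>M\<bar> \<le> J" "\<bar>M'\<bar> \<le> J'"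
      using that triangle by (auto simp: coupled_indices_def p q)
    have "(\<Sum>x\<in>{-j1..j1} \<times> {-j2..j2}. u p x * u q x) =
       (\<Sum>a\<in>{-j1..j1}. \<Sum>b\<in>{-j2..j2}. CG j1 a j2 b J M * CG j1 a j2 b J' M')
         / (sqrt (gram j1 j2 J J J) * sqrt (gram j1 j2 J' J' J'))"
      by (simp add: u_def p q sum.cartesian_product sum_divide_distrib case_prod_beta)
    also have "\<dots> = (if p = q then 1 else 0)"
    proof (cases "M = M'")
      case True
      then show ?thesis
        using gram_neq_0[OF t(1,2), of M] gram_diag[OF t(1,3)] gram_pos[OF t(1)]
        by (cases "J = J'") (auto simp: p q gram_def[symmetric])
    next
      case False
      \<comment> \<open>Vectors of different weights have disjoint supports, by the selection rule
        \<open>M = m1 + m2\<close>.\<close>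
      then have "(\<Sum>a\<in>{-j1..j1}. \<Sum>b\<in>{-j2..j2}. CG j1 a j2 b J M * CG j1 a j2 b J' M') = 0"
        by (intro sum.neutral ballI) (auto simp: CG_def)
      then show ?thesis using False by (simp add: p q)
    qed
    finally show ?thesis .
  qed
  have "(\<Sum>p\<in>coupled_indices j1 j2. u p (a, b) * u p (a', b')) = (if (a, b) = (a', b') then 1 else 0)"
    by (rule orthonormal_complete[OF _ _ card_coupled_indices[OF j] orth]) (use assms in \<open>auto simp: coupled_indices_def\<close>)
  also have "(\<Sum>p\<in>coupled_indices j1 j2. u p (a, b) * u p (a', b')) =
    (\<Sum>J\<in>{\<bar>j1 - j2\<bar>..j1 + j2}. \<Sum>M\<in>{-J..J}. u (J, M) (a, b) * u (J, M) (a', b'))"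
    unfolding coupled_indices_def by (subst sum.Sigma) (auto simp: case_prod_beta)
  also have "\<dots> = (\<Sum>J\<in>{\<bar>j1 - j2\<bar>..j1 + j2}. \<Sum>M\<in>{-J..J}. CG j1 a j2 b J M * CG j1 a' j2 b' J M / gram j1 j2 J J J)"
    by (intro sum.cong refl) (use gram_pos[OF triangle] in \<open>auto simp: u_def less_imp_le\<close>)
  finally show ?thesis by simp
qed

section \<open>Coupling of invariant tensors\<close>

text \<open>An invariant tensor with one index \<open>\<mu>\<close> of spin \<open>j\<close> and further indices \<open>m p, \<dots>, m n\<close> of spins
  \<open>l p, \<dots>, l n\<close>: it is annihilated by one ladder operator and has total weight 0. The values of \<open>m\<close>
  outside \<open>{p..n}\<close> are irrelevant.\<close>

definition invariant_tensor :: "nat \<Rightarrow> nat \<Rightarrow> (nat \<Rightarrow> nat) \<Rightarrow> int \<Rightarrow> (int \<Rightarrow> (nat \<Rightarrow> int) \<Rightarrow> complex) \<Rightarrow> bool" where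
  "invariant_tensor p n l j B \<longleftrightarrow>
    (\<forall>\<mu> m. of_real (ladder j \<mu>) * B (\<mu> + 1) m
       + (\<Sum>i\<in>{p..n}. of_real (ladder (int (l i)) (m i)) * B \<mu> (m(i := m i + 1))) = 0) \<and>
    (\<forall>\<mu> m. \<mu> + (\<Sum>i\<in>{p..n}. m i) \<noteq> 0 \<longrightarrow> B \<mu> m = 0) \<and>
    (\<forall>\<mu> m m'. (\<forall>i\<in>{p..n}. m i = m' i) \<longrightarrow> B \<mu> m = B \<mu> m')"

text \<open>\<open>gram j1 j2 J J J\<close> is the squared length of the coupled vectors; that it equals 1 is never needed.\<close>

definition couple :: "int \<Rightarrow> int \<Rightarrow> int \<Rightarrow> nat \<Rightarrow> (int \<Rightarrow> (nat \<Rightarrow> int) \<Rightarrow> complex) \<Rightarrow>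
    int \<Rightarrow> (nat \<Rightarrow> int) \<Rightarrow> complex" where
  "couple j1 j2 J p B \<mu> m = (\<Sum>a\<in>{-j1..j1}. \<Sum>b\<in>{-j2..j2}.
      of_real (CG j1 a j2 b J \<mu> / gram j1 j2 J J J) * B a (m(p := b)))"

text \<open>\<open>couple\<close> takes the components of the tensor along the coupled vectors, and
  completeness recovers the tensor from them. The division by \<open>gram\<close> compensates for
  vectors of arbitrary length.\<close>

lemma couple_expand:
  assumes "\<bar>\<mu>\<bar> \<le> j1" "\<bar>m p\<bar> \<le> j2"
  shows "B \<mu> m = (\<Sum>J\<in>{\<bar>j1 - j2\<bar>..j1 + j2}. \<Sum>M\<in>{-J..J}.
      of_real (CG j1 \<mu> j2 (m p) J M) * couple j1 j2 J p B M m)"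
proof -
  let ?J = "{\<bar>j1 - j2\<bar>..j1 + j2}"
  have "(\<Sum>J\<in>?J. \<Sum>M\<in>{-J..J}. of_real (CG j1 \<mu> j2 (m p) J M) * couple j1 j2 J p B M m)
     = (\<Sum>J\<in>?J. \<Sum>M\<in>{-J..J}. \<Sum>a\<in>{-j1..j1}. \<Sum>b\<in>{-j2..j2}.
          of_real (CG j1 \<mu> j2 (m p) J M * CG j1 a j2 b J M / gram j1 j2 J J J) * B a (m(p := b)))"
    by (simp add: couple_def sum_distrib_left mult_ac)
  also have "\<dots> = (\<Sum>J\<in>?J. \<Sum>a\<in>{-j1..j1}. \<Sum>M\<in>{-J..J}. \<Sum>b\<in>{-j2..j2}.
          of_real (CG j1 \<mu> j2 (m p) J M * CG j1 a j2 b J M / gram j1 j2 J J J) * B a (m(p := b)))"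
    by (intro sum.cong[OF refl] sum.swap)
  also have "\<dots> = (\<Sum>J\<in>?J. \<Sum>a\<in>{-j1..j1}. \<Sum>b\<in>{-j2..j2}. \<Sum>M\<in>{-J..J}.
          of_real (CG j1 \<mu> j2 (m p) J M * CG j1 a j2 b J M / gram j1 j2 J J J) * B a (m(p := b)))"
    by (intro sum.cong[OF refl] sum.swap)
  also have "\<dots> = (\<Sum>a\<in>{-j1..j1}. \<Sum>J\<in>?J. \<Sum>b\<in>{-j2..j2}. \<Sum>M\<in>{-J..J}.
          of_real (CG j1 \<mu> j2 (m p) J M * CG j1 a j2 b J M / gram j1 j2 J J J) * B a (m(p := b)))"
    by (rule sum.swap)
  also have "\<dots> = (\<Sum>a\<in>{-j1..j1}. \<Sum>b\<in>{-j2..j2}. \<Sum>J\<in>?J. \<Sum>M\<in>{-J..J}.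
          of_real (CG j1 \<mu> j2 (m p) J M * CG j1 a j2 b J M / gram j1 j2 J J J) * B a (m(p := b)))"
    by (intro sum.cong[OF refl] sum.swap)
  also have "\<dots> = (\<Sum>a\<in>{-j1..j1}. \<Sum>b\<in>{-j2..j2}. of_real (\<Sum>J\<in>?J. \<Sum>M\<in>{-J..J}.
          CG j1 \<mu> j2 (m p) J M * CG j1 a j2 b J M / gram j1 j2 J J J) * B a (m(p := b)))"
    by (simp add: sum_distrib_right)
  also have "\<dots> = (\<Sum>a\<in>{-j1..j1}. \<Sum>b\<in>{-j2..j2}. if b = m p then (if a = \<mu> then B a (m(p := b)) else 0) else 0)"
    by (intro sum.cong refl, subst CG_complete) (use assms in auto)
  also have "\<dots> = B \<mu> m" using assms by (simp add: sum.delta abs_le_iff minus_le_iff)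
  finally show ?thesis ..
qed

text \<open>By invariance of \<open>B\<close> the ladder action on the remaining indices is minus
  the action on the two indices being coupled. Shifting the two summations moves the latter onto the
  coefficients, where \<open>CG_up\<close> merges both parts into one ladder step of spin
  \<open>J\<close>.\<close>

lemma invariant_tensor_couple:
  assumes inv: "invariant_tensor p n l j B" and "p \<le> n" and triangle: "triangle j (int (l p)) J"
  shows "invariant_tensor (Suc p) n l J (couple j (int (l p)) J p B)"
proof -
  let ?L = "int (l p)"
  have raise: "of_real (ladder j \<mu>) * B (\<mu> + 1) m
       + (\<Sum>i\<in>{p..n}. of_real (ladder (int (l i)) (m i)) * B \<mu> (m(i := m i + 1))) = 0" for \<mu> m
    using inv by (simp add: invariant_tensor_def)
  have wt: "\<mu> + (\<Sum>i\<in>{p..n}. m i) \<noteq> 0 \<Longrightarrow> B \<mu> m = 0" for \<mu> m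
    using inv by (simp add: invariant_tensor_def)
  have loc: "(\<And>i. i \<in> {p..n} \<Longrightarrow> m i = m' i) \<Longrightarrow> B \<mu> m = B \<mu> m'" for \<mu> m m'
    using inv unfolding invariant_tensor_def by blast
  have split: "{p..n} = insert p {Suc p..n}" using \<open>p \<le> n\<close> by auto
  define N where "N = gram j ?L J J J"
  have 1: "of_real (ladder J \<mu>) * couple j ?L J p B (\<mu> + 1) m
       + (\<Sum>i\<in>{Suc p..n}. of_real (ladder (int (l i)) (m i)) * couple j ?L J p B \<mu> (m(i := m i + 1))) = 0" for \<mu> m
  proof -
    \<comment> \<open>Solves the invariance of \<open>B\<close> for the indices that stay; the terms
      of the front index and of index \<open>p\<close> go to the right-hand side.\<close>
    have r: "(\<Sum>i\<in>{Suc p..n}. of_real (ladder (int (l i)) (m i)) * B a (m(i := m i + 1, p := b)))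
       = - (of_real (ladder j a) * B (a + 1) (m(p := b)) + of_real (ladder ?L b) * B a (m(p := b + 1)))" for a b
    proof -
      have "(\<Sum>i\<in>{Suc p..n}. of_real (ladder (int (l i)) (m i)) * B a (m(i := m i + 1, p := b)))
        = (\<Sum>i\<in>{Suc p..n}. of_real (ladder (int (l i)) ((m(p := b)) i)) * B a ((m(p := b))(i := (m(p := b)) i + 1)))"
        by (intro sum.cong refl) (auto simp: fun_upd_twist)
      moreover have "s = - (x + y)" if "x + (y + s) = 0" for x y s :: complex
        using that by (metis add.assoc add.commute eq_neg_iff_add_eq_0)
      ultimately show ?thesis using raise[of a "m(p := b)"] unfolding split by simp
    qed
    have "(\<Sum>i\<in>{Suc p..n}. of_real (ladder (int (l i)) (m i)) * couple j ?L J p B \<mu> (m(i := m i + 1)))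
      = (\<Sum>i\<in>{Suc p..n}. \<Sum>a\<in>{-j..j}. \<Sum>b\<in>{-?L..?L}. of_real (CG j a ?L b J \<mu> / N) *
           (of_real (ladder (int (l i)) (m i)) * B a (m(i := m i + 1, p := b))))"
      by (simp add: couple_def N_def sum_distrib_left mult_ac)
    also have "\<dots> = (\<Sum>a\<in>{-j..j}. \<Sum>i\<in>{Suc p..n}. \<Sum>b\<in>{-?L..?L}. of_real (CG j a ?L b J \<mu> / N) *
           (of_real (ladder (int (l i)) (m i)) * B a (m(i := m i + 1, p := b))))"
      by (rule sum.swap)
    also have "\<dots> = (\<Sum>a\<in>{-j..j}. \<Sum>b\<in>{-?L..?L}. \<Sum>i\<in>{Suc p..n}. of_real (CG j a ?L b J \<mu> / N) *
           (of_real (ladder (int (l i)) (m i)) * B a (m(i := m i + 1, p := b))))"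
      by (intro sum.cong[OF refl] sum.swap)
    also have "\<dots> = (\<Sum>a\<in>{-j..j}. \<Sum>b\<in>{-?L..?L}. of_real (CG j a ?L b J \<mu> / N) *
           (- (of_real (ladder j a) * B (a + 1) (m(p := b)) + of_real (ladder ?L b) * B a (m(p := b + 1)))))"
      unfolding sum_distrib_left[symmetric] r ..
    also have "\<dots> = - ((\<Sum>a\<in>{-j..j}. \<Sum>b\<in>{-?L..?L}. of_real (ladder j a * CG j a ?L b J \<mu> / N) * B (a + 1) (m(p := b)))
       + (\<Sum>a\<in>{-j..j}. \<Sum>b\<in>{-?L..?L}. of_real (ladder ?L b * CG j a ?L b J \<mu> / N) * B a (m(p := b + 1))))"
      by (simp add: sum.distrib sum_negf algebra_simps add_divide_distrib sum_subtractf)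
    also have "(\<Sum>a\<in>{-j..j}. \<Sum>b\<in>{-?L..?L}. of_real (ladder j a * CG j a ?L b J \<mu> / N) * B (a + 1) (m(p := b)))
       = (\<Sum>a\<in>{-j..j}. \<Sum>b\<in>{-?L..?L}. of_real (ladder j (a - 1) * CG j (a - 1) ?L b J \<mu> / N) * B a (m(p := b)))"
      by (subst sum_shift_int) simp_all
    also have "(\<Sum>a\<in>{-j..j}. \<Sum>b\<in>{-?L..?L}. of_real (ladder ?L b * CG j a ?L b J \<mu> / N) * B a (m(p := b + 1)))
       = (\<Sum>a\<in>{-j..j}. \<Sum>b\<in>{-?L..?L}. of_real (ladder ?L (b - 1) * CG j a ?L (b - 1) J \<mu> / N) * B a (m(p := b)))"
      by (rule sum.cong[OF refl], subst sum_shift_int) simp_all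
    also have "(\<Sum>a\<in>{-j..j}. \<Sum>b\<in>{-?L..?L}. of_real (ladder j (a - 1) * CG j (a - 1) ?L b J \<mu> / N) * B a (m(p := b))) + \<dots>
       = (\<Sum>a\<in>{-j..j}. \<Sum>b\<in>{-?L..?L}. of_real ((ladder j (a - 1) * CG j (a - 1) ?L b J \<mu>
             + ladder ?L (b - 1) * CG j a ?L (b - 1) J \<mu>) / N) * B a (m(p := b)))"
      by (simp add: sum.distrib[symmetric] add_divide_distrib distrib_right)
    also have "\<dots> = of_real (ladder J \<mu>) * couple j ?L J p B (\<mu> + 1) m"
      unfolding CG_up[OF triangle, symmetric] by (simp add: couple_def N_def sum_distrib_left mult_ac)
    finally show ?thesis by (simp only: right_minus)
  qed
  have 2: "couple j ?L J p B \<mu> m = 0" if "\<mu> + (\<Sum>i\<in>{Suc p..n}. m i) \<noteq> 0" for \<mu> m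
    unfolding couple_def
  proof (intro sum.neutral ballI)
    fix a b
    show "of_real (CG j a ?L b J \<mu> / gram j ?L J J J) * B a (m(p := b)) = 0"
    \<comment> \<open>The selection rule discards all other pairs; for the remaining ones the front
      index and index \<open>p\<close> of \<open>B\<close> together carry weight
      \<open>\<mu>\<close>.\<close>
    proof (cases "\<mu> = a + b")
      case True
      have "(\<Sum>i\<in>{p..n}. (m(p := b)) i) = b + (\<Sum>i\<in>{Suc p..n}. m i)"
        unfolding split by (simp add: sum.insert)
      then have "B a (m(p := b)) = 0" using that True by (intro wt) (simp add: algebra_simps)
      then show ?thesis by simp
    qed (simp add: CG_eq_0)
  qed
  have 3: "couple j ?L J p B \<mu> m = couple j ?L J p B \<mu> m'" if "\<forall>i\<in>{Suc p..n}. m i = m' i" for \<mu> m m'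
    unfolding couple_def using that
    by (intro sum.cong refl arg_cong[where f="(*) _"] loc) (auto simp: split)
  show ?thesis unfolding invariant_tensor_def using 1 2 3 by blast
qed

lemma ladder_reflect: "ladder j (- \<mu> - 1) = ladder j \<mu>"
  by (simp add: ladder_def algebra_simps)

text \<open>Schur's lemma in coordinates. Weight 0 reduces the tensor to one sequence with a
  two-term recursion; it alternates in sign when the spins agree, and otherwise a zero of one
  \<open>ladder\<close> at an end of the shorter weight range starts a chain of zeros.\<close>

lemma invariant_tensor_two:
  assumes inv: "invariant_tensor n n l J B" and "0 \<le> J"
  shows "\<exists>c. \<forall>\<mu> m. \<bar>\<mu>\<bar> \<le> J \<longrightarrow> \<bar>m n\<bar> \<le> int (l n) \<longrightarrow>
     B \<mu> m = (if J = int (l n) \<and> \<mu> = - m n then (-1) ^ nat \<bar>m n\<bar> * c else 0)"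
proof -
  define L where "L = int (l n)"
  \<comment> \<open>Only the value at \<open>n\<close> matters, so a constant function carries it;
    total weight 0 forces that value to be \<open>- \<mu>\<close>.\<close>
  define b where "b \<mu> = B \<mu> (\<lambda>_. - \<mu>)" for \<mu>
  have loc: "m n = m' n \<Longrightarrow> B \<mu> m = B \<mu> m'" for \<mu> m m'
  proof -
    assume "m n = m' n"
    then have "\<forall>i\<in>{n..n}. m i = m' i" by simp
    then show ?thesis using inv unfolding invariant_tensor_def by blast
  qed
  have rec: "of_real (ladder J \<mu>) * b (\<mu> + 1) + of_real (ladder L \<mu>) * b \<mu> = 0" for \<mu>
  proof -
    \<comment> \<open>The second weight is taken as \<open>- \<mu> - 1\<close>, so that raising
      either index gives total weight 0.\<close>
    have "of_real (ladder J \<mu>) * B (\<mu> + 1) (\<lambda>_. - \<mu> - 1)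
       + (\<Sum>i\<in>{n..n}. of_real (ladder (int (l i)) (- \<mu> - 1)) * B \<mu> ((\<lambda>_. - \<mu> - 1)(i := - \<mu> - 1 + 1))) = 0"
      using inv unfolding invariant_tensor_def by blast
    then have "of_real (ladder J \<mu>) * B (\<mu> + 1) (\<lambda>_. - \<mu> - 1)
       + of_real (ladder L (- \<mu> - 1)) * B \<mu> ((\<lambda>_. - \<mu> - 1)(n := - \<mu>)) = 0"
      by (simp only: atLeastAtMost_singleton sum.insert finite.emptyI sum.empty add_0_right L_def diff_add_cancel empty_iff not_False_eq_True)
    moreover have "B \<mu> ((\<lambda>_. - \<mu> - 1)(n := - \<mu>)) = b \<mu>" unfolding b_def by (rule loc) simp
    moreover have "B (\<mu> + 1) (\<lambda>_. - \<mu> - 1) = b (\<mu> + 1)" unfolding b_def by (rule loc) simp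
    ultimately show ?thesis by (simp add: ladder_reflect)
  qed
  have Bb: "B \<mu> m = (if \<mu> = - m n then b \<mu> else 0)" for \<mu> m
  proof (cases "\<mu> = - m n")
    case True
    then have "B \<mu> m = b \<mu>" unfolding b_def by (intro loc) simp
    with True show ?thesis by simp
  next
    case False
    then show ?thesis using inv by (simp add: invariant_tensor_def)
  qed
  have "0 \<le> L" by (simp add: L_def)
  consider "J = L" | "J < L" | "L < J" by linarith
  then have "b \<mu> = (if J = L then (-1) ^ nat \<bar>\<mu>\<bar> * b 0 else 0)" if "\<bar>\<mu>\<bar> \<le> J" "\<bar>\<mu>\<bar> \<le> L" for \<mu>
  proof cases
    case 1
    have step: "b (\<nu> + 1) = - b \<nu>" if "- L \<le> \<nu>" "\<nu> < L" for \<nu>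
    proof -
      have "of_real (ladder L \<nu>) * (b (\<nu> + 1) + b \<nu>) = 0" using rec[of \<nu>] 1 by (simp add: distrib_left)
      then show ?thesis using ladder_pos[OF that] by (simp add: add_eq_0_iff2)
    qed
    have p: "int k \<le> L \<Longrightarrow> b (int k) = (-1) ^ k * b 0" for k
    proof (induction k)
      case (Suc k) then show ?case using step[of "int k"] by (simp add: add.commute)
    qed simp
    have m: "int k \<le> L \<Longrightarrow> b (- int k) = (-1) ^ k * b 0" for k
    proof (induction k)
      case (Suc k) then show ?case using step[of "- int (Suc k)"] by simp
    qed simp
    have "b \<mu> = (-1) ^ nat \<bar>\<mu>\<bar> * b 0"
    proof (cases "0 \<le> \<mu>")
      case True then show ?thesis using p[of "nat \<bar>\<mu>\<bar>"] that(2) by simp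
    next
      case False then show ?thesis using m[of "nat \<bar>\<mu>\<bar>"] that(2) by simp
    qed
    then show ?thesis using 1 by simp
  next
    case 2
    \<comment> \<open>For \<open>J < L\<close> the recursion at \<open>\<mu> = J\<close> reads
      \<open>b J = 0\<close>, since \<open>ladder J J\<close> vanishes and \<open>ladder L J\<close>
      does not; zeros then spread downwards.\<close>
    have "int k \<le> 2 * J \<Longrightarrow> b (J - int k) = 0" for k
    proof (induction k)
      case 0
      have "ladder L J > 0" using 2 \<open>0 \<le> J\<close> by (intro ladder_pos) auto
      then show ?case using rec[of J] by simp
    next
      case (Suc k)
      have "ladder L (J - int (Suc k)) > 0" using 2 Suc.prems by (intro ladder_pos) auto
      moreover have "b (J - int (Suc k) + 1) = 0" using Suc by (simp add: algebra_simps)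
      ultimately show ?case using rec[of "J - int (Suc k)"] by simp
    qed
    from this[of "nat (J - \<mu>)"] show ?thesis
      using 2 abs_le_D1[OF that(1)] abs_le_D2[OF that(1)] by simp
  next
    case 3
    \<comment> \<open>For \<open>L < J\<close> the start is at the bottom,
      \<open>\<mu> = - L - 1\<close>, where \<open>ladder L\<close> vanishes; zeros then spread
      upwards.\<close>
    have "int k \<le> 2 * L \<Longrightarrow> b (- L + int k) = 0" for k
    proof (induction k)
      case 0
      have "ladder J (- L - 1) > 0" using 3 \<open>0 \<le> L\<close> by (intro ladder_pos) auto
      then show ?case using rec[of "- L - 1"] by simp
    next
      case (Suc k)
      have "ladder J (- L + int k) > 0" using 3 Suc.prems by (intro ladder_pos) auto
      moreover have "b (- L + int k) = 0" using Suc by simp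
      ultimately show ?case using rec[of "- L + int k"] by (simp add: algebra_simps)
    qed
    from this[of "nat (L + \<mu>)"] show ?thesis
      using 3 abs_le_D1[OF that(2)] abs_le_D2[OF that(2)] by simp
  qed
  then have main: "b \<mu> = (if J = L then (-1) ^ nat \<bar>\<mu>\<bar> * b 0 else 0)" if "\<bar>\<mu>\<bar> \<le> J" "\<bar>\<mu>\<bar> \<le> L" for \<mu>
    using that by blast
  show ?thesis
  proof (intro exI[of _ "b 0"] allI impI)
    fix \<mu> m assume "\<bar>\<mu>\<bar> \<le> J" "\<bar>m n\<bar> \<le> int (l n)"
    then show "B \<mu> m = (if J = int (l n) \<and> \<mu> = - m n then (-1) ^ nat \<bar>m n\<bar> * b 0 else 0)"
      using main[of \<mu>] unfolding Bb L_def[symmetric] by (cases "\<mu> = - m n") auto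
  qed
qed

section \<open>Chains of intermediate spins and weights\<close>

lemma lam_set_0: "lam_set 3 l = {\<lambda>_. 0}"
  by (auto simp: lam_set_def)

lemma mu_set_0: "mu_set 3 lam = {\<lambda>_. 0}"
  by (auto simp: mu_set_def)

abbreviation spin_range :: "int \<Rightarrow> int \<Rightarrow> int set" where
  "spin_range j1 j2 \<equiv> {\<bar>j1 - j2\<bar>..j1 + j2}"

text \<open>With \<open>s + 3\<close> indices a chain has \<open>s\<close> entries; the new entry at
  \<open>Suc s\<close> couples the last spin with \<open>l (s + 2)\<close>. Chains are 0 outside
  their range, so clearing the new position inverts the extension.\<close>

lemma lam_set_Suc:
  "bij_betw (\<lambda>(lam, J). lam(Suc s := J))
     (SIGMA lam:lam_set (s + 3) l. spin_range (chainL l lam s) (int (l (s + 2)))) (lam_set (s + 4) l)"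
proof (rule bij_betw_byWitness[where f' = "\<lambda>lam. (lam(Suc s := 0), lam (Suc s))"], goal_cases)
  case 1
  then show ?case by (auto simp: lam_set_def fun_eq_iff)
next
  case 2
  then show ?case by auto
next
  case 3
  show ?case
  proof clarify
    fix lam J
    assume a: "lam \<in> lam_set (s + 3) l" "J \<in> spin_range (chainL l lam s) (int (l (s + 2)))"
    have "\<bar>int (l (i+1)) - (if i = 1 then int (l 1) else (lam(Suc s := J)) (i-1))\<bar> \<le> (lam(Suc s := J)) i \<and>
        (lam(Suc s := J)) i \<le> int (l (i+1)) + (if i = 1 then int (l 1) else (lam(Suc s := J)) (i-1))"
      if "i \<in> {1..Suc s}" for i
    proof (cases "i = Suc s")
      case True
      then show ?thesis using a(2) by (auto simp: chainL_def abs_minus_commute split: if_splits)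
    next
      case False
      then have i: "i \<in> {1..s}" "i \<noteq> Suc s" "i - 1 \<noteq> Suc s" using that by auto
      have "\<forall>i\<in>{1..s}. \<bar>int (l (i+1)) - (if i = 1 then int (l 1) else lam (i-1))\<bar> \<le> lam i \<and>
        lam i \<le> int (l (i+1)) + (if i = 1 then int (l 1) else lam (i-1))"
        using a(1) by (simp add: lam_set_def)
      from bspec[OF this i(1)] show ?thesis using i by (cases "i = 1") simp_all
    qed
    then show "lam(Suc s := J) \<in> lam_set (s + 4) l" using a(1) by (auto simp: lam_set_def)
  qed
next
  case 4
  show ?case
  proof clarify
    fix lam assume a: "lam \<in> lam_set (s + 4) l"
    have h: "\<forall>i\<in>{1..Suc s}. \<bar>int (l (i+1)) - (if i = 1 then int (l 1) else lam (i-1))\<bar> \<le> lam i \<and>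
        lam i \<le> int (l (i+1)) + (if i = 1 then int (l 1) else lam (i-1))"
      using a by (simp add: lam_set_def)
    have "\<bar>int (l (i+1)) - (if i = 1 then int (l 1) else (lam(Suc s := 0)) (i-1))\<bar> \<le> (lam(Suc s := 0)) i \<and>
        (lam(Suc s := 0)) i \<le> int (l (i+1)) + (if i = 1 then int (l 1) else (lam(Suc s := 0)) (i-1))"
      if "i \<in> {1..s}" for i
    proof -
      have i: "i \<in> {1..Suc s}" "i \<noteq> Suc s" "i - 1 \<noteq> Suc s" using that by auto
      from bspec[OF h i(1)] show ?thesis using i by (cases "i = 1") simp_all
    qed
    then have "(lam(Suc s := 0)) \<in> lam_set (s + 3) l" using a by (auto simp: lam_set_def)
    moreover have "lam (Suc s) \<in> spin_range (chainL l (lam(Suc s := 0)) s) (int (l (s + 2)))"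
      using bspec[OF h, of "Suc s"] by (auto simp: chainL_def abs_minus_commute split: if_splits)
    ultimately show "(lam(Suc s := 0)) \<in> lam_set (s + 3) l \<and> lam (Suc s) \<in> spin_range (chainL l (lam(Suc s := 0)) s) (int (l (s + 2)))" ..
  qed
qed

lemma mu_set_Suc:
  "bij_betw (\<lambda>(mu, M). mu(Suc s := M)) (mu_set (s + 3) lam \<times> {-J..J}) (mu_set (s + 4) (lam(Suc s := J)))"
proof (rule bij_betw_byWitness[where f' = "\<lambda>lam. (lam(Suc s := 0), lam (Suc s))"], goal_cases)
  case 4
  show ?case
  proof clarify
    fix mu assume mu: "mu \<in> mu_set (s + 4) (lam(Suc s := J))"
    then have h: "\<bar>mu i\<bar> \<le> (lam(Suc s := J)) i" if "i \<in> {1..Suc s}" for i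
      using that by (auto simp: mu_set_def)
    have "\<bar>mu i\<bar> \<le> lam i" if "i \<in> {1..s}" for i
      using h[of i] that by auto
    then have "mu(Suc s := 0) \<in> mu_set (s + 3) lam"
      using mu by (auto simp: mu_set_def)
    moreover have "mu (Suc s) \<in> {-J..J}" using h[of "Suc s"] by auto
    ultimately show "mu(Suc s := 0) \<in> mu_set (s + 3) lam \<and> mu (Suc s) \<in> {-J..J}" ..
  qed
qed (auto simp: mu_set_def fun_eq_iff le_Suc_eq)

lemma finite_lam_set: "finite (lam_set (s + 3) l)"
proof (induction s)
  case (Suc s)
  then have "finite (SIGMA lam:lam_set (s + 3) l. spin_range (chainL l lam s) (int (l (s + 2))))"
    by (intro finite_SigmaI) auto
  then show ?case using bij_betw_finite[OF lam_set_Suc[of s l]] by (simp add: eval_nat_numeral)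
qed (simp add: lam_set_0)

lemma sum_lam_set_Suc:
  "sum F (lam_set (s + 4) l) =
     (\<Sum>lam\<in>lam_set (s + 3) l. \<Sum>J\<in>spin_range (chainL l lam s) (int (l (s + 2))). F (lam(Suc s := J)))"
  by (subst sum.reindex_bij_betw[OF lam_set_Suc, symmetric], subst sum.Sigma)
     (auto simp: finite_lam_set case_prod_beta)

lemma sum_mu_set_Suc:
  "sum F (mu_set (s + 4) (lam(Suc s := J))) = (\<Sum>mu\<in>mu_set (s + 3) lam. \<Sum>M\<in>{-J..J}. F (mu(Suc s := M)))"
  by (subst sum.reindex_bij_betw[OF mu_set_Suc, symmetric], subst sum.cartesian_product)
     (auto simp: case_prod_beta)

text \<open>Intermediate spins are integers by type; the lower triangle bound, an absolute value,
  makes them nonnegative.\<close>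

lemma chainL_nonneg: "lam \<in> lam_set (s + 3) l \<Longrightarrow> 0 \<le> chainL l lam s"
proof (cases "s = 0")
  case False
  assume "lam \<in> lam_set (s + 3) l"
  then have "\<bar>int (l (s+1)) - (if s = 1 then int (l 1) else lam (s-1))\<bar> \<le> lam s"
    using False by (auto simp: lam_set_def)
  then show ?thesis using False by (simp add: chainL_def)
qed (simp add: chainL_def)

text \<open>After \<open>s\<close> couplings the first \<open>s + 1\<close> indices are merged into
  one of spin \<open>chainL l lam s\<close> and weight \<open>chainM m mu s\<close>, while the
  indices from \<open>s + 2\<close> on are untouched. The product collects the coefficients used so
  far.\<close>

lemma couple_chain_expand:
  assumes inv: "invariant_tensor 2 n l (int (l 1)) B0" and "s + 3 \<le> n"
  shows "\<exists>B. (\<forall>lam\<in>lam_set (s + 3) l. invariant_tensor (s + 2) n l (chainL l lam s) (B lam)) \<and>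
     (\<forall>m. (\<forall>i\<in>{1..n}. \<bar>m i\<bar> \<le> int (l i)) \<longrightarrow>
        B0 (m 1) m = (\<Sum>lam\<in>lam_set (s + 3) l. \<Sum>mu\<in>mu_set (s + 3) lam.
          of_real (\<Prod>i\<in>{1..s}. CG (chainL l lam (i-1)) (chainM m mu (i-1)) (int (l (i+1))) (m (i+1)) (lam i) (mu i))
          * B lam (chainM m mu s) m))"
  using \<open>s + 3 \<le> n\<close>
proof (induction s)
  case 0
  show ?case
    using inv by (intro exI[of _ "\<lambda>_. B0"]) (simp add: lam_set_0 mu_set_0 chainL_def chainM_def numeral_2_eq_2)
next
  case (Suc s)
  then obtain B where B: "\<And>lam. lam \<in> lam_set (s + 3) l \<Longrightarrow> invariant_tensor (s + 2) n l (chainL l lam s) (B lam)"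
    and exp: "\<And>m. (\<forall>i\<in>{1..n}. \<bar>m i\<bar> \<le> int (l i)) \<Longrightarrow>
        B0 (m 1) m = (\<Sum>lam\<in>lam_set (s + 3) l. \<Sum>mu\<in>mu_set (s + 3) lam.
          of_real (\<Prod>i\<in>{1..s}. CG (chainL l lam (i-1)) (chainM m mu (i-1)) (int (l (i+1))) (m (i+1)) (lam i) (mu i))
          * B lam (chainM m mu s) m)"
    by auto
  let ?L = "int (l (s + 2))"
  \<comment> \<open>The longer chain is read as a shorter one followed by its last spin; clearing
    position \<open>Suc s\<close> gives back the shorter chain.\<close>
  define B' where "B' lam = couple (chainL l (lam(Suc s := 0)) s) ?L (lam (Suc s)) (s + 2) (B (lam(Suc s := 0)))" for lam
  have B'_upd: "B' (lam(Suc s := J)) = couple (chainL l lam s) ?L J (s + 2) (B lam)"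
    if "lam \<in> lam_set (s + 3) l" for lam J
  proof -
    have "lam(Suc s := 0) = lam" using that by (auto simp: lam_set_def fun_eq_iff)
    then show ?thesis by (simp add: B'_def)
  qed
  have inv': "invariant_tensor (Suc s + 2) n l (chainL l lam (Suc s)) (B' lam)" if lam: "lam \<in> lam_set (Suc s + 3) l" for lam
  proof -
    from lam have "lam \<in> lam_set (s + 4) l" by (simp add: eval_nat_numeral)
    then obtain lam0 J where l0: "lam0 \<in> lam_set (s + 3) l" "J \<in> spin_range (chainL l lam0 s) ?L" "lam = lam0(Suc s := J)"
      using bij_betw_imp_surj_on[OF lam_set_Suc[of s l]] by force
    have "invariant_tensor (Suc (s + 2)) n l J (couple (chainL l lam0 s) ?L J (s + 2) (B lam0))"
      using Suc.prems l0 chainL_nonneg[OF l0(1)] by (intro invariant_tensor_couple[OF B[OF l0(1)]]) (auto simp: triangle_def)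
    then show ?thesis unfolding l0(3) B'_upd[OF l0(1)] by (simp add: chainL_def)
  qed
  have "B0 (m 1) m = (\<Sum>lam\<in>lam_set (Suc s + 3) l. \<Sum>mu\<in>mu_set (Suc s + 3) lam.
          of_real (\<Prod>i\<in>{1..Suc s}. CG (chainL l lam (i-1)) (chainM m mu (i-1)) (int (l (i+1))) (m (i+1)) (lam i) (mu i))
          * B' lam (chainM m mu (Suc s)) m)" (is "_ = ?R")
    if m: "\<forall>i\<in>{1..n}. \<bar>m i\<bar> \<le> int (l i)" for m
  proof -
    let ?P = "\<lambda>t lam mu. (\<Prod>i\<in>{1..t}. CG (chainL l lam (i-1)) (chainM m mu (i-1)) (int (l (i+1))) (m (i+1)) (lam i) (mu i))"
    have P: "?P (Suc s) (lam(Suc s := J)) (mu(Suc s := M)) =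
        ?P s lam mu * CG (chainL l lam s) (chainM m mu s) ?L (m (s + 2)) J M" for lam J mu M
    proof -
      have "?P s (lam(Suc s := J)) (mu(Suc s := M)) = ?P s lam mu"
        by (intro prod.cong refl) (auto simp: chainL_def chainM_def)
      then show ?thesis by (simp add: chainL_def chainM_def)
    qed
    have "?R = (\<Sum>lam\<in>lam_set (s + 3) l. \<Sum>J\<in>spin_range (chainL l lam s) ?L. \<Sum>mu\<in>mu_set (s + 3) lam. \<Sum>M\<in>{-J..J}.
         of_real (?P s lam mu * CG (chainL l lam s) (chainM m mu s) ?L (m (s + 2)) J M)
            * couple (chainL l lam s) ?L J (s + 2) (B lam) M m)"
    proof -
      have "Suc s + 3 = s + 4" by simp
      then show ?thesis
        unfolding \<open>Suc s + 3 = s + 4\<close> sum_lam_set_Suc sum_mu_set_Suc P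
        by (intro sum.cong refl) (auto simp: B'_upd chainM_def)
    qed
    \<comment> \<open>The sums over \<open>J\<close> and \<open>mu\<close> commute because the
      admissible \<open>mu\<close> depend on the shorter chain only; \<open>J\<close> and
      \<open>M\<close> thus become innermost, as in \<open>couple_expand\<close>.\<close>
    also have "\<dots> = (\<Sum>lam\<in>lam_set (s + 3) l. \<Sum>mu\<in>mu_set (s + 3) lam. \<Sum>J\<in>spin_range (chainL l lam s) ?L. \<Sum>M\<in>{-J..J}.
         of_real (?P s lam mu * CG (chainL l lam s) (chainM m mu s) ?L (m (s + 2)) J M)
            * couple (chainL l lam s) ?L J (s + 2) (B lam) M m)"
      by (intro sum.cong[OF refl] sum.swap)
    also have "\<dots> = (\<Sum>lam\<in>lam_set (s + 3) l. \<Sum>mu\<in>mu_set (s + 3) lam.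
         of_real (?P s lam mu) * B lam (chainM m mu s) m)"
    proof (intro sum.cong[OF refl])
      fix lam mu assume lm: "lam \<in> lam_set (s + 3) l" "mu \<in> mu_set (s + 3) lam"
      have 1: "\<bar>chainM m mu s\<bar> \<le> chainL l lam s"
        using lm(2) m Suc.prems by (auto simp: chainM_def chainL_def mu_set_def)
      have 2: "\<bar>m (s + 2)\<bar> \<le> ?L" using m Suc.prems by auto
      show "(\<Sum>J\<in>spin_range (chainL l lam s) ?L. \<Sum>M\<in>{-J..J}.
         of_real (?P s lam mu * CG (chainL l lam s) (chainM m mu s) ?L (m (s + 2)) J M)
            * couple (chainL l lam s) ?L J (s + 2) (B lam) M m) = of_real (?P s lam mu) * B lam (chainM m mu s) m"
        unfolding couple_expand[where m=m and p="s + 2", OF 1 2, of "B lam"] by (simp only: sum_distrib_left of_real_mult mult.assoc)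
    qed
    finally show ?thesis using exp[OF m] by simp
  qed
  with inv' show ?case by blast
qed

text \<open>One further coupling, with index \<open>n - 1\<close>, leaves two indices of spins
  \<open>J\<close> and \<open>l n\<close>. By \<open>invariant_tensor_two\<close> only
  \<open>J = l n\<close> and \<open>M = - m n\<close> contribute, which supplies the last factor of
  \<open>coupledCG\<close>, the sign, and one constant for each chain: the entry
  \<open>P lam\<close>.\<close>

lemma invariant_expansion:
  assumes inv: "invariant_tensor 2 n l (int (l 1)) B0" and "3 \<le> n"
  shows "\<exists>P. \<forall>m. (\<forall>i\<in>{1..n}. \<bar>m i\<bar> \<le> int (l i)) \<longrightarrow>
     B0 (m 1) m = (-1) ^ nat \<bar>m n\<bar> * (\<Sum>lam\<in>lam_set n l. of_real (coupledCG n l m lam) * P lam)"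
proof -
  define s where "s = n - 3"
  then have n: "n = s + 3" using \<open>3 \<le> n\<close> by simp
  let ?L = "int (l (s + 2))"
  obtain B where B: "\<And>lam. lam \<in> lam_set n l \<Longrightarrow> invariant_tensor (s + 2) n l (chainL l lam s) (B lam)"
    and exp: "\<And>m. (\<forall>i\<in>{1..n}. \<bar>m i\<bar> \<le> int (l i)) \<Longrightarrow>
        B0 (m 1) m = (\<Sum>lam\<in>lam_set n l. \<Sum>mu\<in>mu_set n lam.
          of_real (\<Prod>i\<in>{1..s}. CG (chainL l lam (i-1)) (chainM m mu (i-1)) (int (l (i+1))) (m (i+1)) (lam i) (mu i))
          * B lam (chainM m mu s) m)"
    using couple_chain_expand[OF inv, of s] unfolding n by auto
  have "\<exists>c. \<forall>\<mu> m. \<bar>\<mu>\<bar> \<le> chainL l lam s \<longrightarrow> (\<forall>i\<in>{1..n}. \<bar>m i\<bar> \<le> int (l i)) \<longrightarrow>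
     B lam \<mu> m = of_real (CG (chainL l lam s) \<mu> ?L (m (s + 2)) (int (l n)) (- m n)) * ((-1) ^ nat \<bar>m n\<bar> * c)"
    if lam: "lam \<in> lam_set n l" for lam
  proof -
    let ?j = "chainL l lam s"
    have j: "0 \<le> ?j" using lam chainL_nonneg by (simp add: n)
    have "\<exists>c. \<forall>\<mu> m. \<bar>\<mu>\<bar> \<le> J \<longrightarrow> \<bar>m n\<bar> \<le> int (l n) \<longrightarrow>
      couple ?j ?L J (s + 2) (B lam) \<mu> m = (if J = int (l n) \<and> \<mu> = - m n then (-1) ^ nat \<bar>m n\<bar> * c else 0)"
      if "J \<in> spin_range ?j ?L" for J
    proof (rule invariant_tensor_two)
      have "invariant_tensor (Suc (s + 2)) n l J (couple ?j ?L J (s + 2) (B lam))"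
        using that j by (intro invariant_tensor_couple[OF B[OF lam]]) (auto simp: triangle_def n)
      then show "invariant_tensor n n l J (couple ?j ?L J (s + 2) (B lam))" by (simp add: n eval_nat_numeral)
    qed (use that in auto)
    \<comment> \<open>One constant for each \<open>J\<close>; the one at
      \<open>J = int (l n)\<close> survives and becomes the array entry.\<close>
    then obtain c where c: "\<And>J \<mu> m. J \<in> spin_range ?j ?L \<Longrightarrow> \<bar>\<mu>\<bar> \<le> J \<Longrightarrow> \<bar>m n\<bar> \<le> int (l n) \<Longrightarrow>
      couple ?j ?L J (s + 2) (B lam) \<mu> m = (if J = int (l n) \<and> \<mu> = - m n then (-1) ^ nat \<bar>m n\<bar> * c J else 0)"
      by metis
    show ?thesis
    proof (intro exI[of _ "c (int (l n))"] allI impI)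
      fix \<mu> m assume \<mu>: "\<bar>\<mu>\<bar> \<le> ?j" and m: "\<forall>i\<in>{1..n}. \<bar>m i\<bar> \<le> int (l i)"
      have mn: "\<bar>m n\<bar> \<le> int (l n)" "\<bar>m (s + 2)\<bar> \<le> ?L" using m by (auto simp: n)
      have "B lam \<mu> m = (\<Sum>J\<in>spin_range ?j ?L. \<Sum>M\<in>{-J..J}.
         of_real (CG ?j \<mu> ?L (m (s + 2)) J M) * couple ?j ?L J (s + 2) (B lam) M m)"
        by (rule couple_expand) (use \<mu> mn in auto)
      also have "\<dots> = (\<Sum>J\<in>spin_range ?j ?L. if J = int (l n) then (\<Sum>M\<in>{-J..J}. if M = - m n then
         of_real (CG ?j \<mu> ?L (m (s + 2)) J M) * ((-1) ^ nat \<bar>m n\<bar> * c J) else 0) else 0)"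
      proof (rule sum.cong[OF refl])
        fix J assume J: "J \<in> spin_range ?j ?L"
        have "(\<Sum>M\<in>{-J..J}. of_real (CG ?j \<mu> ?L (m (s + 2)) J M) * couple ?j ?L J (s + 2) (B lam) M m)
          = (\<Sum>M\<in>{-J..J}. of_real (CG ?j \<mu> ?L (m (s + 2)) J M) *
              (if J = int (l n) \<and> M = - m n then (-1) ^ nat \<bar>m n\<bar> * c J else 0))"
        proof (rule sum.cong[OF refl])
          fix M assume "M \<in> {-J..J}"
          then have "\<bar>M\<bar> \<le> J" by auto
          from c[where m=m, OF J this mn(1)]
          show "of_real (CG ?j \<mu> ?L (m (s + 2)) J M) * couple ?j ?L J (s + 2) (B lam) M m
            = of_real (CG ?j \<mu> ?L (m (s + 2)) J M) * (if J = int (l n) \<and> M = - m n then (-1) ^ nat \<bar>m n\<bar> * c J else 0)"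
            by simp
        qed
        also have "\<dots> = (if J = int (l n) then (\<Sum>M\<in>{-J..J}. if M = - m n then
           of_real (CG ?j \<mu> ?L (m (s + 2)) J M) * ((-1) ^ nat \<bar>m n\<bar> * c J) else 0) else 0)"
          by (cases "J = int (l n)")
            (simp_all only: simp_thms if_True if_False mult_zero_right sum.neutral_const if_distrib[of "(*) _"] cong: sum.cong)
        finally show "(\<Sum>M\<in>{-J..J}. of_real (CG ?j \<mu> ?L (m (s + 2)) J M) * couple ?j ?L J (s + 2) (B lam) M m)
          = (if J = int (l n) then (\<Sum>M\<in>{-J..J}. if M = - m n then
           of_real (CG ?j \<mu> ?L (m (s + 2)) J M) * ((-1) ^ nat \<bar>m n\<bar> * c J) else 0) else 0)" .
      qed
      also have "\<dots> = (if int (l n) \<in> spin_range ?j ?L then of_real (CG ?j \<mu> ?L (m (s + 2)) (int (l n)) (- m n)) * ((-1) ^ nat \<bar>m n\<bar> * c (int (l n))) else 0)"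
        using mn(1) by (simp add: sum.delta' sum.delta abs_le_iff minus_le_iff)
      also have "\<dots> = of_real (CG ?j \<mu> ?L (m (s + 2)) (int (l n)) (- m n)) * ((-1) ^ nat \<bar>m n\<bar> * c (int (l n)))"
        by (auto simp: CG_def)
      finally show "B lam \<mu> m = of_real (CG ?j \<mu> ?L (m (s + 2)) (int (l n)) (- m n)) * ((-1) ^ nat \<bar>m n\<bar> * c (int (l n)))" .
    qed
  qed
  then obtain P where P: "\<And>lam \<mu> m. lam \<in> lam_set n l \<Longrightarrow> \<bar>\<mu>\<bar> \<le> chainL l lam s \<Longrightarrow> (\<forall>i\<in>{1..n}. \<bar>m i\<bar> \<le> int (l i)) \<Longrightarrow>
     B lam \<mu> m = of_real (CG (chainL l lam s) \<mu> ?L (m (s + 2)) (int (l n)) (- m n)) * ((-1) ^ nat \<bar>m n\<bar> * P lam)"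
    by metis
  show ?thesis
  proof (intro exI[of _ P] allI impI)
    fix m assume m: "\<forall>i\<in>{1..n}. \<bar>m i\<bar> \<le> int (l i)"
    have b: "\<bar>chainM m mu s\<bar> \<le> chainL l lam s" if "mu \<in> mu_set n lam" for lam mu
      using that m by (auto simp: chainM_def chainL_def mu_set_def n)
    have "B0 (m 1) m = (\<Sum>lam\<in>lam_set n l. \<Sum>mu\<in>mu_set n lam.
          of_real (\<Prod>i\<in>{1..s}. CG (chainL l lam (i-1)) (chainM m mu (i-1)) (int (l (i+1))) (m (i+1)) (lam i) (mu i))
          * (of_real (CG (chainL l lam s) (chainM m mu s) ?L (m (s + 2)) (int (l n)) (- m n)) * ((-1) ^ nat \<bar>m n\<bar> * P lam)))"
      unfolding exp[OF m] by (intro sum.cong refl) (simp add: P[OF _ b m])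
    also have "\<dots> = (-1) ^ nat \<bar>m n\<bar> * (\<Sum>lam\<in>lam_set n l. of_real (coupledCG n l m lam) * P lam)"
    proof -
      have "n - 3 = s" "n - 1 = s + 2" by (simp_all add: n)
      then show ?thesis
        unfolding coupledCG_def of_real_sum of_real_mult sum_distrib_left sum_distrib_right
        by (simp only: mult_ac)
    qed
    finally show "B0 (m 1) m = (-1) ^ nat \<bar>m n\<bar> * (\<Sum>lam\<in>lam_set n l. of_real (coupledCG n l m lam) * P lam)" .
  qed
qed

section \<open>Isotropic fields and rotations of the sphere\<close>

lemma space_S2_measure [simp]: "space S2_measure = S2"
  by (simp add: S2_measure_def space_scale_measure space_restrict_space)

lemma sets_S2_measure [measurable_cong]: "sets S2_measure = sets (restrict_space borel S2)"
  by (simp add: S2_measure_def)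

lemma S2_sets: "A \<in> sets S2_measure \<longleftrightarrow> A \<subseteq> S2 \<and> A \<in> sets borel"
  by (simp add: sets_S2_measure sets_restrict_space_iff)

lemma radial_measurable [measurable]:
  "(\<lambda>x::real^3. x /\<^sub>R norm x) \<in> measurable (restrict_space lborel (ball 0 1 - {0})) (restrict_space borel S2)"
proof (rule measurable_restrict_space2)
  show "(\<lambda>x::real^3. x /\<^sub>R norm x) \<in> space (restrict_space lborel (ball 0 1 - {0})) \<rightarrow> S2"
    by (auto simp: space_restrict_space)
  show "(\<lambda>x::real^3. x /\<^sub>R norm x) \<in> restrict_space lborel (ball 0 1 - {0}) \<rightarrow>\<^sub>M borel"
    by (rule measurable_restrict_space1) measurable
qed

text \<open>Turns surface area into volume, so that the invariance of Lebesgue measure under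
  orthogonal maps can be used.\<close>

definition cone :: "(real^3) set \<Rightarrow> (real^3) set" where
  "cone A = {x \<in> ball 0 1 - {0}. x /\<^sub>R norm x \<in> A}"

lemma cone_borel: "A \<in> sets borel \<Longrightarrow> cone A \<in> sets borel"
proof -
  assume A: "A \<in> sets borel"
  have "(\<lambda>x::real^3. x /\<^sub>R norm x) \<in> borel \<rightarrow>\<^sub>M borel" by measurable
  from measurable_sets[OF this A]
  have "(ball 0 1 - {0}) \<inter> ((\<lambda>x. x /\<^sub>R norm x) -` A) \<in> sets borel"
    by (intro sets.Int sets.Diff) auto
  moreover have "cone A = (ball 0 1 - {0}) \<inter> ((\<lambda>x. x /\<^sub>R norm x) -` A)"
    by (auto simp: cone_def)
  ultimately show ?thesis by simp
qed

lemma emeasure_S2: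
  assumes "A \<in> sets S2_measure" shows "emeasure S2_measure A = 3 * emeasure lborel (cone A)"
proof -
  have "emeasure S2_measure A = 3 * emeasure (restrict_space lborel (ball 0 1 - {0}))
     ((\<lambda>x. x /\<^sub>R norm x) -` A \<inter> space (restrict_space lborel (ball 0 1 - {0})))"
    unfolding S2_measure_def emeasure_scale_measure
    using assms by (subst emeasure_distr[OF radial_measurable]) (simp_all add: sets_S2_measure)
  also have "(\<lambda>x. x /\<^sub>R norm x) -` A \<inter> space (restrict_space lborel (ball 0 1 - {0})) = cone A"
    by (auto simp: cone_def space_restrict_space)
  also have "emeasure (restrict_space lborel (ball 0 1 - {0})) (cone A) = emeasure lborel (cone A)"
    by (rule emeasure_restrict_space) (auto simp: cone_def)
  finally show ?thesis .
qed

lemma bounded_cone: "bounded (cone A)"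
  by (rule bounded_subset[of "ball 0 1"]) (auto simp: cone_def)

lemma finite_measure_S2: "finite_measure S2_measure"
proof
  have "emeasure lborel (cone S2) < \<infinity>"
    using bounded_cone by (rule emeasure_bounded_finite)
  moreover have "S2 \<in> sets S2_measure" using sets.top[of S2_measure] by simp
  ultimately show "emeasure S2_measure (space S2_measure) \<noteq> \<infinity>"
    by (simp add: emeasure_S2 ennreal_mult_eq_top_iff)
qed

lemma SO3_orthogonal: "g \<in> SO3 \<Longrightarrow> orthogonal_transformation ((*v) g)"
  by (simp add: SO3_def orthogonal_transformation_matrix matrix_vector_mul_linear)

lemma SO3_norm [simp]: "g \<in> SO3 \<Longrightarrow> norm (g *v x) = norm x"
  using SO3_orthogonal orthogonal_transformation by blast

text \<open>Orthogonal images preserve \<open>measure\<close>; boundedness makes the sets of finite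
  measure, which carries the equality over to \<open>emeasure\<close>.\<close>

lemma emeasure_rotate:
  assumes g: "g \<in> SO3" and A: "A \<in> sets borel" and bd: "bounded A"
  shows "emeasure lborel {x. g *v x \<in> A} = emeasure lborel A"
proof -
  have o: "orthogonal_transformation ((*v) g)" by (rule SO3_orthogonal[OF g])
  let ?B = "{x. g *v x \<in> A}"
  have im: "A = (*v) g ` ?B" using orthogonal_transformation_surj[OF o] by auto
  have Bb: "?B \<in> sets borel"
  proof -
    have "(\<lambda>x. g *v x) \<in> borel \<rightarrow>\<^sub>M borel"
      by (intro borel_measurable_continuous_onI linear_continuous_on matrix_vector_mul_bounded_linear)
    from measurable_sets[OF this A] show ?thesis by (simp add: vimage_def)
  qed
  obtain r where r: "\<And>x. x \<in> A \<Longrightarrow> norm x \<le> r" using bd by (auto simp: bounded_iff)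
  have "bounded ?B" unfolding bounded_iff using r SO3_norm[OF g] by (metis mem_Collect_eq)
  then have "?B \<in> lmeasurable" using Bb by (intro bounded_set_imp_lmeasurable) auto
  moreover have "A \<in> lmeasurable" using bd A by (intro bounded_set_imp_lmeasurable) auto
  ultimately have "emeasure lebesgue ?B = emeasure lebesgue A"
    using measure_orthogonal_image[OF o, of ?B] im by (simp add: emeasure_eq_measure2)
  then show ?thesis using A Bb by simp
qed

lemma SO3_measurable:
  assumes "g \<in> SO3" shows "(\<lambda>x. g *v x) \<in> measurable S2_measure S2_measure"
proof -
  have "(\<lambda>x. g *v x) \<in> restrict_space borel S2 \<rightarrow>\<^sub>M restrict_space borel S2"
  proof (rule measurable_restrict_space2)
    show "(*v) g \<in> restrict_space borel S2 \<rightarrow>\<^sub>M borel"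
      by (intro measurable_restrict_space1 borel_measurable_continuous_onI linear_continuous_on matrix_vector_mul_bounded_linear)
  qed (use assms in \<open>auto simp: space_restrict_space\<close>)
  then show ?thesis by (simp cong: measurable_cong_sets add: sets_S2_measure)
qed

text \<open>Rotations are linear and preserve norms, hence commute with the radial projection and
  with the formation of cones.\<close>

lemma distr_S2:
  assumes g: "g \<in> SO3" shows "distr S2_measure S2_measure (\<lambda>x. g *v x) = S2_measure"
proof (rule measure_eqI)
  fix A assume "A \<in> sets (distr S2_measure S2_measure ((*v) g))"
  then have A: "A \<in> sets S2_measure" by simp
  note m = SO3_measurable[OF g]
  let ?B = "(*v) g -` A \<inter> space S2_measure"
  have B: "?B \<in> sets S2_measure" by (rule measurable_sets[OF m A])
  have "cone ?B = {x. g *v x \<in> cone A}"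
    using g A by (auto simp: cone_def matrix_vector_mult_scaleR S2_sets)
  then have "emeasure lborel (cone ?B) = emeasure lborel (cone A)"
    using emeasure_rotate[OF g cone_borel bounded_cone, of A] A by (simp add: S2_sets)
  then show "emeasure (distr S2_measure S2_measure ((*v) g)) A = emeasure S2_measure A"
    unfolding emeasure_distr[OF m A] emeasure_S2[OF A] emeasure_S2[OF B] by simp
qed simp

lemma SO3_transitive:
  assumes "x \<in> S2" "y \<in> S2" shows "\<exists>g\<in>SO3. g *v x = y"
proof -
  obtain f where f: "orthogonal_transformation f" "det (matrix f) = 1" "f x = y"
    using rotation_exists[of x y] assms by auto
  then have "matrix f *v x = y"
    using matrix_vector_mul(2)[OF orthogonal_transformation_linear[OF f(1)]] by metis
  moreover have "matrix f \<in> SO3" using f by (simp add: SO3_def orthogonal_transformation_matrix)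
  ultimately show ?thesis by blast
qed

lemma continuous_S2_measurable:
  fixes f :: "real^3 \<Rightarrow> complex"
  assumes "continuous_on S2 f" shows "f \<in> borel_measurable S2_measure"
  using borel_measurable_continuous_on_restrict[OF assms] by (simp cong: measurable_cong_sets add: sets_S2_measure)

lemma continuous_S2_bounded:
  fixes f :: "real^3 \<Rightarrow> complex"
  assumes "continuous_on S2 f" shows "\<exists>C\<ge>0. \<forall>x\<in>S2. norm (f x) \<le> C"
proof -
  have "bounded (f ` S2)" using assms by (intro compact_imp_bounded compact_continuous_image) auto
  then obtain C where "\<forall>x\<in>S2. norm (f x) \<le> C" by (auto simp: bounded_iff)
  then show ?thesis by (intro exI[of _ "\<bar>C\<bar>"]) auto
qed

lemma continuous_rotate:
  assumes "continuous_on S2 f" "g \<in> SO3" shows "continuous_on S2 (\<lambda>x. f (g *v x))"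
  by (rule continuous_on_compose2[OF assms(1)])
     (use assms(2) in \<open>auto intro!: linear_continuous_on matrix_vector_mul_bounded_linear\<close>)

lemma rotate_PiM_measurable:
  "g \<in> SO3 \<Longrightarrow> (\<lambda>x. \<lambda>i\<in>B. g *v x i) \<in> measurable (PiM B (\<lambda>_. S2_measure)) (PiM B (\<lambda>_. S2_measure))"
  by (intro measurable_restrict)
     (rule measurable_compose[OF measurable_component_singleton], auto intro: SO3_measurable)

text \<open>The same rotation acts in every coordinate; comparing the measures on boxes reduces the
  claim to one factor at a time.\<close>

lemma distr_PiM_S2:
  assumes g: "g \<in> SO3" and "finite B"
  shows "distr (PiM B (\<lambda>_. S2_measure)) (PiM B (\<lambda>_. S2_measure)) (\<lambda>x. \<lambda>i\<in>B. g *v x i) = PiM B (\<lambda>_. S2_measure)"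
proof -
  interpret finite_measure S2_measure by (rule finite_measure_S2)
  interpret product_sigma_finite "\<lambda>_::'a. S2_measure" by standard
  note m = SO3_measurable[OF g]
  show ?thesis
  proof (rule PiM_eqI[OF \<open>finite B\<close>])
    fix A :: "'a \<Rightarrow> (real^3) set" assume A: "\<And>i. i \<in> B \<Longrightarrow> A i \<in> sets S2_measure"
    have "emeasure (distr (PiM B (\<lambda>_. S2_measure)) (PiM B (\<lambda>_. S2_measure)) (\<lambda>x. \<lambda>i\<in>B. g *v x i)) (Pi\<^sub>E B A)
      = emeasure (PiM B (\<lambda>_. S2_measure)) ((\<lambda>x. \<lambda>i\<in>B. g *v x i) -` (Pi\<^sub>E B A) \<inter> space (PiM B (\<lambda>_. S2_measure)))"
      using A \<open>finite B\<close> by (intro emeasure_distr sets_PiM_I_finite rotate_PiM_measurable g) auto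
    also have "(\<lambda>x. \<lambda>i\<in>B. g *v x i) -` (Pi\<^sub>E B A) \<inter> space (PiM B (\<lambda>_. S2_measure))
      = Pi\<^sub>E B (\<lambda>i. (\<lambda>x. g *v x) -` A i \<inter> space S2_measure)"
      by (auto simp: space_PiM PiE_iff)
    also have "emeasure (PiM B (\<lambda>_. S2_measure)) \<dots> = (\<Prod>i\<in>B. emeasure S2_measure ((\<lambda>x. g *v x) -` A i \<inter> space S2_measure))"
      using A \<open>finite B\<close> by (intro emeasure_PiM measurable_sets[OF m]) auto
    also have "\<dots> = (\<Prod>i\<in>B. emeasure S2_measure (A i))"
    proof (rule prod.cong[OF refl])
      fix i assume "i \<in> B"
      from emeasure_distr[OF m A[OF this]]
      show "emeasure S2_measure ((\<lambda>x. g *v x) -` A i \<inter> space S2_measure) = emeasure S2_measure (A i)"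
        by (simp add: distr_S2[OF g])
    qed
    finally show "emeasure (distr (PiM B (\<lambda>_. S2_measure)) (PiM B (\<lambda>_. S2_measure)) (\<lambda>x. \<lambda>i\<in>B. g *v x i)) (Pi\<^sub>E B A)
      = (\<Prod>i\<in>B. emeasure S2_measure (A i))" .
  qed simp
qed

text \<open>The product is at most the power \<open>card B\<close> of the largest factor, and that
  is at most 1 plus its \<open>n\<close>-th power. Mixed moments are thereby controlled by
  \<open>n\<close>-th moments at single points.\<close>

lemma prod_bound:
  fixes t :: "'i \<Rightarrow> real"
  assumes "finite B" "card B \<le> n"
  shows "(\<Prod>i\<in>B. \<bar>t i\<bar>) \<le> 1 + (\<Sum>i\<in>B. \<bar>t i\<bar> ^ n)"
proof (cases "B = {}")
  case False
  define m where "m = Max ((\<lambda>i. \<bar>t i\<bar>) ` B)"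
  have m: "\<bar>t i\<bar> \<le> m" if "i \<in> B" for i using assms that by (auto simp: m_def)
  have "m \<in> (\<lambda>i. \<bar>t i\<bar>) ` B" unfolding m_def using assms False by (intro Max_in) auto
  then obtain j where j: "j \<in> B" "m = \<bar>t j\<bar>" by auto
  have "(\<Prod>i\<in>B. \<bar>t i\<bar>) \<le> (\<Prod>i\<in>B. m)" using m by (intro prod_mono) auto
  also have "\<dots> = m ^ card B" by simp
  also have "\<dots> \<le> 1 + m ^ n"
  proof (cases "m \<le> 1")
    case True
    then show ?thesis using j power_le_one[of m "card B"] zero_le_power[of m n] by linarith
  next
    case False
    then have "m ^ card B \<le> m ^ n" using assms(2) by (intro power_increasing) auto
    then show ?thesis by simp
  qed
  also have "m ^ n \<le> (\<Sum>i\<in>B. \<bar>t i\<bar> ^ n)"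
    unfolding j(2) using assms j(1) by (intro member_le_sum[of j B "\<lambda>i. \<bar>t i\<bar> ^ n"]) auto
  finally show ?thesis by simp
qed simp

text \<open>\<open>alm\<close> with an arbitrary test function, so that derivatives of harmonics can
  be inserted as well.\<close>

definition field_coeff :: "('w \<Rightarrow> real^3 \<Rightarrow> real) \<Rightarrow> (real^3 \<Rightarrow> complex) \<Rightarrow> 'w \<Rightarrow> complex" where
  "field_coeff T f \<omega> = (\<integral>x. complex_of_real (T \<omega> x) * f x \<partial>S2_measure)"

section \<open>Moments as integrals against a correlation kernel\<close>

locale isotropic_field = prob_space M for M :: "'w measure" +
  fixes T :: "'w \<Rightarrow> real^3 \<Rightarrow> real" and n :: nat
  assumes field: "random_field_S2 M T"
    and iso: "strongly_isotropic M T"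
    and moments: "\<forall>x\<in>S2. integrable M (\<lambda>\<omega>. \<bar>T \<omega> x\<bar> ^ n)"
begin

lemma T_joint: "(\<lambda>(\<omega>, x). T \<omega> x) \<in> borel_measurable (M \<Otimes>\<^sub>M S2_measure)"
  using field by (simp add: random_field_S2_def)

lemma T_meas: "x \<in> S2 \<Longrightarrow> (\<lambda>\<omega>. T \<omega> x) \<in> borel_measurable M"
  using field by (auto simp: random_field_S2_def)

lemma isotropy:
  fixes h :: "(nat \<Rightarrow> real) \<Rightarrow> real"
  assumes xs: "\<And>i. i < k \<Longrightarrow> xs i \<in> S2" and g: "g \<in> SO3" and h: "h \<in> borel_measurable (PiM {..<k} (\<lambda>_. borel))"
  shows "(\<integral>\<omega>. h (\<lambda>i\<in>{..<k}. T \<omega> (xs i)) \<partial>M) = (\<integral>\<omega>. h (\<lambda>i\<in>{..<k}. T \<omega> (g *v xs i)) \<partial>M)"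
proof -
  have m: "(\<lambda>\<omega>. \<lambda>i\<in>{..<k}. T \<omega> (ys i)) \<in> measurable M (PiM {..<k} (\<lambda>_. borel))"
    if "\<And>i. i < k \<Longrightarrow> ys i \<in> S2" for ys
    using that by (intro measurable_restrict T_meas) auto
  have "(\<integral>\<omega>. h (\<lambda>i\<in>{..<k}. T \<omega> (xs i)) \<partial>M) =
     integral\<^sup>L (distr M (PiM {..<k} (\<lambda>_. borel)) (\<lambda>\<omega>. \<lambda>i\<in>{..<k}. T \<omega> (xs i))) h"
    by (rule integral_distr[symmetric, OF m h]) (use xs in auto)
  also have "distr M (PiM {..<k} (\<lambda>_. borel)) (\<lambda>\<omega>. \<lambda>i\<in>{..<k}. T \<omega> (xs i)) =
     distr M (PiM {..<k} (\<lambda>_. borel)) (\<lambda>\<omega>. \<lambda>i\<in>{..<k}. T \<omega> (g *v xs i))"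
    using iso xs g unfolding strongly_isotropic_def by blast
  also have "integral\<^sup>L \<dots> h = (\<integral>\<omega>. h (\<lambda>i\<in>{..<k}. T \<omega> (g *v xs i)) \<partial>M)"
    by (rule integral_distr[OF m h]) (use xs g in auto)
  finally show ?thesis .
qed

text \<open>Isotropy for a single point, combined with the transitivity of rotations on the sphere.
  The resulting uniform bound is what later gives integrability over the product space.\<close>

lemma moment_const: "\<exists>c\<ge>0. \<forall>x\<in>S2. (\<integral>\<omega>. \<bar>T \<omega> x\<bar> ^ n \<partial>M) = c"
proof -
  have e: "axis 1 1 \<in> S2" by simp
  show ?thesis
  proof (intro exI[of _ "\<integral>\<omega>. \<bar>T \<omega> (axis 1 1)\<bar> ^ n \<partial>M"] conjI ballI)
    fix x assume x: "x \<in> S2"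
    obtain g where g: "g \<in> SO3" "g *v axis 1 1 = x" using SO3_transitive[OF e x] by auto
    have "(\<lambda>y::nat \<Rightarrow> real. \<bar>y 0\<bar> ^ n) \<in> borel_measurable (PiM {..<1} (\<lambda>_. borel))" by measurable
    from isotropy[where k=1 and xs="\<lambda>_. axis 1 1", OF _ g(1) this] e
    show "(\<integral>\<omega>. \<bar>T \<omega> x\<bar> ^ n \<partial>M) = (\<integral>\<omega>. \<bar>T \<omega> (axis 1 1)\<bar> ^ n \<partial>M)" by (simp add: g(2))
  qed (intro integral_nonneg_AE, simp)
qed

lemma prod_moment:
  fixes B :: "'i set"
  assumes "finite B" "card B \<le> n"
  shows "\<exists>C\<ge>0. \<forall>x. (\<forall>i\<in>B. x i \<in> S2) \<longrightarrow>
     integrable M (\<lambda>\<omega>. \<Prod>i\<in>B. \<bar>T \<omega> (x i)\<bar>) \<and> (\<integral>\<omega>. (\<Prod>i\<in>B. \<bar>T \<omega> (x i)\<bar>) \<partial>M) \<le> C"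
proof -
  obtain c where c: "c \<ge> 0" "\<And>x. x \<in> S2 \<Longrightarrow> (\<integral>\<omega>. \<bar>T \<omega> x\<bar> ^ n \<partial>M) = c"
    using moment_const by auto
  show ?thesis
  proof (intro exI[of _ "1 + card B * c"] conjI allI impI)
    fix x :: "'i \<Rightarrow> real^3" assume x: "\<forall>i\<in>B. x i \<in> S2"
    have I: "integrable M (\<lambda>\<omega>. 1 + (\<Sum>i\<in>B. \<bar>T \<omega> (x i)\<bar> ^ n))"
      using x moments by (intro Bochner_Integration.integrable_add Bochner_Integration.integrable_sum) auto
    have m: "(\<lambda>\<omega>. \<Prod>i\<in>B. \<bar>T \<omega> (x i)\<bar>) \<in> borel_measurable M"
      using x by (intro borel_measurable_prod borel_measurable_abs T_meas) auto
    have b: "norm (\<Prod>i\<in>B. \<bar>T \<omega> (x i)\<bar>) \<le> norm (1 + (\<Sum>i\<in>B. \<bar>T \<omega> (x i)\<bar> ^ n))" for \<omega>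
      using prod_bound[OF assms, of "\<lambda>i. T \<omega> (x i)"] by (simp add: abs_prod sum_nonneg)
    show J: "integrable M (\<lambda>\<omega>. \<Prod>i\<in>B. \<bar>T \<omega> (x i)\<bar>)"
      by (rule Bochner_Integration.integrable_bound[OF I m]) (use b in auto)
    have "(\<integral>\<omega>. (\<Prod>i\<in>B. \<bar>T \<omega> (x i)\<bar>) \<partial>M) \<le> (\<integral>\<omega>. 1 + (\<Sum>i\<in>B. \<bar>T \<omega> (x i)\<bar> ^ n) \<partial>M)"
      using prod_bound[OF assms] by (intro integral_mono J I) auto
    also have "\<dots> = 1 + (\<Sum>i\<in>B. \<integral>\<omega>. \<bar>T \<omega> (x i)\<bar> ^ n \<partial>M)"
      using x moments by (subst Bochner_Integration.integral_add) (auto simp: Bochner_Integration.integral_sum prob_space)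
    also have "\<dots> = 1 + card B * c" using x c by simp
    finally show "(\<integral>\<omega>. (\<Prod>i\<in>B. \<bar>T \<omega> (x i)\<bar>) \<partial>M) \<le> 1 + card B * c" .
  qed (use c in auto)
qed

abbreviation S2_prod :: "'i set \<Rightarrow> ('i \<Rightarrow> real^3) measure" where
  "S2_prod B \<equiv> PiM B (\<lambda>_. S2_measure)"

lemma T_coord [measurable]:
  assumes "i \<in> B"
  shows "(\<lambda>p. T (fst p) (snd p i)) \<in> borel_measurable (M \<Otimes>\<^sub>M S2_prod B)"
proof -
  have "(\<lambda>p. (fst p, snd p i)) \<in> M \<Otimes>\<^sub>M S2_prod B \<rightarrow>\<^sub>M M \<Otimes>\<^sub>M S2_measure"
    using assms by measurable
  from measurable_compose[OF this T_joint] show ?thesis by simp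
qed

lemma finite_measure_S2_prod: "finite B \<Longrightarrow> finite_measure (S2_prod B)"
proof -
  assume "finite B"
  interpret S: finite_measure S2_measure by (rule finite_measure_S2)
  interpret product_sigma_finite "\<lambda>_::'i. S2_measure" by standard
  show ?thesis
  proof
    show "emeasure (S2_prod B) (space (S2_prod B)) \<noteq> \<infinity>"
      using \<open>finite B\<close> S.emeasure_finite[of S2]
      by (simp add: space_PiM emeasure_PiM sets.top[of S2_measure, simplified] power_eq_top_ennreal)
  qed
qed

text \<open>The hypothesis of Fubini's theorem: product moments are bounded uniformly in the points,
  the spheres have finite measure, and continuous functions are bounded on the sphere.\<close>

lemma integrable_field_prod:
  fixes B :: "'i set"
  assumes "finite B" "card B \<le> n" and f: "\<And>i. i \<in> B \<Longrightarrow> continuous_on S2 (f i)"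
  shows "integrable (M \<Otimes>\<^sub>M S2_prod B) (\<lambda>(\<omega>, x). \<Prod>i\<in>B. complex_of_real (T \<omega> (x i)) * f i (x i))"
proof -
  interpret PB: finite_measure "S2_prod B" by (rule finite_measure_S2_prod[OF assms(1)])
  interpret P: pair_sigma_finite M "S2_prod B" ..
  obtain C where C: "C \<ge> 0" "\<And>x. (\<forall>i\<in>B. x i \<in> S2) \<Longrightarrow> integrable M (\<lambda>\<omega>. \<Prod>i\<in>B. \<bar>T \<omega> (x i)\<bar>) \<and> (\<integral>\<omega>. (\<Prod>i\<in>B. \<bar>T \<omega> (x i)\<bar>) \<partial>M) \<le> C"
    using prod_moment[OF assms(1,2)] by blast
  have m1: "(\<lambda>p. \<Prod>i\<in>B. \<bar>T (fst p) (snd p i)\<bar>) \<in> borel_measurable (M \<Otimes>\<^sub>M S2_prod B)"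
    by measurable
  have I: "integrable (M \<Otimes>\<^sub>M S2_prod B) (\<lambda>p. \<Prod>i\<in>B. \<bar>T (fst p) (snd p i)\<bar>)"
  proof (rule integrableI_bounded[OF m1])
    have "(\<integral>\<^sup>+p. ennreal (norm (\<Prod>i\<in>B. \<bar>T (fst p) (snd p i)\<bar>)) \<partial>(M \<Otimes>\<^sub>M S2_prod B)) =
      (\<integral>\<^sup>+x. \<integral>\<^sup>+\<omega>. ennreal (norm (\<Prod>i\<in>B. \<bar>T \<omega> (x i)\<bar>)) \<partial>M \<partial>S2_prod B)"
      using m1 by (subst P.nn_integral_snd[symmetric]) (auto simp: case_prod_beta)
    also have "\<dots> \<le> (\<integral>\<^sup>+x. ennreal C \<partial>S2_prod B)"
    proof (rule nn_integral_mono)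
      fix x assume "x \<in> space (S2_prod B)"
      then have x: "\<forall>i\<in>B. x i \<in> S2" by (auto simp: space_PiM PiE_iff)
      have "(\<integral>\<^sup>+\<omega>. ennreal (norm (\<Prod>i\<in>B. \<bar>T \<omega> (x i)\<bar>)) \<partial>M) = ennreal (\<integral>\<omega>. (\<Prod>i\<in>B. \<bar>T \<omega> (x i)\<bar>) \<partial>M)"
        using C(2)[OF x] by (subst nn_integral_eq_integral) (auto simp: abs_prod prod_nonneg)
      also have "\<dots> \<le> ennreal C" using C(2)[OF x] by (intro ennreal_leI) auto
      finally show "(\<integral>\<^sup>+\<omega>. ennreal (norm (\<Prod>i\<in>B. \<bar>T \<omega> (x i)\<bar>)) \<partial>M) \<le> ennreal C" .
    qed
    also have "\<dots> < \<infinity>" using PB.emeasure_finite by (auto simp: ennreal_mult_less_top less_top[symmetric] ennreal_mult_eq_top_iff)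
    finally show "(\<integral>\<^sup>+p. ennreal (norm (\<Prod>i\<in>B. \<bar>T (fst p) (snd p i)\<bar>)) \<partial>(M \<Otimes>\<^sub>M S2_prod B)) < \<infinity>" .
  qed
  have "\<forall>i\<in>B. \<exists>D\<ge>0. \<forall>x\<in>S2. norm (f i x) \<le> D" using f continuous_S2_bounded by blast
  then obtain D where D: "\<And>i. i \<in> B \<Longrightarrow> D i \<ge> 0" "\<And>i x. i \<in> B \<Longrightarrow> x \<in> S2 \<Longrightarrow> norm (f i x) \<le> D i" by metis
  have fm: "(\<lambda>p. f i (snd p i)) \<in> borel_measurable (M \<Otimes>\<^sub>M S2_prod B)" if "i \<in> B" for i
  proof -
    have "(\<lambda>p. snd p i) \<in> M \<Otimes>\<^sub>M S2_prod B \<rightarrow>\<^sub>M S2_measure" using that by measurable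
    from measurable_compose[OF this continuous_S2_measurable[OF f[OF that]]] show ?thesis .
  qed
  have m2: "(\<lambda>p. \<Prod>i\<in>B. complex_of_real (T (fst p) (snd p i)) * f i (snd p i)) \<in> borel_measurable (M \<Otimes>\<^sub>M S2_prod B)"
    by (intro borel_measurable_prod borel_measurable_times fm measurable_compose[OF T_coord borel_measurable_of_real])
  have "integrable (M \<Otimes>\<^sub>M S2_prod B) (\<lambda>p. \<Prod>i\<in>B. complex_of_real (T (fst p) (snd p i)) * f i (snd p i))"
  proof (rule Bochner_Integration.integrable_bound[OF integrable_mult_right[OF I, of "\<Prod>i\<in>B. D i"] m2], rule AE_I2)
    fix p assume "p \<in> space (M \<Otimes>\<^sub>M S2_prod B)"
    then have x: "\<forall>i\<in>B. snd p i \<in> S2" by (auto simp: space_PiM PiE_iff space_pair_measure)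
    have "norm (\<Prod>i\<in>B. complex_of_real (T (fst p) (snd p i)) * f i (snd p i)) = (\<Prod>i\<in>B. \<bar>T (fst p) (snd p i)\<bar> * norm (f i (snd p i)))"
      by (simp add: prod_norm[symmetric] norm_mult)
    also have "\<dots> \<le> (\<Prod>i\<in>B. \<bar>T (fst p) (snd p i)\<bar> * D i)"
      using D x by (intro prod_mono) (auto intro: mult_left_mono)
    also have "\<dots> = (\<Prod>i\<in>B. D i) * (\<Prod>i\<in>B. \<bar>T (fst p) (snd p i)\<bar>)" by (simp add: prod.distrib mult.commute)
    finally show "norm (\<Prod>i\<in>B. complex_of_real (T (fst p) (snd p i)) * f i (snd p i)) \<le>
       norm ((\<Prod>i\<in>B. D i) * (\<Prod>i\<in>B. \<bar>T (fst p) (snd p i)\<bar>))" by simp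
  qed
  then show ?thesis by (simp add: case_prod_unfold)
qed

definition corr :: "'i set \<Rightarrow> ('i \<Rightarrow> real^3) \<Rightarrow> real" where
  "corr B x = (\<integral>\<omega>. (\<Prod>i\<in>B. T \<omega> (x i)) \<partial>M)"

text \<open>The one-point case of \<open>integrable_field_prod\<close>, with the index type
  \<open>unit\<close>; Fubini gives integrability of almost every path, as required to multiply path
  integrals.\<close>

lemma AE_integrable_field:
  assumes "1 \<le> n" and f: "continuous_on S2 f"
  shows "AE \<omega> in M. integrable S2_measure (\<lambda>x. complex_of_real (T \<omega> x) * f x)"
proof -
  interpret S: finite_measure S2_measure by (rule finite_measure_S2)
  interpret product_sigma_finite "\<lambda>_::unit. S2_measure" by standard
  interpret PB: finite_measure "S2_prod {()}" by (rule finite_measure_S2_prod) simp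
  interpret P: pair_sigma_finite M "S2_prod {()}" ..
  have "integrable (M \<Otimes>\<^sub>M S2_prod {()}) (\<lambda>(\<omega>, x). \<Prod>i\<in>{()}. complex_of_real (T \<omega> (x i)) * f (x i))"
    using assms by (intro integrable_field_prod) auto
  from P.AE_integrable_fst[OF this]
  have "AE \<omega> in M. integrable (S2_prod {()}) (\<lambda>x. complex_of_real (T \<omega> (x ())) * f (x ()))" by simp
  then show ?thesis
  proof (rule AE_mp, intro AE_I2 impI)
    fix \<omega> assume \<omega>: "\<omega> \<in> space M" and I: "integrable (S2_prod {()}) (\<lambda>x. complex_of_real (T \<omega> (x ())) * f (x ()))"
    have [measurable]: "(\<lambda>x. T \<omega> x) \<in> borel_measurable S2_measure"
      using measurable_Pair2[OF T_joint \<omega>] by simp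
    have [measurable]: "f \<in> borel_measurable S2_measure" by (rule continuous_S2_measurable[OF f])
    have "integrable (distr (S2_prod {()}) S2_measure (\<lambda>x. x ())) (\<lambda>x. complex_of_real (T \<omega> x) * f x)"
      using I by (subst integrable_distr_eq) auto
    then show "integrable S2_measure (\<lambda>x. complex_of_real (T \<omega> x) * f x)"
      by (simp add: distr_singleton)
  qed
qed

text \<open>For almost every \<open>\<omega>\<close> a product of integrals over the sphere is one
  integral over the product of spheres; exchanging it with the expectation leaves the correlation of
  the field as kernel.\<close>

lemma moment_kernel:
  fixes B :: "'i set"
  assumes "finite B" "card B \<le> n" and f: "\<And>i. i \<in> B \<Longrightarrow> continuous_on S2 (f i)"
  shows "(\<integral>\<omega>. (\<Prod>i\<in>B. field_coeff T (f i) \<omega>) \<partial>M) = (\<integral>x. complex_of_real (corr B x) * (\<Prod>i\<in>B. f i (x i)) \<partial>S2_prod B)"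
    and "integrable (S2_prod B) (\<lambda>x. complex_of_real (corr B x) * (\<Prod>i\<in>B. f i (x i)))"
proof -
  interpret S: finite_measure S2_measure by (rule finite_measure_S2)
  interpret product_sigma_finite "\<lambda>_::'i. S2_measure" by standard
  interpret PB: finite_measure "S2_prod B" by (rule finite_measure_S2_prod[OF assms(1)])
  interpret P: pair_sigma_finite M "S2_prod B" ..
  note I = integrable_field_prod[where f=f, OF assms]
  have inner: "(\<integral>\<omega>. (\<Prod>i\<in>B. complex_of_real (T \<omega> (x i)) * f i (x i)) \<partial>M) = complex_of_real (corr B x) * (\<Prod>i\<in>B. f i (x i))" for x
    by (simp add: prod.distrib corr_def of_real_prod[symmetric] del: of_real_prod)
  have "AE \<omega> in M. \<forall>i\<in>B. integrable S2_measure (\<lambda>x. complex_of_real (T \<omega> x) * f i x)"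
  proof (rule AE_finite_allI[OF assms(1)])
    fix i assume "i \<in> B"
    then have "1 \<le> n" using assms(1,2) by (metis One_nat_def Suc_leI card_gt_0_iff empty_iff le_trans)
    then show "AE \<omega> in M. integrable S2_measure (\<lambda>x. complex_of_real (T \<omega> x) * f i x)"
      using f[OF \<open>i \<in> B\<close>] by (rule AE_integrable_field)
  qed
  then have ae: "AE \<omega> in M. (\<Prod>i\<in>B. field_coeff T (f i) \<omega>) = (\<integral>x. (\<Prod>i\<in>B. complex_of_real (T \<omega> (x i)) * f i (x i)) \<partial>S2_prod B)"
  proof (rule AE_mp, intro AE_I2 impI)
    fix \<omega> assume "\<forall>i\<in>B. integrable S2_measure (\<lambda>x. complex_of_real (T \<omega> x) * f i x)"
    then show "(\<Prod>i\<in>B. field_coeff T (f i) \<omega>) = (\<integral>x. (\<Prod>i\<in>B. complex_of_real (T \<omega> (x i)) * f i (x i)) \<partial>S2_prod B)"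
      unfolding field_coeff_def by (intro product_integral_prod[symmetric] assms(1)) auto
  qed
  have m: "(\<lambda>\<omega>. \<integral>x. (\<Prod>i\<in>B. complex_of_real (T \<omega> (x i)) * f i (x i)) \<partial>S2_prod B) \<in> borel_measurable M"
    using P.integrable_fst[OF I] by (rule borel_measurable_integrable)
  have "(\<integral>\<omega>. (\<Prod>i\<in>B. field_coeff T (f i) \<omega>) \<partial>M) = (\<integral>\<omega>. \<integral>x. (\<Prod>i\<in>B. complex_of_real (T \<omega> (x i)) * f i (x i)) \<partial>S2_prod B \<partial>M)"
  proof (rule integral_cong_AE[OF _ m ae])
    show "(\<lambda>\<omega>. \<Prod>i\<in>B. field_coeff T (f i) \<omega>) \<in> borel_measurable M"
    proof (rule borel_measurable_prod)
      fix i assume "i \<in> B"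
      then have [measurable]: "f i \<in> borel_measurable S2_measure" by (intro continuous_S2_measurable f)
      have [measurable]: "(\<lambda>p. T (fst p) (snd p)) \<in> borel_measurable (M \<Otimes>\<^sub>M S2_measure)" using T_joint by (simp add: case_prod_beta)
      have "(\<lambda>(\<omega>, x). complex_of_real (T \<omega> x) * f i x) \<in> borel_measurable (M \<Otimes>\<^sub>M S2_measure)"
        unfolding case_prod_beta by measurable
      then show "field_coeff T (f i) \<in> borel_measurable M" unfolding field_coeff_def
        by (rule S.borel_measurable_lebesgue_integral)
    qed
  qed
  also have "\<dots> = (\<integral>x. \<integral>\<omega>. (\<Prod>i\<in>B. complex_of_real (T \<omega> (x i)) * f i (x i)) \<partial>M \<partial>S2_prod B)"
    by (rule P.Fubini_integral[OF I, symmetric])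
  finally show "(\<integral>\<omega>. (\<Prod>i\<in>B. field_coeff T (f i) \<omega>) \<partial>M) = (\<integral>x. complex_of_real (corr B x) * (\<Prod>i\<in>B. f i (x i)) \<partial>S2_prod B)"
    by (simp only: inner)
  show "integrable (S2_prod B) (\<lambda>x. complex_of_real (corr B x) * (\<Prod>i\<in>B. f i (x i)))"
    using P.integrable_snd[OF I] by (simp only: inner)
qed

lemma corr_rotate:
  fixes B :: "nat set"
  assumes "finite B" and x: "\<And>i. i \<in> B \<Longrightarrow> x i \<in> S2" and g: "g \<in> SO3"
  shows "corr B (\<lambda>i\<in>B. g *v x i) = corr B x"
proof -
  obtain k where k: "B \<subseteq> {..<k}" using assms(1) finite_nat_iff_bounded by blast
  \<comment> \<open>Isotropy speaks of initial segments of indices; positions outside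
    \<open>B\<close> are filled with an arbitrary point of the sphere.\<close>
  define xs where "xs i = (if i \<in> B then x i else axis 1 1)" for i
  have "(\<lambda>y::nat \<Rightarrow> real. \<Prod>i\<in>B. y i) \<in> borel_measurable (PiM {..<k} (\<lambda>_. borel))"
    using k by (intro borel_measurable_prod) auto
  from isotropy[where xs=xs, OF _ g this] x
  have "(\<integral>\<omega>. (\<Prod>i\<in>B. (\<lambda>i\<in>{..<k}. T \<omega> (xs i)) i) \<partial>M) = (\<integral>\<omega>. (\<Prod>i\<in>B. (\<lambda>i\<in>{..<k}. T \<omega> (g *v xs i)) i) \<partial>M)"
    by (auto simp: xs_def)
  moreover have "(\<Prod>i\<in>B. (\<lambda>i\<in>{..<k}. T \<omega> (xs i)) i) = (\<Prod>i\<in>B. T \<omega> (x i))" for \<omega>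
    using k by (intro prod.cong) (auto simp: xs_def)
  moreover have "(\<Prod>i\<in>B. (\<lambda>i\<in>{..<k}. T \<omega> (g *v xs i)) i) = (\<Prod>i\<in>B. T \<omega> ((\<lambda>i\<in>B. g *v x i) i))" for \<omega>
    using k by (intro prod.cong) (auto simp: xs_def)
  ultimately show ?thesis by (simp add: corr_def)
qed

text \<open>A change of variables: the product measure is invariant, and so is the kernel by
  isotropy, hence the rotation is felt by the test functions alone.\<close>

lemma moment_kernel_rotate:
  fixes B :: "nat set"
  assumes "finite B" "card B \<le> n" and f: "\<And>i. i \<in> B \<Longrightarrow> continuous_on S2 (f i)" and g: "g \<in> SO3"
  shows "(\<integral>x. complex_of_real (corr B x) * (\<Prod>i\<in>B. f i (g *v x i)) \<partial>S2_prod B)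
    = (\<integral>x. complex_of_real (corr B x) * (\<Prod>i\<in>B. f i (x i)) \<partial>S2_prod B)"
proof -
  let ?G = "\<lambda>x. \<lambda>i\<in>B. g *v x i"
  have "(\<integral>x. complex_of_real (corr B x) * (\<Prod>i\<in>B. f i (x i)) \<partial>S2_prod B) =
     integral\<^sup>L (distr (S2_prod B) (S2_prod B) ?G) (\<lambda>x. complex_of_real (corr B x) * (\<Prod>i\<in>B. f i (x i)))"
    by (simp only: distr_PiM_S2[OF g assms(1)])
  also have "\<dots> = (\<integral>x. complex_of_real (corr B (?G x)) * (\<Prod>i\<in>B. f i (?G x i)) \<partial>S2_prod B)"
    by (intro integral_distr rotate_PiM_measurable g borel_measurable_integrable moment_kernel(2) assms)
  also have "\<dots> = (\<integral>x. complex_of_real (corr B x) * (\<Prod>i\<in>B. f i (g *v x i)) \<partial>S2_prod B)"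
    by (intro Bochner_Integration.integral_cong refl)
       (auto simp: corr_rotate[OF assms(1) _ g] space_PiM PiE_iff)
  finally show ?thesis ..
qed

text \<open>Keeps the error of a first-order expansion quadratic after integration against the
  kernel.\<close>

lemma corr_bounded:
  fixes B :: "'i set"
  assumes "finite B" "card B \<le> n"
  shows "\<exists>C\<ge>0. \<forall>x\<in>space (S2_prod B). \<bar>corr B x\<bar> \<le> C"
proof -
  obtain C where C: "C \<ge> 0" "\<And>x. (\<forall>i\<in>B. x i \<in> S2) \<Longrightarrow> integrable M (\<lambda>\<omega>. \<Prod>i\<in>B. \<bar>T \<omega> (x i)\<bar>) \<and> (\<integral>\<omega>. (\<Prod>i\<in>B. \<bar>T \<omega> (x i)\<bar>) \<partial>M) \<le> C"
    using prod_moment[OF assms(1,2)] by blast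
  show ?thesis
  proof (intro exI[of _ C] conjI C(1) ballI)
    fix x assume "x \<in> space (S2_prod B)"
    then have x: "\<forall>i\<in>B. x i \<in> S2" by (auto simp: space_PiM PiE_iff)
    have "\<bar>corr B x\<bar> \<le> (\<integral>\<omega>. \<bar>\<Prod>i\<in>B. T \<omega> (x i)\<bar> \<partial>M)"
      unfolding corr_def by (rule integral_abs_bound)
    then show "\<bar>corr B x\<bar> \<le> C" using C(2)[OF x] by (simp add: abs_prod)
  qed
qed

end

section \<open>Spherical harmonics under infinitesimal rotations\<close>

text \<open>First-order expansion at \<open>t = 0\<close>, uniform on \<open>X\<close> and from the right only; uniformity is what allows
  to integrate the expansion.\<close>

definition taylor1 :: "'x set \<Rightarrow> (real \<Rightarrow> 'x \<Rightarrow> complex) \<Rightarrow> ('x \<Rightarrow> complex) \<Rightarrow> ('x \<Rightarrow> complex) \<Rightarrow> bool" where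
  "taylor1 X u u0 u1 \<longleftrightarrow> (\<exists>C\<ge>0. \<forall>x\<in>X. norm (u0 x) \<le> C \<and> norm (u1 x) \<le> C \<and>
     (\<forall>t\<in>{0..1}. norm (u t x - u0 x - of_real t * u1 x) \<le> C * t\<^sup>2))"

lemma taylor1_const: "taylor1 X (\<lambda>t x. c) (\<lambda>x. c) (\<lambda>x. 0)"
  unfolding taylor1_def by (intro exI[of _ "norm c"]) simp

lemma taylor1_add:
  assumes "taylor1 X u u0 u1" "taylor1 X v v0 v1"
  shows "taylor1 X (\<lambda>t x. u t x + v t x) (\<lambda>x. u0 x + v0 x) (\<lambda>x. u1 x + v1 x)"
proof -
  obtain C where C: "C \<ge> 0" "\<And>x. x \<in> X \<Longrightarrow> norm (u0 x) \<le> C" "\<And>x. x \<in> X \<Longrightarrow> norm (u1 x) \<le> C"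
     "\<And>x t. x \<in> X \<Longrightarrow> t \<in> {0..1} \<Longrightarrow> norm (u t x - u0 x - of_real t * u1 x) \<le> C * t\<^sup>2"
    using assms(1) unfolding taylor1_def by blast
  obtain D where D: "D \<ge> 0" "\<And>x. x \<in> X \<Longrightarrow> norm (v0 x) \<le> D" "\<And>x. x \<in> X \<Longrightarrow> norm (v1 x) \<le> D"
     "\<And>x t. x \<in> X \<Longrightarrow> t \<in> {0..1} \<Longrightarrow> norm (v t x - v0 x - of_real t * v1 x) \<le> D * t\<^sup>2"
    using assms(2) unfolding taylor1_def by blast
  show ?thesis unfolding taylor1_def
  proof (intro exI[of _ "C + D"] conjI ballI)
    fix x t assume x: "x \<in> X" and t: "t \<in> {0..1::real}"
    have "u t x + v t x - (u0 x + v0 x) - of_real t * (u1 x + v1 x) =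
      (u t x - u0 x - of_real t * u1 x) + (v t x - v0 x - of_real t * v1 x)" by (simp add: algebra_simps)
    then show "norm (u t x + v t x - (u0 x + v0 x) - of_real t * (u1 x + v1 x)) \<le> (C + D) * t\<^sup>2"
      using norm_triangle_mono[OF C(4)[OF x t] D(4)[OF x t]] by (simp only: distrib_right)
  qed (use C D in \<open>auto intro: norm_triangle_mono\<close>)
qed

lemma taylor1_mult:
  assumes "taylor1 X u u0 u1" "taylor1 X v v0 v1"
  shows "taylor1 X (\<lambda>t x. u t x * v t x) (\<lambda>x. u0 x * v0 x) (\<lambda>x. u1 x * v0 x + u0 x * v1 x)"
proof -
  obtain C where C: "C \<ge> 0" "\<And>x. x \<in> X \<Longrightarrow> norm (u0 x) \<le> C" "\<And>x. x \<in> X \<Longrightarrow> norm (u1 x) \<le> C"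
     "\<And>x t. x \<in> X \<Longrightarrow> t \<in> {0..1} \<Longrightarrow> norm (u t x - u0 x - of_real t * u1 x) \<le> C * t\<^sup>2"
    using assms(1) unfolding taylor1_def by blast
  obtain D where D: "D \<ge> 0" "\<And>x. x \<in> X \<Longrightarrow> norm (v0 x) \<le> D" "\<And>x. x \<in> X \<Longrightarrow> norm (v1 x) \<le> D"
     "\<And>x t. x \<in> X \<Longrightarrow> t \<in> {0..1} \<Longrightarrow> norm (v t x - v0 x - of_real t * v1 x) \<le> D * t\<^sup>2"
    using assms(2) unfolding taylor1_def by blast
  have CD: "C * D \<ge> 0" using C(1) D(1) by simp
  show ?thesis unfolding taylor1_def
  \<comment> \<open>The remainder splits into three products, bounded by 3, 2 and 1 times
    \<open>C * D * t\<^sup>2\<close>.\<close>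
  proof (intro exI[of _ "6 * (C * D)"] conjI ballI)
    fix x assume x: "x \<in> X"
    have b: "norm (u0 x * v0 x) \<le> C * D" "norm (u1 x * v0 x) \<le> C * D" "norm (u0 x * v1 x) \<le> C * D" "norm (u1 x * v1 x) \<le> C * D"
      unfolding norm_mult using C(1-3) D(1-3) x by (intro mult_mono; simp)+
    show "norm (u0 x * v0 x) \<le> 6 * (C * D)" using b CD by simp
    show "norm (u1 x * v0 x + u0 x * v1 x) \<le> 6 * (C * D)"
      using norm_triangle_mono[OF b(2,3)] CD by simp
    fix t assume t: "t \<in> {0..1::real}"
    have t2: "t\<^sup>2 \<le> 1" using t by (simp add: power_le_one)
    define ru where "ru = u t x - u0 x - of_real t * u1 x"
    define rv where "rv = v t x - v0 x - of_real t * v1 x"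
    have ru: "norm ru \<le> C * t\<^sup>2" and rv: "norm rv \<le> D * t\<^sup>2" using C(4) D(4) x t by (auto simp: ru_def rv_def)
    have nt: "norm (of_real t * v1 x) \<le> D" "norm (of_real t * u1 x) \<le> C"
      using t mult_left_le_one_le[of "norm (v1 x)" t] mult_left_le_one_le[of "norm (u1 x)" t] C(3)[OF x] D(3)[OF x]
      by (auto simp: norm_mult)
    have "norm (v t x) \<le> D + D + D"
    proof -
      have "v t x = v0 x + of_real t * v1 x + rv" by (simp add: rv_def)
      moreover have "norm rv \<le> D" using rv mult_left_le[OF t2 D(1)] by linarith
      ultimately show ?thesis using D(2)[OF x] nt(1) by (simp only:) (intro norm_triangle_mono)
    qed
    then have 1: "norm (ru * v t x) \<le> (C * t\<^sup>2) * (D + D + D)"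
      unfolding norm_mult using ru C(1) by (intro mult_mono) auto
    have "norm (u0 x + of_real t * u1 x) \<le> C + C" using C(2)[OF x] nt(2) by (intro norm_triangle_mono)
    then have 2: "norm ((u0 x + of_real t * u1 x) * rv) \<le> (C + C) * (D * t\<^sup>2)"
      unfolding norm_mult using rv C(1) by (intro mult_mono) auto
    have 3: "norm ((of_real t)\<^sup>2 * (u1 x * v1 x)) \<le> t\<^sup>2 * (C * D)"
      using b(4) by (simp add: norm_mult[of "_\<^sup>2"] norm_power mult_left_mono)
    have "u t x * v t x - u0 x * v0 x - of_real t * (u1 x * v0 x + u0 x * v1 x) =
      ru * v t x + (u0 x + of_real t * u1 x) * rv + (of_real t)\<^sup>2 * (u1 x * v1 x)"
      by (simp add: ru_def rv_def algebra_simps power2_eq_square)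
    then have "norm (u t x * v t x - u0 x * v0 x - of_real t * (u1 x * v0 x + u0 x * v1 x))
      \<le> (C * t\<^sup>2) * (D + D + D) + (C + C) * (D * t\<^sup>2) + t\<^sup>2 * (C * D)"
      using norm_triangle_mono[OF norm_triangle_mono[OF 1 2] 3] by simp
    also have "\<dots> = 6 * (C * D) * t\<^sup>2" by (simp add: algebra_simps)
    finally show "norm (u t x * v t x - u0 x * v0 x - of_real t * (u1 x * v0 x + u0 x * v1 x)) \<le> 6 * (C * D) * t\<^sup>2" .
  qed (use CD in auto)
qed

lemma taylor1_cnj:
  assumes "taylor1 X u u0 u1"
  shows "taylor1 X (\<lambda>t x. cnj (u t x)) (\<lambda>x. cnj (u0 x)) (\<lambda>x. cnj (u1 x))"
proof -
  have "cnj (u t x) - cnj (u0 x) - of_real t * cnj (u1 x) = cnj (u t x - u0 x - of_real t * u1 x)" for t x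
    by simp
  then show ?thesis using assms unfolding taylor1_def by (simp only: complex_mod_cnj)
qed

lemma taylor1_cong:
  assumes "taylor1 X u u0 u1" "\<And>t x. x \<in> X \<Longrightarrow> u t x = v t x" "\<And>x. x \<in> X \<Longrightarrow> u0 x = v0 x" "\<And>x. x \<in> X \<Longrightarrow> u1 x = v1 x"
  shows "taylor1 X v v0 v1"
  using assms unfolding taylor1_def by simp

text \<open>Leibniz' rule. The derivative of one factor is written as a function update, the form in
  which moments with one altered test function appear later.\<close>

lemma taylor1_prod:
  assumes "finite B" "\<And>i. i \<in> B \<Longrightarrow> taylor1 X (u i) (u0 i) (u1 i)"
  shows "taylor1 X (\<lambda>t x. \<Prod>i\<in>B. u i t x) (\<lambda>x. \<Prod>i\<in>B. u0 i x) (\<lambda>x. \<Sum>k\<in>B. \<Prod>i\<in>B. (u0(k := u1 k)) i x)"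
  using assms
proof (induction B)
  case empty
  show ?case using taylor1_const[of X 1] by simp
next
  case (insert j B)
  show ?case
  proof (rule taylor1_cong[OF taylor1_mult[OF insert.prems[of j] insert.IH]])
    fix x
    have "(\<Prod>i\<in>insert j B. (u0(j := u1 j)) i x) = u1 j x * (\<Prod>i\<in>B. u0 i x)"
      using insert.hyps by (auto intro!: prod.cong)
    moreover have "(\<Prod>i\<in>insert j B. (u0(k := u1 k)) i x) = u0 j x * (\<Prod>i\<in>B. (u0(k := u1 k)) i x)" if "k \<in> B" for k
      using insert.hyps that by auto
    ultimately show "u1 j x * (\<Prod>i\<in>B. u0 i x) + u0 j x * (\<Sum>k\<in>B. \<Prod>i\<in>B. (u0(k := u1 k)) i x) =
      (\<Sum>k\<in>insert j B. \<Prod>i\<in>insert j B. (u0(k := u1 k)) i x)"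
      using insert.hyps by (simp add: sum_distrib_left del: prod.insert)
  qed (use insert in auto)
qed

lemma taylor1_power:
  assumes "taylor1 X u u0 u1"
  shows "taylor1 X (\<lambda>t x. u t x ^ k) (\<lambda>x. u0 x ^ k) (\<lambda>x. of_nat k * u0 x ^ (k - 1) * u1 x)"
proof (induction k)
  case 0
  show ?case using taylor1_const[of X 1] by simp
next
  case (Suc k)
  show ?case
    by (rule taylor1_cong[OF taylor1_mult[OF assms Suc]]; cases k) (auto simp: algebra_simps)
qed

lemma taylor1_poly:
  fixes a :: "real \<Rightarrow> 'x \<Rightarrow> real"
  assumes "taylor1 X (\<lambda>t x. of_real (a t x)) (\<lambda>x. of_real (a0 x)) u1"
  shows "taylor1 X (\<lambda>t x. of_real (poly p (a t x))) (\<lambda>x. of_real (poly p (a0 x))) (\<lambda>x. of_real (poly (pderiv p) (a0 x)) * u1 x)"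
proof (induction p)
  case 0
  show ?case using taylor1_const[of X 0] by simp
next
  case (pCons c p)
  show ?case
    by (rule taylor1_cong[OF taylor1_add[OF taylor1_const[of X "of_real c"] taylor1_mult[OF assms pCons.IH]]])
       (auto simp: pderiv_pCons algebra_simps)
qed

lemma taylor1_cos: "taylor1 X (\<lambda>t x. of_real (cos t)) (\<lambda>x. 1) (\<lambda>x. 0)"
  unfolding taylor1_def
proof (intro exI[of _ 1] conjI ballI)
  fix t :: real
  have "\<bar>sin (t / 2)\<bar> \<le> \<bar>t / 2\<bar>" by (rule abs_sin_x_le_abs_x)
  then have "(sin (t / 2))\<^sup>2 \<le> (t / 2)\<^sup>2" by (simp only: abs_le_square_iff)
  then have "(sin (t / 2))\<^sup>2 \<le> t\<^sup>2 / 4" by (simp add: power_divide)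
  moreover have "cos t = 1 - 2 * (sin (t / 2))\<^sup>2" using cos_double_sin[of "t / 2"] by simp
  ultimately have "\<bar>cos t - 1\<bar> \<le> t\<^sup>2"
    using zero_le_power2[of "sin (t / 2)"] by linarith
  then show "norm (of_real (cos t) - 1 - of_real t * (0::complex)) \<le> 1 * t\<^sup>2"
    by (metis mult_zero_right diff_zero norm_of_real of_real_1 of_real_diff mult_1)
qed auto

lemma taylor1_sin: "taylor1 X (\<lambda>t x. of_real (sin t)) (\<lambda>x. 0) (\<lambda>x. 1)"
  unfolding taylor1_def
proof (intro exI[of _ 1] conjI ballI)
  fix t :: real
  have "\<bar>sin t - (\<Sum>m<2. sin_coeff m * t ^ m)\<bar> \<le> inverse (fact 2) * \<bar>t\<bar> ^ 2" by (rule Maclaurin_sin_bound)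
  then have "\<bar>sin t - t\<bar> \<le> t\<^sup>2 / 2" by (simp add: numeral_2_eq_2 sin_coeff_def)
  also have "\<dots> \<le> t\<^sup>2" by simp
  finally have "\<bar>sin t - t\<bar> \<le> t\<^sup>2" .
  then show "norm (of_real (sin t) - 0 - of_real t * (1::complex)) \<le> 1 * t\<^sup>2"
    by (metis diff_zero mult.right_neutral norm_of_real of_real_diff mult_1)
qed auto

lemma taylor1_coord: "taylor1 S2 (\<lambda>t x. of_real (x $ i)) (\<lambda>x. of_real (x $ i)) (\<lambda>x. 0)"
  unfolding taylor1_def
proof (intro exI[of _ 1] conjI ballI)
  fix x :: "real^3" assume "x \<in> S2"
  then show "norm (complex_of_real (x $ i)) \<le> 1" using component_le_norm_cart[of x i] by simp
qed auto

section \<open>Rotations about the coordinate axes\<close>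

definition rot1 :: "real \<Rightarrow> real^3^3" where
  "rot1 t = vector [vector [1, 0, 0], vector [0, cos t, - sin t], vector [0, sin t, cos t]]"
definition rot2 :: "real \<Rightarrow> real^3^3" where
  "rot2 t = vector [vector [cos t, 0, sin t], vector [0, 1, 0], vector [- sin t, 0, cos t]]"
definition rot3 :: "real \<Rightarrow> real^3^3" where
  "rot3 t = vector [vector [cos t, - sin t, 0], vector [sin t, cos t, 0], vector [0, 0, 1]]"

lemma rot_SO3: "rot1 t \<in> SO3" "rot2 t \<in> SO3" "rot3 t \<in> SO3"
  using sin_cos_squared_add3[of t]
  by (auto simp: SO3_def orthogonal_matrix vec_eq_iff forall_3 matrix_matrix_mult_def sum_3
      transpose_def mat_def det_3 rot1_def rot2_def rot3_def algebra_simps)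

lemma rot_mult:
  "(rot1 t *v x) $ 1 = x $ 1" "(rot1 t *v x) $ 2 = cos t * x $ 2 - sin t * x $ 3" "(rot1 t *v x) $ 3 = sin t * x $ 2 + cos t * x $ 3"
  "(rot2 t *v x) $ 1 = cos t * x $ 1 + sin t * x $ 3" "(rot2 t *v x) $ 2 = x $ 2" "(rot2 t *v x) $ 3 = - sin t * x $ 1 + cos t * x $ 3"
  "(rot3 t *v x) $ 1 = cos t * x $ 1 - sin t * x $ 2" "(rot3 t *v x) $ 2 = sin t * x $ 1 + cos t * x $ 2" "(rot3 t *v x) $ 3 = x $ 3"
  by (simp_all add: rot1_def rot2_def rot3_def matrix_vector_mult_def sum_3)

text \<open>The derivative of \<open>f\<close> on the sphere along a one-parameter family of rotations.\<close>

definition rot_deriv :: "(real \<Rightarrow> real^3^3) \<Rightarrow> (real^3 \<Rightarrow> complex) \<Rightarrow> (real^3 \<Rightarrow> complex) \<Rightarrow> bool" where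
  "rot_deriv R f f' \<longleftrightarrow> taylor1 S2 (\<lambda>t x. f (R t *v x)) f f'"

lemma rot_deriv_zero: "rot_deriv R (\<lambda>x. 0) (\<lambda>x. 0)"
  unfolding rot_deriv_def by (rule taylor1_const)

lemma rot_deriv_cmult: "rot_deriv R f f' \<Longrightarrow> rot_deriv R (\<lambda>x. c * f x) (\<lambda>x. c * f' x)"
  unfolding rot_deriv_def by (rule taylor1_cong[OF taylor1_mult[OF taylor1_const[of _ c]]]) auto

lemma rot_deriv_cnj: "rot_deriv R f f' \<Longrightarrow> rot_deriv R (\<lambda>x. cnj (f x)) (\<lambda>x. cnj (f' x))"
  unfolding rot_deriv_def by (rule taylor1_cnj)

text \<open>In polar coordinates \<open>horiz\<close> is sin theta e^(i phi) and \<open>vert\<close>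
  is cos theta on the sphere; \<open>Yp\<close> is a polynomial in the two.\<close>

definition horiz :: "real^3 \<Rightarrow> complex" where
  "horiz x = complex_of_real (x $ 1) + \<i> * complex_of_real (x $ 2)"
definition vert :: "real^3 \<Rightarrow> complex" where
  "vert x = complex_of_real (x $ 3)"

lemma taylor1_lin:
  "taylor1 S2 (\<lambda>t x. of_real (cos t * x $ i + sin t * x $ j)) (\<lambda>x. of_real (x $ i)) (\<lambda>x. of_real (x $ j))"
  by (rule taylor1_cong[OF taylor1_add[OF taylor1_mult[OF taylor1_cos taylor1_coord[of i]]
        taylor1_mult[OF taylor1_sin taylor1_coord[of j]]]]) auto

lemma taylor1_lin_minus:
  "taylor1 S2 (\<lambda>t x. of_real (cos t * x $ i - sin t * x $ j)) (\<lambda>x. of_real (x $ i)) (\<lambda>x. - of_real (x $ j))"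
  by (rule taylor1_cong[OF taylor1_add[OF taylor1_mult[OF taylor1_cos taylor1_coord[of i]]
        taylor1_mult[OF taylor1_const[of _ "-1"] taylor1_mult[OF taylor1_sin taylor1_coord[of j]]]]]) auto

lemma rot_deriv_vert: "rot_deriv rot1 vert (\<lambda>x. of_real (x $ 2))" "rot_deriv rot2 vert (\<lambda>x. - of_real (x $ 1))" "rot_deriv rot3 vert (\<lambda>x. 0)"
  unfolding rot_deriv_def vert_def rot_mult
  using taylor1_lin[of 3 2] taylor1_lin_minus[of 3 1] taylor1_coord[of 3]
  by (auto simp: add.commute)

lemma rot_deriv_horiz: "rot_deriv rot1 horiz (\<lambda>x. - \<i> * vert x)" "rot_deriv rot2 horiz vert" "rot_deriv rot3 horiz (\<lambda>x. \<i> * horiz x)"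
proof -
  have "rot_deriv rot1 horiz (\<lambda>x. 0 + (0 * of_real (x $ 2) + \<i> * - of_real (x $ 3)))"
    unfolding rot_deriv_def horiz_def rot_mult
    by (intro taylor1_add taylor1_mult taylor1_coord taylor1_lin_minus taylor1_const)
  then show "rot_deriv rot1 horiz (\<lambda>x. - \<i> * vert x)" by (simp add: vert_def)
  have "rot_deriv rot2 horiz (\<lambda>x. of_real (x $ 3) + (0 * of_real (x $ 2) + \<i> * 0))"
    unfolding rot_deriv_def horiz_def rot_mult
    by (intro taylor1_add taylor1_mult taylor1_coord taylor1_lin taylor1_const)
  then show "rot_deriv rot2 horiz vert" by (simp add: vert_def[abs_def])
  have "rot_deriv rot3 horiz (\<lambda>x. - of_real (x $ 2) + (0 * of_real (x $ 2) + \<i> * of_real (x $ 1)))"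
    unfolding rot_deriv_def horiz_def rot_mult add.commute[of "sin _ * _"]
    by (intro taylor1_add taylor1_mult taylor1_coord taylor1_lin taylor1_lin_minus taylor1_const)
  then show "rot_deriv rot3 horiz (\<lambda>x. \<i> * horiz x)" by (simp add: horiz_def algebra_simps)
qed

section \<open>Legendre functions and the ladder relations of the harmonics\<close>

definition Nlm :: "nat \<Rightarrow> nat \<Rightarrow> complex" where
  "Nlm l m = complex_of_real (sqrt ((2 * real l + 1) / (4 * pi) * fact (l - m) / fact (l + m))) * (-1) ^ m"

definition Qlm :: "nat \<Rightarrow> nat \<Rightarrow> real^3 \<Rightarrow> complex" where
  "Qlm l m x = complex_of_real (poly (legendre_core l m) (x $ 3))"

lemma Yp_eq: "Yp l m x = Nlm l m * (horiz x ^ m * Qlm l m x)"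
  by (simp add: Yp_def Nlm_def horiz_def Qlm_def mult.assoc)

lemma pderiv_legendre_core: "pderiv (legendre_core l m) = legendre_core l (Suc m)"
  by (simp add: legendre_core_def pderiv_smult)

lemma rot_deriv_Qlm:
  assumes "rot_deriv R vert z'"
  shows "rot_deriv R (Qlm l m) (\<lambda>x. Qlm l (Suc m) x * z' x)"
  using taylor1_poly[OF assms[unfolded rot_deriv_def vert_def]] unfolding rot_deriv_def Qlm_def pderiv_legendre_core[symmetric] .

lemma rot_deriv_Yp:
  assumes "rot_deriv R horiz w'" "rot_deriv R vert z'"
  shows "rot_deriv R (Yp l m) (\<lambda>x. Nlm l m * (of_nat m * horiz x ^ (m - 1) * w' x * Qlm l m x + horiz x ^ m * (Qlm l (Suc m) x * z' x)))"
proof -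
  have "rot_deriv R (\<lambda>x. horiz x ^ m * Qlm l m x) (\<lambda>x. of_nat m * horiz x ^ (m - 1) * w' x * Qlm l m x + horiz x ^ m * (Qlm l (Suc m) x * z' x))"
    using taylor1_mult[OF taylor1_power[OF assms(1)[unfolded rot_deriv_def]] rot_deriv_Qlm[OF assms(2), unfolded rot_deriv_def]]
    unfolding rot_deriv_def .
  from rot_deriv_cmult[OF this] show ?thesis unfolding Yp_eq[abs_def] .
qed

lemma continuous_horiz_vert_Qlm [continuous_intros]:
  "continuous_on A horiz" "continuous_on A vert" "continuous_on A (Qlm l m)"
  unfolding horiz_def[abs_def] vert_def[abs_def] Qlm_def[abs_def] by (intro continuous_intros)+

lemma pderiv_funpow_eq_0: "degree p < k \<Longrightarrow> (pderiv ^^ k) p = 0" for p :: "real poly"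
proof (induction k arbitrary: p)
  case (Suc k)
  show ?case
  proof (cases "degree p = 0")
    case True
    then have "pderiv p = 0" by (simp add: pderiv_eq_0_iff)
    then show ?thesis by (simp add: funpow_Suc_right del: funpow.simps)
  next
    case False
    then have "degree (pderiv p) < k" using Suc.prems by (simp add: degree_pderiv)
    then show ?thesis using Suc.IH by (simp add: funpow_Suc_right del: funpow.simps)
  qed
qed simp

text \<open>A polynomial of degree at most 2l is differentiated more than 2l times; this ends the
  raising of \<open>Yp\<close> at \<open>m = l\<close>.\<close>

lemma legendre_core_eq_0: "l < m \<Longrightarrow> legendre_core l m = 0"
proof -
  assume "l < m"
  have "degree ([:-1, 0, 1:] ^ l :: real poly) \<le> 2 * l"
    using degree_power_le[of "[:-1, 0, 1:] :: real poly" l] by simp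
  then have "(pderiv ^^ (l + m)) ([:-1, 0, 1:] ^ l :: real poly) = 0"
    using \<open>l < m\<close> by (intro pderiv_funpow_eq_0) simp
  then show ?thesis by (simp add: legendre_core_def)
qed

text \<open>The polynomial \<open>u\<close> solves (X^2 - 1) u' = 2 l X u, and the claim is this
  equation differentiated \<open>j + 1\<close> times.\<close>

lemma legendre_ode_poly:
  fixes u :: "real poly" and X :: "real poly" and l :: nat
  defines "X \<equiv> [:0, 1:]" and "u \<equiv> [:-1, 0, 1:] ^ l"
  shows "(X * X - 1) * (pderiv ^^ (j + 2)) u + 2 * (of_nat j + 1 - of_nat l) * (X * (pderiv ^^ (j + 1)) u)
    + (of_nat j + 1) * (of_nat j - 2 * of_nat l) * (pderiv ^^ j) u = 0"
proof -
  have X: "pderiv X = 1" "[:-1, 0, 1:] = X * X - 1" by (simp_all add: X_def pderiv_pCons one_pCons)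
  have X2: "pderiv (X * X - 1) = 2 * X" by (simp add: pderiv_diff pderiv_mult X)
  have c: "pderiv (a * p) = a * pderiv p" if "pderiv a = 0" for a p :: "real poly"
    using that by (simp add: pderiv_mult)
  show ?thesis
  proof (induction j)
    case 0
    have 1: "(X * X - 1) * pderiv u = 2 * of_nat l * (X * u)"
    proof (cases l)
      case (Suc k)
      have "pderiv u = of_nat l * ((X * X - 1) ^ k * (2 * X))"
        unfolding u_def Suc X by (simp add: pderiv_power_Suc X2 of_nat_poly del: of_nat_Suc power_Suc)
      then show ?thesis unfolding u_def Suc X by (simp add: mult_ac)
    qed (simp add: u_def pderiv_1)
    have "pderiv ((X * X - 1) * pderiv u) = pderiv (2 * of_nat l * (X * u))"
      by (simp only: 1)
    also have "pderiv ((X * X - 1) * pderiv u) = 2 * X * pderiv u + (X * X - 1) * pderiv (pderiv u)"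
      by (simp only: pderiv_mult X2 mult.commute add.commute)
    also have "pderiv (2 * of_nat l * (X * u)) = 2 * of_nat l * (u + X * pderiv u)"
      by (subst c) (simp_all only: pderiv_mult X pderiv_of_nat pderiv_numeral mult_zero_left mult_zero_right add_0 mult_1_right mult_1 add.commute)
    finally have "(X * X - 1) * pderiv (pderiv u) = 2 * of_nat l * (u + X * pderiv u) - 2 * X * pderiv u"
      by (simp only: eq_diff_eq add.commute)
    moreover have "(pderiv ^^ (0 + 2)) u = pderiv (pderiv u)" "(pderiv ^^ (0 + 1)) u = pderiv u" "(pderiv ^^ 0) u = u"
      by (simp_all add: numeral_2_eq_2)
    ultimately show ?case by (simp only: of_nat_0) (simp add: algebra_simps)
  next
    case (Suc j)
    define n L A1 A2 A3 :: "real poly" where "n = of_nat j" and "L = of_nat l"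
      and "A1 = (pderiv ^^ (j + 1)) u" and "A2 = (pderiv ^^ (j + 2)) u" and "A3 = (pderiv ^^ (j + 3)) u"
    have s: "pderiv A1 = A2" "pderiv A2 = A3" "pderiv ((pderiv ^^ j) u) = A1"
      by (simp_all add: A1_def A2_def A3_def eval_nat_numeral)
    have z: "pderiv (2 * (n + 1 - L)) = 0" "pderiv ((n + 1) * (n - 2 * L)) = 0"
      by (simp_all add: n_def L_def pderiv_mult pderiv_add pderiv_diff pderiv_1)
    have "pderiv ((X * X - 1) * A2 + 2 * (n + 1 - L) * (X * A1) + (n + 1) * (n - 2 * L) * (pderiv ^^ j) u) = 0"
      using Suc.IH by (simp only: n_def L_def A1_def A2_def pderiv_0)
    then have e: "(2 * X * A2 + (X * X - 1) * A3) + 2 * (n + 1 - L) * (A1 + X * A2) + (n + 1) * (n - 2 * L) * A1 = 0"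
      unfolding pderiv_add c[OF z(1)] c[OF z(2)] s pderiv_mult[of "X * X - 1"] pderiv_mult[of X] X2 X
      by (simp add: mult.commute add.commute add.left_commute)
    have "(X * X - 1) * A3 + 2 * ((n + 1) + 1 - L) * (X * A2) + ((n + 1) + 1) * ((n + 1) - 2 * L) * A1
      = (2 * X * A2 + (X * X - 1) * A3) + 2 * (n + 1 - L) * (A1 + X * A2) + (n + 1) * (n - 2 * L) * A1"
      by (simp add: algebra_simps)
    also have "\<dots> = 0" by (rule e)
    finally have "(X * X - 1) * A3 + 2 * ((n + 1) + 1 - L) * (X * A2) + ((n + 1) + 1) * ((n + 1) - 2 * L) * A1 = 0" .
    moreover have "Suc j + 2 = j + 3" "Suc j + 1 = j + 2" "Suc j = j + 1" "of_nat (Suc j) = n + 1" by (simp_all add: n_def)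
    ultimately show ?case unfolding A1_def A2_def A3_def L_def by (simp only:)
  qed
qed

text \<open>The case \<open>j = l + k - 1\<close>, scaled by the constant of Rodrigues' formula: it
  returns from the orders \<open>k + 1\<close> and \<open>k\<close> to \<open>k - 1\<close>, as
  lowering requires.\<close>

lemma legendre_ode:
  assumes "1 \<le> k" "k \<le> l"
  shows "(1 - z\<^sup>2) * poly (legendre_core l (Suc k)) z - 2 * real k * z * poly (legendre_core l k) z
    = - (real l + real k) * (real l - real k + 1) * poly (legendre_core l (k - 1)) z"
proof -
  define c :: real where "c = 1 / (2 ^ l * fact l)"
  let ?u = "[:-1, 0, 1:] ^ l :: real poly" and ?X = "[:0, 1:] :: real poly"
  define j where "j = l + (k - 1)"
  have j: "j + 2 = l + Suc k" "j + 1 = l + k" using assms by (auto simp: j_def)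
  have L: "poly (legendre_core l i) z = c * poly ((pderiv ^^ (l + i)) ?u) z" for i
    by (simp add: legendre_core_def c_def)
  have "poly ((?X * ?X - 1) * (pderiv ^^ (j + 2)) ?u + 2 * (of_nat j + 1 - of_nat l) * (?X * (pderiv ^^ (j + 1)) ?u)
    + (of_nat j + 1) * (of_nat j - 2 * of_nat l) * (pderiv ^^ j) ?u) z = 0"
    by (simp only: legendre_ode_poly poly_0)
  then have e: "(z\<^sup>2 - 1) * poly ((pderiv ^^ (l + Suc k)) ?u) z + 2 * (real j + 1 - real l) * (z * poly ((pderiv ^^ (l + k)) ?u) z)
    + (real j + 1) * (real j - 2 * real l) * poly ((pderiv ^^ (l + (k - 1))) ?u) z = 0"
    unfolding j j_def[symmetric] by (simp add: power2_eq_square del: mult_pCons_left mult_pCons_right)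
  have r: "real j = real l + real k - 1" using assms by (simp add: j_def)
  have "c * ((z\<^sup>2 - 1) * poly ((pderiv ^^ (l + Suc k)) ?u) z + 2 * (real j + 1 - real l) * (z * poly ((pderiv ^^ (l + k)) ?u) z)
    + (real j + 1) * (real j - 2 * real l) * poly ((pderiv ^^ (l + (k - 1))) ?u) z) = 0" unfolding e by simp
  then show ?thesis unfolding L r by (simp add: algebra_simps)
qed

lemma continuous_Y: "continuous_on A (Y l m)"
proof -
  have "continuous_on A (Yp l k)" for k
    unfolding Yp_eq[abs_def] by (intro continuous_intros)
  then show ?thesis unfolding Y_def[abs_def]
    by (cases "int l < \<bar>m\<bar>"; cases "0 \<le> m") (auto intro!: continuous_intros)
qed

lemma S2_horiz_vert: "x \<in> S2 \<Longrightarrow> horiz x * cnj (horiz x) = 1 - (vert x)\<^sup>2"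
proof -
  assume "x \<in> S2"
  then have "x $ 1 ^ 2 + x $ 2 ^ 2 + x $ 3 ^ 2 = 1"
    by (simp add: norm_eq_1 inner_vec_def sum_3 power2_eq_square)
  then have "x $ 1 ^ 2 + x $ 2 ^ 2 = 1 - x $ 3 ^ 2" by linarith
  then have "of_real (x $ 1 ^ 2 + x $ 2 ^ 2) = (of_real (1 - x $ 3 ^ 2) :: complex)" by (simp only:)
  then show ?thesis by (simp add: horiz_def vert_def power2_eq_square algebra_simps)
qed

text \<open>From \<open>Suc m\<close> to \<open>m\<close> the quotient of factorials gains (l - m)(l
  + m + 1), the square of \<open>ladder\<close>; the minus sign is the Condon-Shortley
  phase.\<close>

lemma Nlm_Suc:
  assumes "m < l"
  shows "Nlm l m = - of_real (ladder (int l) (int m)) * Nlm l (Suc m)"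
proof -
  have 1: "(fact (l - m) :: real) = real (l - m) * fact (l - Suc m)"
    using assms by (metis Suc_diff_Suc fact_Suc)
  have 2: "(fact (l + Suc m) :: real) = real (l + m + 1) * fact (l + m)" by simp
  have "a * F / G = (a * b) * (F / (b * G))" if "b \<noteq> 0" for a b F G :: real
    using that by simp
  then have 3: "(fact (l - m) / fact (l + m) :: real) = (real (l - m) * real (l + m + 1)) * (fact (l - Suc m) / fact (l + Suc m))"
    unfolding 1 2 by simp
  have 4: "c * F / G = p * (c * F' / G')" if "F / G = p * (F' / G')" for c F G p F' G' :: real
    using that by (metis times_divide_eq_right mult.left_commute)
  have "sqrt ((2 * real l + 1) / (4 * pi) * fact (l - m) / fact (l + m)) =
     sqrt ((real (l - m) * real (l + m + 1)) * ((2 * real l + 1) / (4 * pi) * fact (l - Suc m) / fact (l + Suc m)))"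
    by (rule arg_cong[where f=sqrt, OF 4[OF 3]])
  also have "\<dots> = ladder (int l) (int m) * sqrt ((2 * real l + 1) / (4 * pi) * fact (l - Suc m) / fact (l + Suc m))"
    unfolding real_sqrt_mult[of "_ * real (l + m + 1)"] using assms by (simp add: ladder_def of_nat_diff algebra_simps)
  finally show ?thesis by (simp add: Nlm_def)
qed

lemma Qlm_0: "l < m \<Longrightarrow> Qlm l m x = 0"
  by (simp add: Qlm_def legendre_core_eq_0)

lemma Yp_0: "l < m \<Longrightarrow> Yp l m x = 0"
  by (simp add: Yp_eq Qlm_0)

text \<open>With \<open>d\<^sub>1, d\<^sub>2\<close> the derivatives along the rotations about the first two axes, the ladder operators
  are \<open>- \<i> d\<^sub>1 \<plusminus> d\<^sub>2\<close>. The raising operator annihilates \<open>x\<^sub>1 + \<i> x\<^sub>2\<close>, the lowering operator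
  needs the differentiated Legendre equation.\<close>

lemma Yp_ladder:
  assumes "m \<le> l"
  obtains d1 d2 where "rot_deriv rot1 (Yp l m) d1" "rot_deriv rot2 (Yp l m) d2" "continuous_on S2 d1" "continuous_on S2 d2"
    "\<And>x. - \<i> * d1 x + d2 x = of_real (ladder (int l) (int m)) * Yp l (Suc m) x"
    "\<And>x. 0 < m \<Longrightarrow> x \<in> S2 \<Longrightarrow> - \<i> * d1 x - d2 x = of_real (ladder (int l) (int m - 1)) * Yp l (m - 1) x"
proof -
  define d1 where "d1 = (\<lambda>x. Nlm l m * (of_nat m * horiz x ^ (m - 1) * (- \<i> * vert x) * Qlm l m x + horiz x ^ m * (Qlm l (Suc m) x * of_real (x $ 2))))"
  define d2 where "d2 = (\<lambda>x. Nlm l m * (of_nat m * horiz x ^ (m - 1) * vert x * Qlm l m x + horiz x ^ m * (Qlm l (Suc m) x * - of_real (x $ 1))))"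
  show ?thesis
  proof
    show "rot_deriv rot1 (Yp l m) d1" unfolding d1_def by (rule rot_deriv_Yp[OF rot_deriv_horiz(1) rot_deriv_vert(1)])
    show "rot_deriv rot2 (Yp l m) d2" unfolding d2_def by (rule rot_deriv_Yp[OF rot_deriv_horiz(2) rot_deriv_vert(2)])
    show "continuous_on S2 d1" "continuous_on S2 d2"
      unfolding d1_def d2_def by (intro continuous_intros)+
    fix x
    have "- \<i> * d1 x + d2 x = - Nlm l m * (horiz x ^ m * (horiz x * Qlm l (Suc m) x))"
      unfolding d1_def d2_def by (simp add: horiz_def algebra_simps)
    also have "\<dots> = of_real (ladder (int l) (int m)) * Yp l (Suc m) x"
    proof (cases "m < l")
      case True
      then show ?thesis by (simp add: Yp_eq Nlm_Suc[OF True] algebra_simps)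
    next
      case False
      then show ?thesis by (simp add: Yp_eq Qlm_0)
    qed
    finally show "- \<i> * d1 x + d2 x = of_real (ladder (int l) (int m)) * Yp l (Suc m) x" .
    assume "0 < m" and x: "x \<in> S2"
    then obtain k where m: "m = Suc k" by (cases m) auto
    have kl: "k < l" using m assms by simp
    \<comment> \<open>The terms with \<open>vert\<close> add up, and those with the first two
      coordinates combine to the conjugate of \<open>horiz\<close>; on the sphere its product with
      \<open>horiz\<close> is \<open>1 - (vert x)\<^sup>2\<close>.\<close>
    have "- \<i> * d1 x - d2 x = Nlm l m * (- 2 * of_nat m * horiz x ^ k * vert x * Qlm l m x + horiz x ^ k * (Qlm l (Suc m) x * (horiz x * cnj (horiz x))))"
      unfolding d1_def d2_def m by (simp add: horiz_def algebra_simps)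
    also have "\<dots> = Nlm l m * horiz x ^ k * ((1 - (vert x)\<^sup>2) * Qlm l (Suc m) x - 2 * of_nat m * vert x * Qlm l m x)"
      unfolding S2_horiz_vert[OF x] by (simp add: algebra_simps)
    also have "(1 - (vert x)\<^sup>2) * Qlm l (Suc m) x - 2 * of_nat m * vert x * Qlm l m x =
       of_real ((1 - (x $ 3)\<^sup>2) * poly (legendre_core l (Suc m)) (x $ 3) - 2 * real m * x $ 3 * poly (legendre_core l m) (x $ 3))"
      by (simp add: vert_def Qlm_def)
    also have "\<dots> = of_real (- (real l + real m) * (real l - real m + 1) * poly (legendre_core l (m - 1)) (x $ 3))"
      using \<open>0 < m\<close> assms by (subst legendre_ode) auto
    also have "\<dots> = - of_real ((real l + real m) * (real l - real m + 1)) * Qlm l k x"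
      by (simp only: Qlm_def m of_real_mult of_real_minus mult_minus_left diff_Suc_1)
    also have "(real l + real m) * (real l - real m + 1) = ladder (int l) (int k) * ladder (int l) (int k)"
    proof -
      have "ladder (int l) (int k) * ladder (int l) (int k) = of_int ((int l - int k) * (int l + int k + 1))"
        unfolding ladder_def real_sqrt_mult_self using kl by (intro abs_of_nonneg) simp
      then show ?thesis by (simp add: m algebra_simps)
    qed
    also have "Nlm l m * horiz x ^ k * (- of_real (ladder (int l) (int k) * ladder (int l) (int k)) * Qlm l k x) = of_real (ladder (int l) (int k)) * Yp l k x"
      unfolding Yp_eq Nlm_Suc[OF kl] m by (simp add: mult_ac)
    finally show "- \<i> * d1 x - d2 x = of_real (ladder (int l) (int m - 1)) * Yp l (m - 1) x"
      by (simp add: m)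
  qed
qed

lemma cnj_Yp_0: "cnj (Yp l 0 x) = Yp l 0 x"
  by (simp add: Yp_def)

text \<open>For negative weights \<open>Y\<close> is a signed conjugate, and conjugation turns the
  lowering relation of \<open>Yp\<close> into a raising relation. Outside the weight range both
  sides vanish, at \<open>m = - l - 1\<close> thanks to \<open>ladder\<close>.\<close>

lemma Y_raise:
  obtains d1 d2 where "rot_deriv rot1 (Y l m) d1" "rot_deriv rot2 (Y l m) d2" "continuous_on S2 d1" "continuous_on S2 d2"
    "\<And>x. x \<in> S2 \<Longrightarrow> - \<i> * d1 x + d2 x = of_real (ladder (int l) m) * Y l (m + 1) x"
proof -
  consider "\<bar>m\<bar> > int l" | "0 \<le> m" "m \<le> int l" | "m < 0" "- m \<le> int l" by linarith
  then show ?thesis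
  proof cases
    case 1
    then have Y0: "Y l m = (\<lambda>x. 0)" by (auto simp: Y_def)
    have "m + 1 = - int l \<or> \<bar>m + 1\<bar> > int l" using 1 by linarith
    then have "of_real (ladder (int l) m) * Y l (m + 1) x = 0" for x
    proof
      assume "m + 1 = - int l"
      then have "m = - int l - 1" by simp
      then show ?thesis by simp
    qed (simp add: Y_def)
    then show ?thesis using that[of "\<lambda>x. 0" "\<lambda>x. 0"] by (simp add: Y0 rot_deriv_zero)
  next
    case 2
    define k where "k = nat m"
    have k: "m = int k" "k \<le> l" using 2 by (auto simp: k_def)
    have Yk: "Y l m = Yp l k" using k by (auto simp: Y_def)
    have Yk1: "Y l (m + 1) x = Yp l (Suc k) x" for x
      using k by (auto simp: Y_def Yp_0 nat_add_distrib)
    obtain d1 d2 where "rot_deriv rot1 (Yp l k) d1" "rot_deriv rot2 (Yp l k) d2" "continuous_on S2 d1" "continuous_on S2 d2"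
      "\<And>x. - \<i> * d1 x + d2 x = of_real (ladder (int l) (int k)) * Yp l (Suc k) x"
      using Yp_ladder[OF k(2)] by metis
    then show ?thesis using that[of d1 d2] by (simp add: Yk Yk1 k(1)[symmetric])
  next
    case 3
    define k where "k = nat (- m)"
    have k: "m = - int k" "k \<le> l" "0 < k" using 3 by (auto simp: k_def)
    have Yk: "Y l m = (\<lambda>x. (-1) ^ k * cnj (Yp l k x))" using k by (auto simp: Y_def)
    have Yk1: "Y l (m + 1) x = (-1) ^ (k - 1) * cnj (Yp l (k - 1) x)" for x
    \<comment> \<open>For \<open>k = 1\<close> raising arrives at weight 0, which \<open>Y\<close>
      defines without conjugation; the two forms agree since \<open>Yp l 0\<close> is real.\<close>
    proof (cases "k = 1")
      case True
      then show ?thesis using k by (simp add: Y_def cnj_Yp_0)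
    next
      case False
      then have "\<not> m + 1 \<ge> 0" "\<not> \<bar>m + 1\<bar> > int l" "nat (- (m + 1)) = k - 1" using k by auto
      then show ?thesis by (simp add: Y_def)
    qed
    obtain d1 d2 where d: "rot_deriv rot1 (Yp l k) d1" "rot_deriv rot2 (Yp l k) d2" "continuous_on S2 d1" "continuous_on S2 d2"
      "\<And>x. x \<in> S2 \<Longrightarrow> - \<i> * d1 x - d2 x = of_real (ladder (int l) (int k - 1)) * Yp l (k - 1) x"
      using Yp_ladder[OF k(2)] k(3) by metis
    have r: "ladder (int l) m = ladder (int l) (int k - 1)"
      using ladder_reflect[of "int l" m] by (simp add: k(1))
    have s: "(-1::complex) ^ k = - ((-1) ^ (k - 1))" using k(3) by (cases k) auto
    show ?thesis
    proof (rule that[of "\<lambda>x. (-1) ^ k * cnj (d1 x)" "\<lambda>x. (-1) ^ k * cnj (d2 x)"])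
      show "rot_deriv rot1 (Y l m) (\<lambda>x. (-1) ^ k * cnj (d1 x))" "rot_deriv rot2 (Y l m) (\<lambda>x. (-1) ^ k * cnj (d2 x))"
        unfolding Yk by (intro rot_deriv_cmult rot_deriv_cnj d)+
      show "continuous_on S2 (\<lambda>x. (-1) ^ k * cnj (d1 x))" "continuous_on S2 (\<lambda>x. (-1) ^ k * cnj (d2 x))"
        by (intro continuous_intros d)+
      fix x assume x: "x \<in> S2"
      have "- \<i> * ((-1) ^ k * cnj (d1 x)) + (-1) ^ k * cnj (d2 x) = - ((-1) ^ k * cnj (- \<i> * d1 x - d2 x))"
        by (simp add: algebra_simps)
      also have "\<dots> = of_real (ladder (int l) m) * Y l (m + 1) x"
        unfolding d(5)[OF x] Yk1 s r by simp
      finally show "- \<i> * ((-1) ^ k * cnj (d1 x)) + (-1) ^ k * cnj (d2 x) = of_real (ladder (int l) m) * Y l (m + 1) x" .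
    qed
  qed
qed

text \<open>Rotation about the third axis multiplies \<open>horiz\<close> by e^(i t) and fixes
  \<open>vert\<close>.\<close>

lemma Y_weight: "rot_deriv rot3 (Y l m) (\<lambda>x. \<i> * of_int m * Y l m x)"
proof -
  have p: "rot_deriv rot3 (Yp l k) (\<lambda>x. \<i> * of_nat k * Yp l k x)" for k
  proof -
    have "(\<lambda>x. Nlm l k * (of_nat k * horiz x ^ (k - 1) * (\<i> * horiz x) * Qlm l k x + horiz x ^ k * (Qlm l (Suc k) x * 0))) = (\<lambda>x. \<i> * of_nat k * Yp l k x)"
      by (cases k) (auto simp: Yp_eq fun_eq_iff)
    with rot_deriv_Yp[OF rot_deriv_horiz(3) rot_deriv_vert(3), of l k] show ?thesis by simp
  qed
  consider "\<bar>m\<bar> > int l" | "0 \<le> m" "m \<le> int l" | "m < 0" "- m \<le> int l" by linarith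
  then show ?thesis
  proof cases
    case 1
    then have "Y l m = (\<lambda>x. 0)" by (auto simp: Y_def)
    then show ?thesis by (simp add: rot_deriv_zero)
  next
    case 2
    then have "Y l m = Yp l (nat m)" by (auto simp: Y_def)
    with p[of "nat m"] 2 show ?thesis by simp
  next
    case 3
    define k where "k = nat (- m)"
    have k: "m = - int k" "k \<le> l" "0 < k" using 3 by (auto simp: k_def)
    have Yk: "Y l m = (\<lambda>x. (-1) ^ k * cnj (Yp l k x))" using k by (auto simp: Y_def)
    have "rot_deriv rot3 (Y l m) (\<lambda>x. (-1) ^ k * cnj (\<i> * of_nat k * Yp l k x))"
      unfolding Yk by (intro rot_deriv_cmult rot_deriv_cnj p)
    also have "(\<lambda>x. (-1) ^ k * cnj (\<i> * of_nat k * Yp l k x)) = (\<lambda>x. \<i> * of_int m * Y l m x)"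
      by (simp only: Yk) (simp add: k(1) fun_eq_iff)
    finally show ?thesis .
  qed
qed

section \<open>Invariance of moments and cumulants\<close>

text \<open>Each index lies in exactly one block, and no other block depends on it. Sorting the sum
  over \<open>k\<close> by blocks leaves the vanishing sum of a block times the remaining factors,
  so every partition contributes 0 separately. The free \<open>r\<close> and \<open>v\<close> cover
  raising and weight alike.\<close>

lemma cumulant_derivation:
  fixes e :: "nat set \<Rightarrow> (nat \<Rightarrow> int) \<Rightarrow> complex"
  assumes "finite I"
    and loc: "\<And>B m m'. (\<And>i. i \<in> B \<Longrightarrow> m i = m' i) \<Longrightarrow> e B m = e B m'"
    and rot_deriv: "\<And>B. B \<subseteq> I \<Longrightarrow> (\<Sum>k\<in>B. r k * e B (m(k := v k))) = 0"
  shows "(\<Sum>k\<in>I. r k * (\<Sum>\<pi>\<in>{\<pi>. partition_on I \<pi>}. c \<pi> * (\<Prod>B\<in>\<pi>. e B (m(k := v k))))) = 0"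
proof -
  have "(\<Sum>k\<in>I. r k * (\<Prod>B\<in>\<pi>. e B (m(k := v k)))) = 0" if p: "partition_on I \<pi>" for \<pi>
  proof -
    have fin: "finite \<pi>" by (rule finite_elements[OF assms(1) p])
    have fin': "finite B" if "B \<in> \<pi>" for B
      using that partition_onD1[OF p] assms(1) by (auto intro: finite_subset)
    have disj: "B = B'" if "B \<in> \<pi>" "B' \<in> \<pi>" "k \<in> B" "k \<in> B'" for B B' k
      using partition_onD2[OF p] that by (auto simp: disjoint_def)
    have "(\<Sum>k\<in>I. r k * (\<Prod>B\<in>\<pi>. e B (m(k := v k)))) = (\<Sum>k\<in>\<Union>\<pi>. r k * (\<Prod>B\<in>\<pi>. e B (m(k := v k))))"
      using partition_onD1[OF p] by simp
    also have "\<dots> = (\<Sum>B0\<in>\<pi>. \<Sum>k\<in>B0. r k * (\<Prod>B\<in>\<pi>. e B (m(k := v k))))"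
      using fin fin' disj by (subst sum.Union_disjoint) auto
    also have "\<dots> = (\<Sum>B0\<in>\<pi>. (\<Prod>B\<in>\<pi> - {B0}. e B m) * (\<Sum>k\<in>B0. r k * e B0 (m(k := v k))))"
    proof (rule sum.cong[OF refl])
      fix B0 assume B0: "B0 \<in> \<pi>"
      have "(\<Prod>B\<in>\<pi>. e B (m(k := v k))) = e B0 (m(k := v k)) * (\<Prod>B\<in>\<pi> - {B0}. e B m)" if k: "k \<in> B0" for k
      proof -
        have "(\<Prod>B\<in>\<pi>. e B (m(k := v k))) = e B0 (m(k := v k)) * (\<Prod>B\<in>\<pi> - {B0}. e B (m(k := v k)))"
          by (rule prod.remove[OF fin B0])
        also have "(\<Prod>B\<in>\<pi> - {B0}. e B (m(k := v k))) = (\<Prod>B\<in>\<pi> - {B0}. e B m)"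
          using disj[OF _ B0 _ k] by (intro prod.cong refl loc) auto
        finally show ?thesis .
      qed
      then show "(\<Sum>k\<in>B0. r k * (\<Prod>B\<in>\<pi>. e B (m(k := v k)))) = (\<Prod>B\<in>\<pi> - {B0}. e B m) * (\<Sum>k\<in>B0. r k * e B0 (m(k := v k)))"
        by (simp add: sum_distrib_left mult_ac)
    qed
    also have "\<dots> = 0"
    proof (rule sum.neutral, rule ballI)
      fix B0 assume "B0 \<in> \<pi>"
      then have "B0 \<subseteq> I" using partition_onD1[OF p] by auto
      from rot_deriv[OF this] show "(\<Prod>B\<in>\<pi> - {B0}. e B m) * (\<Sum>k\<in>B0. r k * e B0 (m(k := v k))) = 0" by simp
    qed
    finally show ?thesis .
  qed
  then have "(\<Sum>\<pi>\<in>{\<pi>. partition_on I \<pi>}. c \<pi> * (\<Sum>k\<in>I. r k * (\<Prod>B\<in>\<pi>. e B (m(k := v k))))) = 0"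
    by simp
  also have "(\<Sum>\<pi>\<in>{\<pi>. partition_on I \<pi>}. c \<pi> * (\<Sum>k\<in>I. r k * (\<Prod>B\<in>\<pi>. e B (m(k := v k))))) =
     (\<Sum>k\<in>I. r k * (\<Sum>\<pi>\<in>{\<pi>. partition_on I \<pi>}. c \<pi> * (\<Prod>B\<in>\<pi>. e B (m(k := v k)))))"
    unfolding sum_distrib_left by (subst sum.swap) (simp add: mult_ac)
  finally show ?thesis .
qed

text \<open>The trivial update in the weight hypothesis makes it an instance of the same scheme as
  raising, with \<open>v k = m k\<close>. Total weight times the tensor vanishes, so one of the two
  factors is 0.\<close>

lemma invariant_tensorI:
  assumes "3 \<le> n"
    and loc: "\<And>m m'. (\<And>i. i \<in> {1..n} \<Longrightarrow> m i = m' i) \<Longrightarrow> e m = e m'"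
    and raise: "\<And>m. (\<Sum>k\<in>{1..n}. of_real (ladder (int (l k)) (m k)) * e (m(k := m k + 1))) = 0"
    and wt: "\<And>m. (\<Sum>k\<in>{1..n}. of_int (m k) * e (m(k := m k))) = 0"
  shows "invariant_tensor 2 n l (int (l 1)) (\<lambda>\<mu> m. e (m(1 := \<mu>)))"
proof -
  have split: "{1..n} = insert 1 {2..n}" using assms(1) by auto
  have "of_real (ladder (int (l 1)) \<mu>) * e (m(1 := \<mu> + 1))
       + (\<Sum>i\<in>{2..n}. of_real (ladder (int (l i)) (m i)) * e (m(i := m i + 1, 1 := \<mu>))) = 0" for \<mu> m
  proof -
    have "(\<Sum>i\<in>{2..n}. of_real (ladder (int (l i)) (m i)) * e (m(i := m i + 1, 1 := \<mu>)))
      = (\<Sum>i\<in>{2..n}. of_real (ladder (int (l i)) ((m(1 := \<mu>)) i)) * e ((m(1 := \<mu>))(i := (m(1 := \<mu>)) i + 1)))"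
      by (intro sum.cong refl) (auto simp: fun_upd_twist)
    then show ?thesis using raise[of "m(1 := \<mu>)"] unfolding split by simp
  qed
  moreover have "e (m(1 := \<mu>)) = 0" if "\<mu> + (\<Sum>i\<in>{2..n}. m i) \<noteq> 0" for \<mu> m
  proof -
    have "(\<Sum>k\<in>{1..n}. of_int ((m(1 := \<mu>)) k)) * e (m(1 := \<mu>)) = 0"
      using wt[of "m(1 := \<mu>)"] by (simp only: fun_upd_triv sum_distrib_right)
    moreover have "(\<Sum>k\<in>{1..n}. of_int ((m(1 := \<mu>)) k) :: complex) = of_int (\<mu> + (\<Sum>i\<in>{2..n}. m i))"
      unfolding split by simp
    ultimately show ?thesis using that by (metis mult_eq_0_iff of_int_eq_0_iff)
  qed
  moreover have "e (m(1 := \<mu>)) = e (m'(1 := \<mu>))" if "\<forall>i\<in>{2..n}. m i = m' i" for \<mu> m m'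
    using that by (intro loc) auto
  ultimately show ?thesis unfolding invariant_tensor_def by blast
qed

section \<open>Infinitesimal invariance of the moments and cumulants\<close>

context isotropic_field
begin

lemma moment_cong:
  assumes "\<And>i x. i \<in> B \<Longrightarrow> x \<in> S2 \<Longrightarrow> f i x = f' i x"
  shows "(\<integral>\<omega>. (\<Prod>i\<in>B. field_coeff T (f i) \<omega>) \<partial>M) = (\<integral>\<omega>. (\<Prod>i\<in>B. field_coeff T (f' i) \<omega>) \<partial>M)"
proof -
  have "field_coeff T (f i) \<omega> = field_coeff T (f' i) \<omega>" if "i \<in> B" for i \<omega>
    unfolding field_coeff_def using assms[OF that] by (intro Bochner_Integration.integral_cong) auto
  then show ?thesis by simp
qed

text \<open>Multilinearity read off from the kernel representation; it recombines derivatives about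
  different axes into ladder operators.\<close>

lemma moment_linear:
  assumes B: "finite B" "card B \<le> n" "k \<in> B" and f: "\<And>i. i \<in> B \<Longrightarrow> continuous_on S2 (f i)"
    and g: "continuous_on S2 g1" "continuous_on S2 g2"
    and lin: "\<And>x. x \<in> S2 \<Longrightarrow> g x = a * g1 x + b * g2 x"
  shows "(\<integral>\<omega>. (\<Prod>i\<in>B. field_coeff T ((f(k := g)) i) \<omega>) \<partial>M) =
     a * (\<integral>\<omega>. (\<Prod>i\<in>B. field_coeff T ((f(k := g1)) i) \<omega>) \<partial>M) + b * (\<integral>\<omega>. (\<Prod>i\<in>B. field_coeff T ((f(k := g2)) i) \<omega>) \<partial>M)"
proof -
  have c: "continuous_on S2 ((f(k := h)) i)" if "continuous_on S2 h" "i \<in> B" for h i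
    using f that by auto
  have cg: "continuous_on S2 (\<lambda>x. a * g1 x + b * g2 x)" using g by (intro continuous_intros)
  have "(\<integral>\<omega>. (\<Prod>i\<in>B. field_coeff T ((f(k := g)) i) \<omega>) \<partial>M) = (\<integral>\<omega>. (\<Prod>i\<in>B. field_coeff T ((f(k := \<lambda>x. a * g1 x + b * g2 x)) i) \<omega>) \<partial>M)"
    using lin by (intro moment_cong) auto
  also have "\<dots> = (\<integral>x. complex_of_real (corr B x) * (\<Prod>i\<in>B. (f(k := \<lambda>x. a * g1 x + b * g2 x)) i (x i)) \<partial>S2_prod B)"
    by (rule moment_kernel(1)[OF B(1,2) c[OF cg]])
  also have "\<dots> = (\<integral>x. a * (complex_of_real (corr B x) * (\<Prod>i\<in>B. (f(k := g1)) i (x i))) + b * (complex_of_real (corr B x) * (\<Prod>i\<in>B. (f(k := g2)) i (x i))) \<partial>S2_prod B)"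
  proof -
    have "(\<Prod>i\<in>B. (f(k := h)) i (x i)) = h (x k) * (\<Prod>i\<in>B - {k}. f i (x i))" for h x
      using B by (subst prod.remove[OF B(1,3)]) (auto intro!: prod.cong)
    then show ?thesis by (simp add: algebra_simps)
  qed
  also have "\<dots> = a * (\<integral>x. complex_of_real (corr B x) * (\<Prod>i\<in>B. (f(k := g1)) i (x i)) \<partial>S2_prod B)
     + b * (\<integral>x. complex_of_real (corr B x) * (\<Prod>i\<in>B. (f(k := g2)) i (x i)) \<partial>S2_prod B)"
    using moment_kernel(2)[OF B(1,2) c[OF g(1)]] moment_kernel(2)[OF B(1,2) c[OF g(2)]]
    by (subst Bochner_Integration.integral_add) auto
  finally show ?thesis
    using moment_kernel(1)[OF B(1,2) c[OF g(1)]] moment_kernel(1)[OF B(1,2) c[OF g(2)]] by simp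
qed

text \<open>Rotating all test functions leaves the kernel integral unchanged for every
  \<open>t\<close>. Its expansion has a uniform error of order \<open>t\<^sup>2\<close>, so the
  coefficient of \<open>t\<close> must vanish, and by Leibniz' rule this coefficient is the stated
  sum.\<close>

lemma moment_derivation:
  fixes B :: "nat set"
  assumes B: "finite B" "card B \<le> n" and R: "\<And>t. R t \<in> SO3"
    and f: "\<And>i. i \<in> B \<Longrightarrow> continuous_on S2 (f i)" and f': "\<And>i. i \<in> B \<Longrightarrow> continuous_on S2 (f' i)"
    and rot_deriv: "\<And>i. i \<in> B \<Longrightarrow> rot_deriv R (f i) (f' i)"
  shows "(\<Sum>k\<in>B. \<integral>\<omega>. (\<Prod>i\<in>B. field_coeff T ((f(k := f' k)) i) \<omega>) \<partial>M) = 0"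
proof -
  interpret PB: finite_measure "S2_prod B" by (rule finite_measure_S2_prod[OF B(1)])
  define u1 where "u1 x = (\<Sum>k\<in>B. \<Prod>i\<in>B. (f(k := f' k)) i (x i))" for x
  have c: "continuous_on S2 ((f(k := f' k)) i)" if "k \<in> B" "i \<in> B" for k i
    using f f' that by auto
  have I1: "integrable (S2_prod B) (\<lambda>x. complex_of_real (corr B x) * u1 x)"
    unfolding u1_def sum_distrib_left by (intro Bochner_Integration.integrable_sum moment_kernel(2) B c)
  have "(\<Sum>k\<in>B. \<integral>\<omega>. (\<Prod>i\<in>B. field_coeff T ((f(k := f' k)) i) \<omega>) \<partial>M) = (\<Sum>k\<in>B. \<integral>x. complex_of_real (corr B x) * (\<Prod>i\<in>B. (f(k := f' k)) i (x i)) \<partial>S2_prod B)"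
    by (intro sum.cong refl moment_kernel(1) B c)
  also have "\<dots> = (\<integral>x. complex_of_real (corr B x) * u1 x \<partial>S2_prod B)"
    unfolding u1_def sum_distrib_left by (intro Bochner_Integration.integral_sum[symmetric] moment_kernel(2) B c)
  also have "\<dots> = 0"
  proof -
    let ?I = "\<integral>x. complex_of_real (corr B x) * u1 x \<partial>S2_prod B"
    have tc: "taylor1 (space (S2_prod B)) (\<lambda>t x. f i (R t *v x i)) (\<lambda>x. f i (x i)) (\<lambda>x. f' i (x i))" if "i \<in> B" for i
      using rot_deriv[OF that] that unfolding rot_deriv_def taylor1_def by (force simp: space_PiM PiE_iff)
    have "taylor1 (space (S2_prod B)) (\<lambda>t x. \<Prod>i\<in>B. f i (R t *v x i)) (\<lambda>x. \<Prod>i\<in>B. f i (x i)) u1"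
      using taylor1_prod[OF B(1) tc] by (rule taylor1_cong) (auto simp: u1_def fun_upd_def intro!: sum.cong prod.cong)
    then obtain C where C: "C \<ge> 0" "\<And>x t. x \<in> space (S2_prod B) \<Longrightarrow> t \<in> {0..1} \<Longrightarrow>
        norm ((\<Prod>i\<in>B. f i (R t *v x i)) - (\<Prod>i\<in>B. f i (x i)) - of_real t * u1 x) \<le> C * t\<^sup>2"
      unfolding taylor1_def by blast
    obtain D where D: "D \<ge> 0" "\<And>x. x \<in> space (S2_prod B) \<Longrightarrow> \<bar>corr B x\<bar> \<le> D" using corr_bounded[OF B] by blast
    define V where "V = measure (S2_prod B) (space (S2_prod B))"
    have bound: "norm ?I \<le> t * (D * C * V)" if t: "0 < t" "t \<le> 1" for t
    proof -
      define h where "h x = complex_of_real (corr B x) * (\<Prod>i\<in>B. f i (R t *v x i)) - complex_of_real (corr B x) * (\<Prod>i\<in>B. f i (x i))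
         - of_real t * (complex_of_real (corr B x) * u1 x)" for x
      have If: "integrable (S2_prod B) (\<lambda>x. complex_of_real (corr B x) * (\<Prod>i\<in>B. f i (x i)))"
        by (intro moment_kernel(2) B f)
      have Ir: "integrable (S2_prod B) (\<lambda>x. complex_of_real (corr B x) * (\<Prod>i\<in>B. f i (R t *v x i)))"
        by (rule moment_kernel(2)[OF B, of "\<lambda>i x. f i (R t *v x)"]) (intro continuous_rotate f R)
      have Ih: "integrable (S2_prod B) h" unfolding h_def
        using If Ir I1 by (intro Bochner_Integration.integrable_diff integrable_mult_right) auto
      \<comment> \<open>The first two parts of \<open>h\<close> have equal integrals by rotation
        invariance; the linear part remains.\<close>
      have "integral\<^sup>L (S2_prod B) h = - (of_real t * ?I)"
        unfolding h_def using If Ir I1 moment_kernel_rotate[OF B, of f "R t"] f R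
        by (simp add: Bochner_Integration.integral_diff)
      then have "t * norm ?I = norm (integral\<^sup>L (S2_prod B) h)" using t by (simp add: norm_mult)
      also have "\<dots> \<le> (\<integral>x. norm (h x) \<partial>S2_prod B)" by (rule integral_norm_bound)
      also have "\<dots> \<le> (\<integral>x. D * (C * t\<^sup>2) \<partial>S2_prod B)"
      proof (rule integral_mono)
        fix x assume x: "x \<in> space (S2_prod B)"
        have "h x = complex_of_real (corr B x) * ((\<Prod>i\<in>B. f i (R t *v x i)) - (\<Prod>i\<in>B. f i (x i)) - of_real t * u1 x)"
          by (simp add: h_def algebra_simps)
        then show "norm (h x) \<le> D * (C * t\<^sup>2)"
          using D C(2)[OF x, of t] D(2)[OF x] t by (simp add: norm_mult mult_mono)
      qed (use Ih in auto)
      also have "\<dots> = t * (t * (D * C * V))" by (simp add: V_def power2_eq_square)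
      finally show ?thesis using t by simp
    qed
    \<comment> \<open>The bound holds for all \<open>t\<close> in the interval (0, 1] and tends to 0
      from the right, the side on which \<open>taylor1\<close> expands.\<close>
    have "norm ?I \<le> 0"
    proof (rule tendsto_lowerbound)
      show "((\<lambda>t. t * (D * C * V)) \<longlongrightarrow> 0) (at_right 0)"
        by (rule tendsto_eq_intros | simp)+
      show "eventually (\<lambda>t. norm ?I \<le> t * (D * C * V)) (at_right 0)"
        unfolding eventually_at_right_field by (intro exI[of _ 1]) (auto intro!: bound)
    qed simp
    then show ?thesis by simp
  qed
  finally show ?thesis .
qed

definition coeff_moment :: "(nat \<Rightarrow> nat) \<Rightarrow> nat set \<Rightarrow> (nat \<Rightarrow> int) \<Rightarrow> complex" where
  "coeff_moment l B m = (\<integral>\<omega>. (\<Prod>i\<in>B. alm T (l i) (m i) \<omega>) \<partial>M)"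

lemma coeff_moment_eq: "coeff_moment l B m = (\<integral>\<omega>. (\<Prod>i\<in>B. field_coeff T (\<lambda>x. cnj (Y (l i) (m i) x)) \<omega>) \<partial>M)"
  by (simp add: coeff_moment_def alm_def field_coeff_def)

lemma coeff_moment_upd: "coeff_moment l B (m(k := v)) =
   (\<integral>\<omega>. (\<Prod>i\<in>B. field_coeff T (((\<lambda>i x. cnj (Y (l i) (m i) x))(k := \<lambda>x. cnj (Y (l k) v x))) i) \<omega>) \<partial>M)"
  unfolding coeff_moment_eq by (intro Bochner_Integration.integral_cong refl prod.cong) auto

lemma continuous_cnj_Y: "continuous_on S2 (\<lambda>x. cnj (Y l m x))"
  by (intro continuous_intros continuous_Y)

lemma coeff_moment_weight:
  assumes B: "finite B" "card B \<le> n"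
  shows "(\<Sum>k\<in>B. of_int (m k) * coeff_moment l B (m(k := m k))) = 0"
proof -
  let ?y = "\<lambda>i x. cnj (Y (l i) (m i) x)"
  let ?d = "\<lambda>i x. cnj (\<i> * of_int (m i) * Y (l i) (m i) x)"
  have "(\<Sum>k\<in>B. \<integral>\<omega>. (\<Prod>i\<in>B. field_coeff T ((?y(k := ?d k)) i) \<omega>) \<partial>M) = 0"
  proof (rule moment_derivation[where R=rot3, OF B rot_SO3(3)])
    show "continuous_on S2 (?d i)" for i by (intro continuous_intros continuous_Y)
  qed (intro continuous_cnj_Y rot_deriv_cnj Y_weight)+
  also have "(\<Sum>k\<in>B. \<integral>\<omega>. (\<Prod>i\<in>B. field_coeff T ((?y(k := ?d k)) i) \<omega>) \<partial>M) = (\<Sum>k\<in>B. - \<i> * (of_int (m k) * coeff_moment l B (m(k := m k))))"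
  proof (rule sum.cong[OF refl])
    fix k assume k: "k \<in> B"
    \<comment> \<open>With both functions equal and \<open>b = 0\<close>,
      \<open>moment_linear\<close> is homogeneity in one slot. Conjugation turns the eigenvalue
      \<open>\<i> * m\<close> into \<open>- \<i> * m\<close>.\<close>
    show "(\<integral>\<omega>. (\<Prod>i\<in>B. field_coeff T ((?y(k := ?d k)) i) \<omega>) \<partial>M) = - \<i> * (of_int (m k) * coeff_moment l B (m(k := m k)))"
      unfolding coeff_moment_upd
      by (subst moment_linear[OF B k, of ?y "?y k" "?y k" _ "- \<i> * of_int (m k)" 0]) (auto intro: continuous_cnj_Y)
  qed
  finally show ?thesis by (simp add: sum_distrib_left[symmetric] sum_negf)
qed

text \<open>The derivatives about the first two axes give vanishing sums separately. The conjugate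
  of \<open>Y_raise\<close> combines them with the factors \<open>\<i>\<close> and 1 into the
  harmonic of weight \<open>m k + 1\<close>.\<close>

lemma coeff_moment_raise:
  assumes B: "finite B" "card B \<le> n"
  shows "(\<Sum>k\<in>B. of_real (ladder (int (l k)) (m k)) * coeff_moment l B (m(k := m k + 1))) = 0"
proof -
  let ?y = "\<lambda>i x. cnj (Y (l i) (m i) x)"
  have "\<forall>k. \<exists>d1 d2. rot_deriv rot1 (Y (l k) (m k)) d1 \<and> rot_deriv rot2 (Y (l k) (m k)) d2 \<and> continuous_on S2 d1 \<and> continuous_on S2 d2 \<and>
    (\<forall>x\<in>S2. - \<i> * d1 x + d2 x = of_real (ladder (int (l k)) (m k)) * Y (l k) (m k + 1) x)"
    by (metis Y_raise)
  then obtain d1 d2 where d: "\<And>k. rot_deriv rot1 (Y (l k) (m k)) (d1 k)" "\<And>k. rot_deriv rot2 (Y (l k) (m k)) (d2 k)"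
    "\<And>k. continuous_on S2 (d1 k)" "\<And>k. continuous_on S2 (d2 k)"
    "\<And>k x. x \<in> S2 \<Longrightarrow> - \<i> * d1 k x + d2 k x = of_real (ladder (int (l k)) (m k)) * Y (l k) (m k + 1) x"
    by metis
  let ?F = "\<lambda>h. \<integral>\<omega>. (\<Prod>i\<in>B. field_coeff T (h i) \<omega>) \<partial>M"
  let ?e1 = "\<lambda>k x. cnj (d1 k x)" and ?e2 = "\<lambda>k x. cnj (d2 k x)"
  have cc: "continuous_on S2 (?e1 k)" "continuous_on S2 (?e2 k)" for k
    by (intro continuous_intros d)+
  have 1: "(\<Sum>k\<in>B. ?F (?y(k := ?e1 k))) = 0"
    using B by (intro moment_derivation[where R=rot1] rot_SO3 continuous_cnj_Y rot_deriv_cnj cc d)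
  have 2: "(\<Sum>k\<in>B. ?F (?y(k := ?e2 k))) = 0"
    using B by (intro moment_derivation[where R=rot2] rot_SO3 continuous_cnj_Y rot_deriv_cnj cc d)
  have "of_real (ladder (int (l k)) (m k)) * coeff_moment l B (m(k := m k + 1)) = \<i> * ?F (?y(k := ?e1 k)) + 1 * ?F (?y(k := ?e2 k))"
    if k: "k \<in> B" for k
  proof -
    let ?g = "\<lambda>x. of_real (ladder (int (l k)) (m k)) * cnj (Y (l k) (m k + 1) x)"
    have "?g x = \<i> * ?e1 k x + 1 * ?e2 k x" if "x \<in> S2" for x
      using arg_cong[OF d(5)[OF that, of k], of cnj] by (simp add: add.commute)
    then have "?F (?y(k := ?g)) = \<i> * ?F (?y(k := ?e1 k)) + 1 * ?F (?y(k := ?e2 k))"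
      by (intro moment_linear[OF B k continuous_cnj_Y cc])
    moreover have "?F (?y(k := ?g)) = of_real (ladder (int (l k)) (m k)) * coeff_moment l B (m(k := m k + 1))"
      unfolding coeff_moment_upd
      by (subst moment_linear[OF B k, of ?y "\<lambda>x. cnj (Y (l k) (m k + 1) x)" "?y k" _ "of_real (ladder (int (l k)) (m k))" 0]) (auto intro: continuous_cnj_Y)
    ultimately show ?thesis by simp
  qed
  then have "(\<Sum>k\<in>B. of_real (ladder (int (l k)) (m k)) * coeff_moment l B (m(k := m k + 1))) =
     \<i> * (\<Sum>k\<in>B. ?F (?y(k := ?e1 k))) + (\<Sum>k\<in>B. ?F (?y(k := ?e2 k)))"
    by (simp add: sum.distrib sum_distrib_left)
  then show ?thesis unfolding 1 2 by simp
qed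

lemma coeff_moment_local: "(\<And>i. i \<in> B \<Longrightarrow> m i = m' i) \<Longrightarrow> coeff_moment l B m = coeff_moment l B m'"
  unfolding coeff_moment_def by (intro Bochner_Integration.integral_cong refl prod.cong) auto

lemma invariant_tensor_moment:
  assumes "3 \<le> n"
  shows "invariant_tensor 2 n l (int (l 1)) (\<lambda>\<mu> m. coeff_moment l {1..n} (m(1 := \<mu>)))"
  using assms by (intro invariant_tensorI coeff_moment_local coeff_moment_raise coeff_moment_weight) auto

text \<open>A block of a partition has at most \<open>n\<close> elements, so its moment exists and
  obeys both identities; \<open>cumulant_derivation\<close> assembles the blocks.\<close>

lemma invariant_tensor_cumulant:
  assumes "3 \<le> n"
  shows "invariant_tensor 2 n l (int (l 1)) (\<lambda>\<mu> m. cumulant M (\<lambda>i. alm T (l i) ((m(1 := \<mu>)) i)) {1..n})"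
proof -
  define cum where "cum m = (\<Sum>\<pi>\<in>{\<pi>. partition_on {1..n} \<pi>}.
     ((-1) ^ (card \<pi> - 1) * of_nat (fact (card \<pi> - 1))) * (\<Prod>B\<in>\<pi>. coeff_moment l B m))" for m
  have cum: "cumulant M (\<lambda>i. alm T (l i) (m i)) {1..n} = cum m" for m
    by (simp add: cumulant_def cum_def coeff_moment_def)
  have card: "finite B" "card B \<le> n" if "B \<subseteq> {1..n}" for B
    using that card_mono[OF _ that] finite_subset[OF that] by auto
  have "invariant_tensor 2 n l (int (l 1)) (\<lambda>\<mu> m. cum (m(1 := \<mu>)))"
  proof (rule invariant_tensorI[OF assms])
    fix m m' :: "nat \<Rightarrow> int" assume *: "\<And>i. i \<in> {1..n} \<Longrightarrow> m i = m' i"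
    show "cum m = cum m'" unfolding cum_def
    proof (intro sum.cong refl arg_cong[where f="(*) _"] prod.cong coeff_moment_local)
      fix \<pi> B i assume "\<pi> \<in> {\<pi>. partition_on {1..n} \<pi>}" "B \<in> \<pi>" "i \<in> B"
      then have "i \<in> {1..n}" using partition_onD1 by blast
      then show "m i = m' i" by (rule *)
    qed
  next
    fix m
    show "(\<Sum>k\<in>{1..n}. of_real (ladder (int (l k)) (m k)) * cum (m(k := m k + 1))) = 0"
      unfolding cum_def by (intro cumulant_derivation coeff_moment_local coeff_moment_raise card) auto
    show "(\<Sum>k\<in>{1..n}. of_int (m k) * cum (m(k := m k))) = 0"
      unfolding cum_def by (intro cumulant_derivation coeff_moment_local coeff_moment_weight card) auto
  qed
  then show ?thesis by (simp only: cum)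
qed

end

theorem theorem1:
  fixes M :: "'w measure" and T :: "'w \<Rightarrow> real^3 \<Rightarrow> real" and n :: nat
  assumes "prob_space M"
    and "n \<ge> 3"
    and "random_field_S2 M T"
    and "strongly_isotropic M T"
    and "\<forall>x\<in>S2. integrable M (\<lambda>\<omega>. \<bar>T \<omega> x\<bar> ^ n)"
  shows "\<forall>l :: nat \<Rightarrow> nat. \<exists>P PC :: (nat \<Rightarrow> int) \<Rightarrow> complex.
           \<forall>m :: nat \<Rightarrow> int. (\<forall>i\<in>{1..n}. \<bar>m i\<bar> \<le> int (l i)) \<longrightarrow>
             (\<integral>\<omega>. (\<Prod>i\<in>{1..n}. alm T (l i) (m i) \<omega>) \<partial>M) =
               (-1) ^ nat \<bar>m n\<bar> * (\<Sum>lam\<in>lam_set n l. complex_of_real (coupledCG n l m lam) * P lam) \<and>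
             cumulant M (\<lambda>i. alm T (l i) (m i)) {1..n} =
               (-1) ^ nat \<bar>m n\<bar> * (\<Sum>lam\<in>lam_set n l. complex_of_real (coupledCG n l m lam) * PC lam)"
proof
  fix l :: "nat \<Rightarrow> nat"
  interpret isotropic_field M T n
    using assms by (simp add: isotropic_field_def isotropic_field_axioms_def)
  show "\<exists>P PC :: (nat \<Rightarrow> int) \<Rightarrow> complex.
           \<forall>m :: nat \<Rightarrow> int. (\<forall>i\<in>{1..n}. \<bar>m i\<bar> \<le> int (l i)) \<longrightarrow>
             (\<integral>\<omega>. (\<Prod>i\<in>{1..n}. alm T (l i) (m i) \<omega>) \<partial>M) =
               (-1) ^ nat \<bar>m n\<bar> * (\<Sum>lam\<in>lam_set n l. complex_of_real (coupledCG n l m lam) * P lam) \<and>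
             cumulant M (\<lambda>i. alm T (l i) (m i)) {1..n} =
               (-1) ^ nat \<bar>m n\<bar> * (\<Sum>lam\<in>lam_set n l. complex_of_real (coupledCG n l m lam) * PC lam)"
    \<comment> \<open>At \<open>\<mu> = m 1\<close> the update of \<open>m\<close> is trivial, so
      the tensors return the moment and the cumulant themselves.\<close>
    using invariant_expansion[OF invariant_tensor_moment[OF assms(2)] assms(2), of l]
      invariant_expansion[OF invariant_tensor_cumulant[OF assms(2)] assms(2), of l]
    unfolding coeff_moment_def fun_upd_triv by blast
qed

end
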